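(* Let $\mathcal V\subset TM$ be a Goursat bundle of derived length $k$ with decceleration vector $\tau=\mathrm{deccel}(\mathcal V)=\langle\rho_1,\rho_2,\ldots,\rho_k\rangle$, $\rho_k\ge 2$. Let $\{x,\varphi^{1,k},\varphi^{2,k},\ldots,\varphi^{\rho_k,k}\}$ denote the fundamental functions of order $k$ and, for each $j$ in the range $1\le j\le k-1$ for which $\rho_j>0$, let $\{\varphi^{1,j},\ldots,\varphi^{\rho_j,j}\}$ denote the fundamental functions of order $j$, all defined on some open subset $\mathcal U\subseteq M$. Then there is an open, dense subset $\widehat{\mathcal U}\subseteq\mathcal U$ and a section $Y$ of $\mathcal V$ such that on $\widehat{\mathcal U}$, $Yx\ne 0$ and the functions $x$, $\varphi^{l_j,j}_0:=\varphi^{l_j,j}$, together with the functions $$\varphi^{l_j,j}_{s_j+1}=\frac{Y\varphi^{l_j,j}_{s_j}}{Yx},\qquad j\in\{1,\ldots,k\}\text{ with }\rho_j>0,\ \ 1\le l_j\le\rho_j,\ \ 0\le s_j\le j-1,$$ are contact coordinates for $\mathcal V$, identifying it with the partial prolongation $\mathcal C(\tau)$; that is, they are local coordinates in which, on putting $z^{l_j,j}_{s}=\varphi^{l_j,j}_{s}$ ($0\le s\le j$), $\mathcal V$ takes the form $\mathcal C(\tau)$.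
   Context: Everything is smooth ($C^\infty$). $\{X,Y,\ldots\}$ denotes the sub-bundle of $TM$ whose sections are the $C^\infty(M)$-module generated by the listed vector fields. $^\perp$ denotes the annihilator in $T^*M$ of a sub-bundle of $TM$. A first integral of a sub-bundle of $TM$ (equivalently of its annihilator) is a function whose differential lies in the annihilator. **Derived flag and Cauchy bundles.** For $\mathcal V\subset TM$ the structure tensor is $\delta_0:\mathcal V\times\mathcal V\to TM/\mathcal V$, $\delta_0(X,Y)=[X,Y]\bmod\mathcal V$. If it has constant rank, the first derived bundle $\mathcal V^{(1)}$ is the sub-bundle whose sections are generated by sections of $\mathcal V$ and their brackets; iterating gives $\mathcal V=\mathcal V^{(0)}\subset\mathcal V^{(1)}\subset\mathcal V^{(2)}\subset\cdots$. $\mathcal V$ is regular if all the structure tensors of the $\mathcal V^{(i)}$ have constant rank; the derived length is the least $k$ with $\mathcal V^{(k+1)}=\mathcal V^{(k)}$. The Cauchy bundle $\mathrm{Char}\,\mathcal V$ is the bundle (when of constant rank) whose sections are those sections $X$ of $\mathcal V$ with $[X,\Gamma(\mathcal V)]\subseteq\Gamma(\mathcal V)$. $\mathcal V$ is totally regular if it is regular and every $\mathcal V^{(i)}$ has a Cauchy bundle of constant rank. Put $m_i=\dim\mathcal V^{(i)}$, $\chi^i=\dim\mathrm{Char}\,\mathcal V^{(i)}$ (fibre dimensions), and for $1\le j\le k-1$ put $\mathrm{Char}\,\mathcal V^{(j)}_{j-1}=\mathcal V^{(j-1)}\cap\mathrm{Char}\,\mathcal V^{(j)}$ with rank $\chi^j_{j-1}$.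 **Decceleration.** With $\Delta_j=m_j-m_{j-1}$ ($1\le j\le k$) and $\Delta^2_i=\Delta_i-\Delta_{i-1}$ ($2\le i\le k$), $\mathrm{deccel}(\mathcal V)=\langle-\Delta^2_2,-\Delta^2_3,\ldots,-\Delta^2_k,\Delta_k\rangle$. **Partial prolongations.** For a list $\tau=\langle\rho_1,\ldots,\rho_k\rangle$ of non-negative integers with $\rho_k\ge1$, the partial prolongation $\mathcal C(\tau)$ is the distribution $$\mathcal C(\tau)=\Big\{\partial_x+\sum_{j:\rho_j>0}\ \sum_{l_j=1}^{\rho_j}\ \sum_{h=0}^{j-1}z^{l_j,j}_{h+1}\,\partial_{z^{l_j,j}_h},\ \ \partial_{z^{l_j,j}_j}\ (\rho_j>0,\ 1\le l_j\le\rho_j)\Big\}$$ on the space with coordinates $x,\ z^{l_j,j}_h$ ($\rho_j>0$, $1\le l_j\le\rho_j$, $0\le h\le j$). Contact coordinates for $\mathcal V$ are local coordinates on $M$ in which $\mathcal V$ has this form. **Singular variety of a quotient; Weber structures.** For a totally regular $\mathcal W\subset TM$, let $\widehat\pi:TM\to\widehat{TM}:=TM/\mathrm{Char}\,\mathcal W$ be the projection, $\widehat{\mathcal W}=\mathcal W/\mathrm{Char}\,\mathcal W$, and let $\widehat\delta:\widehat{\mathcal W}\times\widehat{\mathcal W}\to\widehat{TM}/\widehat{\mathcal W}$, $\widehat\delta(\widehat\pi X,\widehat\pi Y)=\widehat\pi([X,Y])\bmod\widehat{\mathcal W}$. A line $[\widehat X]\in\mathbb P\widehat{\mathcal W}$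 is singular if the linear map $\widehat Y\mapsto\widehat\delta(\widehat X,\widehat Y)$ has less than generic rank; $\mathrm{Sing}(\widehat{\mathcal W})$ is the set of singular lines. A Weber structure is a totally regular $\mathcal W\subset TM$ of rank $c+q+1$ ($q\ge2$, $c\ge0$), $\dim M=c+2q+1$, with $\dim\mathrm{Char}\,\mathcal W=c$, $\mathcal W^{(1)}=TM$ and $\widehat\Sigma:=\mathrm{Sing}(\widehat{\mathcal W})=\mathbb P\widehat{\mathcal B}\approx\mathbb{RP}^{q-1}$ for some rank $q$ sub-bundle $\widehat{\mathcal B}\subset\widehat{\mathcal W}$ (the singular sub-bundle). Its resolvent bundle $\mathcal R_{\widehat\Sigma}(\mathcal W)\subset\mathcal W$ is the largest sub-bundle with $\widehat\pi(\mathcal R_{\widehat\Sigma}(\mathcal W))=\widehat{\mathcal B}$ (rank $q+c$). The Weber structure is integrable if its resolvent bundle is integrable. **Goursat bundles.** A totally regular $\mathcal V\subset TM$ of derived length $k$, with $\mathcal V^{(k)}=TM$, is a Goursat bundle of type $\tau$ if: (i) $\mathcal V$ has the derived type of a partial prolongation of type $\tau=\mathrm{deccel}(\mathcal V)$, i.e. its ranks $m_i,\chi^i$ agree with those of $\mathcal C(\tau)$; (ii) each $\mathrm{Char}\,\mathcal V^{(i)}_{i-1}$, $1\le i\le k-1$, is an integrable sub-bundle of constant rank agreeing with the corresponding rank for $\mathcal C(\tau)$; (iii) if $\Delta_k>1$, then $\mathcal V^{(k-1)}$ determines an integrable Weber structure on $M$ with singular sub-bundle satisfying $\mathbb P\widehat{\mathcal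 B}\approx\mathbb{RP}^{\Delta_k-1}$. **Fundamental functions** (case $\rho_k\ge2$). Let $\Xi^{(j)}=(\mathrm{Char}\,\mathcal V^{(j)})^\perp$ and $\Xi^{(j)}_{j-1}=(\mathrm{Char}\,\mathcal V^{(j)}_{j-1})^\perp$, $1\le j\le k-1$, and let $\Upsilon=\mathcal R_{\widehat\Sigma_{k-1}}(\mathcal V^{(k-1)})^\perp$ be the annihilator of the resolvent bundle of the Weber structure $(\mathcal V^{(k-1)},\widehat\Sigma_{k-1})$. All are integrable; $\Xi^{(j)}\subseteq\Xi^{(j)}_{j-1}$ with $\dim\Xi^{(j)}_{j-1}-\dim\Xi^{(j)}=\rho_j$, and $\dim\Upsilon=\rho_k+1$. For $1\le j\le k-1$ with $\rho_j>0$, choose a complement $\Omega_j$ spanned by $1$-forms $\omega_{1},\dots,\omega_{\rho_j}$ with $\Xi^{(j)}_{j-1}=\Xi^{(j)}\oplus\Omega_j$; fundamental functions of order $j$ are functions $\varphi^{1,j},\ldots,\varphi^{\rho_j,j}$ with $(d\varphi^{1,j},\ldots,d\varphi^{\rho_j,j})^T\equiv M_j(\omega_1,\ldots,\omega_{\rho_j})^T\bmod\Xi^{(j)}$ for some matrix of functions $M_j$ with $\det M_j\ne0$. Fundamental functions of order $k$ are $\rho_k+1$ functions $\varphi^{0,k}=:x,\varphi^{1,k},\ldots,\varphi^{\rho_k,k}$ spanning the first integrals of $\Upsilon$ (their differentials form a basis of $\Upsilon$). *)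

theory Defs
  imports "HOL-Analysis.Analysis" "HOL-Library.Function_Algebras"
begin

section \<open>Functions into a real vector space\<close>

text \<open>Tangent vectors and covectors are functionals below; with this instance \<open>span\<close>, \<open>dim\<close>,
  \<open>independent\<close> are available for them.\<close>

instantiation "fun" :: (type, real_vector) real_vector
begin

definition scaleR_fun :: "real \<Rightarrow> ('a \<Rightarrow> 'b) \<Rightarrow> 'a \<Rightarrow> 'b"
  where "scaleR_fun r f = (\<lambda>x. r *\<^sub>R f x)"

instance
  by standard (simp_all add: scaleR_fun_def fun_eq_iff scaleR_add_right scaleR_add_left)

end

section \<open>Smooth manifolds\<close>

text \<open>To be used on open sets only.\<close>

fun Ck_on :: "nat \<Rightarrow> 'a::euclidean_space set \<Rightarrow> ('a \<Rightarrow> 'b::real_normed_vector) \<Rightarrow> bool" where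
  "Ck_on 0 S f \<longleftrightarrow> continuous_on S f"
| "Ck_on (Suc n) S f \<longleftrightarrow>
     f differentiable_on S \<and> (\<forall>v. Ck_on n S (\<lambda>x. frechet_derivative f (at x) v))"

definition smooth_on :: "'a::euclidean_space set \<Rightarrow> ('a \<Rightarrow> 'b::real_normed_vector) \<Rightarrow> bool" where
  "smooth_on S f \<longleftrightarrow> (\<forall>n. Ck_on n S f)"

text \<open>A manifold is a Hausdorff second countable type \<open>'m\<close> with an atlas of charts into a
  Euclidean space \<open>'e\<close>; its dimension is \<open>DIM('e)\<close>. A chart is its domain with a map that only
  matters on that domain.\<close>

type_synonym ('m, 'e) chart = "'m set \<times> ('m \<Rightarrow> 'e)"

definition chart_inv :: "('m, 'e) chart \<Rightarrow> 'e \<Rightarrow> 'm" where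
  "chart_inv c = inv_into (fst c) (snd c)"

definition is_chart :: "('m::topological_space, 'e::euclidean_space) chart \<Rightarrow> bool" where
  "is_chart c \<longleftrightarrow> open (fst c) \<and> open (snd c ` fst c) \<and>
     homeomorphism (fst c) (snd c ` fst c) (snd c) (chart_inv c)"

definition compatible ::
  "('m::topological_space, 'e::euclidean_space) chart \<Rightarrow> ('m, 'e) chart \<Rightarrow> bool" where
  "compatible c d \<longleftrightarrow>
     smooth_on (snd c ` (fst c \<inter> fst d)) (snd d \<circ> chart_inv c) \<and>
     smooth_on (snd d ` (fst c \<inter> fst d)) (snd c \<circ> chart_inv d)"

definition smooth_atlas ::
  "('m::{t2_space,second_countable_topology}, 'e::euclidean_space) chart set \<Rightarrow> bool" where
  "smooth_atlas A \<longleftrightarrow> (\<forall>c\<in>A. is_chart c) \<and> (\<forall>c\<in>A. \<forall>d\<in>A. compatible c d) \<and>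
     (\<Union>c\<in>A. fst c) = UNIV"

text \<open>Membership in the maximal atlas, i.e. a local coordinate system on \<open>fst c\<close>.\<close>

definition admissible_chart ::
  "('m::topological_space, 'e::euclidean_space) chart set \<Rightarrow> ('m, 'e) chart \<Rightarrow> bool" where
  "admissible_chart A c \<longleftrightarrow> is_chart c \<and> (\<forall>d\<in>A. compatible c d)"

definition smooth_fun_on ::
  "('m::topological_space, 'e::euclidean_space) chart set \<Rightarrow> 'm set \<Rightarrow> ('m \<Rightarrow> real) \<Rightarrow> bool" where
  "smooth_fun_on A U f \<longleftrightarrow> open U \<and> (\<forall>c\<in>A. smooth_on (snd c ` (fst c \<inter> U)) (f \<circ> chart_inv c))"

definition smooth_near ::
  "('m::topological_space, 'e::euclidean_space) chart set \<Rightarrow> 'm \<Rightarrow> ('m \<Rightarrow> real) \<Rightarrow> bool" where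
  "smooth_near A p f \<longleftrightarrow> (\<exists>U. p \<in> U \<and> smooth_fun_on A U f)"

section \<open>Tangent vectors, vector fields and one-forms\<close>

text \<open>A tangent vector at \<open>p\<close> is the operator of directional differentiation, in some chart,
  of functions smooth near \<open>p\<close>, and is set to \<open>0\<close> on all other functions. In particular it can be
  applied to functions defined only on a neighbourhood of \<open>p\<close>.\<close>

type_synonym 'm tvec = "('m \<Rightarrow> real) \<Rightarrow> real"
type_synonym 'm vfield = "'m \<Rightarrow> 'm tvec"
type_synonym 'm tbundle = "'m \<Rightarrow> 'm tvec set"
type_synonym 'm covec = "'m tvec \<Rightarrow> real"

definition coord_vec ::
  "('m::topological_space, 'e::euclidean_space) chart set \<Rightarrow> ('m, 'e) chart \<Rightarrow> 'm \<Rightarrow> 'e \<Rightarrow> 'm tvec" where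
  "coord_vec A c p v = (\<lambda>f. if smooth_near A p f
     then frechet_derivative (f \<circ> chart_inv c) (at (snd c p)) v else 0)"

definition tangent_space ::
  "('m::topological_space, 'e::euclidean_space) chart set \<Rightarrow> 'm tbundle" where
  "tangent_space A p = {coord_vec A c p v | c v. c \<in> A \<and> p \<in> fst c}"

definition vector_field_on ::
  "('m::topological_space, 'e::euclidean_space) chart set \<Rightarrow> 'm set \<Rightarrow> 'm vfield \<Rightarrow> bool" where
  "vector_field_on A U X \<longleftrightarrow> (\<forall>p\<in>U. X p \<in> tangent_space A p) \<and>
     (\<forall>W f. W \<subseteq> U \<and> smooth_fun_on A W f \<longrightarrow> smooth_fun_on A W (\<lambda>p. X p f))"

definition lie_bracket ::
  "('m::topological_space, 'e::euclidean_space) chart set \<Rightarrow> 'm vfield \<Rightarrow> 'm vfield \<Rightarrow> 'm vfield" where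
  "lie_bracket A X Y p = (\<lambda>f. if smooth_near A p f
     then X p (\<lambda>q. Y q f) - Y p (\<lambda>q. X q f) else 0)"

definition cotangent_space ::
  "('m::topological_space, 'e::euclidean_space) chart set \<Rightarrow> 'm \<Rightarrow> 'm covec set" where
  "cotangent_space A p = {\<alpha>.
     (\<forall>u\<in>tangent_space A p. \<forall>v\<in>tangent_space A p. \<alpha> (u + v) = \<alpha> u + \<alpha> v) \<and>
     (\<forall>r. \<forall>v\<in>tangent_space A p. \<alpha> (r *\<^sub>R v) = r * \<alpha> v) \<and>
     (\<forall>v. v \<notin> tangent_space A p \<longrightarrow> \<alpha> v = 0)}"

definition differential ::
  "('m::topological_space, 'e::euclidean_space) chart set \<Rightarrow> ('m \<Rightarrow> real) \<Rightarrow> 'm \<Rightarrow> 'm covec" where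
  "differential A f p = (\<lambda>v. if v \<in> tangent_space A p then v f else 0)"

definition one_form_on ::
  "('m::topological_space, 'e::euclidean_space) chart set \<Rightarrow> 'm set \<Rightarrow> ('m \<Rightarrow> 'm covec) \<Rightarrow> bool" where
  "one_form_on A U \<omega> \<longleftrightarrow> (\<forall>p\<in>U. \<omega> p \<in> cotangent_space A p) \<and>
     (\<forall>W X. open W \<and> W \<subseteq> U \<and> vector_field_on A W X \<longrightarrow> smooth_fun_on A W (\<lambda>p. \<omega> p (X p)))"

definition annihilator ::
  "('m::topological_space, 'e::euclidean_space) chart set \<Rightarrow> 'm tbundle \<Rightarrow> 'm \<Rightarrow> 'm covec set" where
  "annihilator A V p = {\<alpha> \<in> cotangent_space A p. \<forall>v\<in>V p. \<alpha> v = 0}"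

section \<open>Sub-bundles of the tangent bundle\<close>

definition subbundle ::
  "('m::topological_space, 'e::euclidean_space) chart set \<Rightarrow> nat \<Rightarrow> 'm tbundle \<Rightarrow> bool" where
  "subbundle A r V \<longleftrightarrow>
     (\<forall>p. V p \<subseteq> tangent_space A p \<and> subspace (V p) \<and> dim (V p) = r) \<and>
     (\<forall>p. \<exists>U X. open U \<and> p \<in> U \<and> (\<forall>i<r. vector_field_on A U (X i)) \<and>
        (\<forall>q\<in>U. V q = span ((\<lambda>i. X i q) ` {..<r})))"

definition sections ::
  "('m::topological_space, 'e::euclidean_space) chart set \<Rightarrow> 'm tbundle \<Rightarrow> 'm vfield set" where
  "sections A V = {X. vector_field_on A UNIV X \<and> (\<forall>p. X p \<in> V p)}"

text \<open>Only meaningful for families of subspaces of constant dimension.\<close>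

definition bundle_rank :: "'m tbundle \<Rightarrow> nat" where
  "bundle_rank V = (THE r. \<forall>p. dim (V p) = r)"

text \<open>Integrability: \<open>V\<close> is tangent to a foliation, i.e. near every point it is spanned by some of
  the coordinate vector fields of a chart.\<close>

definition integrable_bundle ::
  "('m::topological_space, 'e::euclidean_space) chart set \<Rightarrow> 'm tbundle \<Rightarrow> bool" where
  "integrable_bundle A V \<longleftrightarrow> (\<forall>p. \<exists>c B. admissible_chart A c \<and> p \<in> fst c \<and> B \<subseteq> Basis \<and>
     (\<forall>q\<in>fst c. V q = span (coord_vec A c q ` B)))"

text \<open>The dimension of the image of \<open>span S\<close> in the quotient by the subspace \<open>C\<close>.\<close>

definition dim_mod :: "'v::real_vector set \<Rightarrow> 'v set \<Rightarrow> nat" where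
  "dim_mod C S = dim (span (S \<union> C)) - dim C"

section \<open>Derived flag and Cauchy bundles\<close>

text \<open>Rank at \<open>p\<close> of the structure tensor \<open>V \<times> V \<rightarrow> TM/V\<close>.\<close>

definition structure_rank ::
  "('m::topological_space, 'e::euclidean_space) chart set \<Rightarrow> 'm tbundle \<Rightarrow> 'm \<Rightarrow> nat" where
  "structure_rank A V p =
     dim_mod (V p) {lie_bracket A X Y p | X Y. X \<in> sections A V \<and> Y \<in> sections A V}"

definition derived_bundle ::
  "('m::topological_space, 'e::euclidean_space) chart set \<Rightarrow> 'm tbundle \<Rightarrow> 'm tbundle" where
  "derived_bundle A V p =
     span (V p \<union> {lie_bracket A X Y p | X Y. X \<in> sections A V \<and> Y \<in> sections A V})"

definition derived_flag ::
  "('m::topological_space, 'e::euclidean_space) chart set \<Rightarrow> nat \<Rightarrow> 'm tbundle \<Rightarrow> 'm tbundle" where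
  "derived_flag A i = derived_bundle A ^^ i"

definition regular_bundle ::
  "('m::topological_space, 'e::euclidean_space) chart set \<Rightarrow> 'm tbundle \<Rightarrow> bool" where
  "regular_bundle A V \<longleftrightarrow> (\<exists>r. subbundle A r V) \<and>
     (\<forall>i. \<exists>r. \<forall>p. structure_rank A (derived_flag A i V) p = r)"

definition has_derived_length ::
  "('m::topological_space, 'e::euclidean_space) chart set \<Rightarrow> 'm tbundle \<Rightarrow> nat \<Rightarrow> bool" where
  "has_derived_length A V k \<longleftrightarrow> derived_flag A (Suc k) V = derived_flag A k V \<and>
     (\<forall>i<k. derived_flag A (Suc i) V \<noteq> derived_flag A i V)"

text \<open>The fibre at \<open>p\<close> consists of the values at \<open>p\<close> of the global sections \<open>X\<close> of \<open>V\<close> with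
  \<open>[X, \<Gamma>(V)] \<subseteq> \<Gamma>(V)\<close>.\<close>

definition cauchy_bundle ::
  "('m::topological_space, 'e::euclidean_space) chart set \<Rightarrow> 'm tbundle \<Rightarrow> 'm tbundle" where
  "cauchy_bundle A V p = {X p | X. X \<in> sections A V \<and>
     (\<forall>Y\<in>sections A V. lie_bracket A X Y \<in> sections A V)}"

definition totally_regular ::
  "('m::topological_space, 'e::euclidean_space) chart set \<Rightarrow> 'm tbundle \<Rightarrow> bool" where
  "totally_regular A V \<longleftrightarrow> regular_bundle A V \<and>
     (\<forall>i. \<exists>r. \<forall>p. dim (cauchy_bundle A (derived_flag A i V) p) = r)"

definition flag_rank ::
  "('m::topological_space, 'e::euclidean_space) chart set \<Rightarrow> 'm tbundle \<Rightarrow> nat \<Rightarrow> nat" where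
  "flag_rank A V i = bundle_rank (derived_flag A i V)"

text \<open>\<open>Char V\<^sup>(\<^sup>j\<^sup>)\<close>\<close>

definition char_flag ::
  "('m::topological_space, 'e::euclidean_space) chart set \<Rightarrow> 'm tbundle \<Rightarrow> nat \<Rightarrow> 'm tbundle" where
  "char_flag A V j = cauchy_bundle A (derived_flag A j V)"

text \<open>\<open>V\<^sup>(\<^sup>j\<^sup>-\<^sup>1\<^sup>) \<inter> Char V\<^sup>(\<^sup>j\<^sup>)\<close>, for \<open>j \<ge> 1\<close>\<close>

definition char_flag_inter ::
  "('m::topological_space, 'e::euclidean_space) chart set \<Rightarrow> 'm tbundle \<Rightarrow> nat \<Rightarrow> 'm tbundle" where
  "char_flag_inter A V j p = derived_flag A (j - 1) V p \<inter> char_flag A V j p"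

text \<open>\<open>decel A V k\<close> is \<open>\<langle>-\<Delta>\<^sup>2\<^sub>2, \<dots>, -\<Delta>\<^sup>2\<^sub>k, \<Delta>\<^sub>k\<rangle>\<close>, for derived length \<open>k \<ge> 1\<close>.\<close>

definition flag_diff ::
  "('m::topological_space, 'e::euclidean_space) chart set \<Rightarrow> 'm tbundle \<Rightarrow> nat \<Rightarrow> int" where
  "flag_diff A V j = int (flag_rank A V j) - int (flag_rank A V (j - 1))"

definition deccel ::
  "('m::topological_space, 'e::euclidean_space) chart set \<Rightarrow> 'm tbundle \<Rightarrow> nat \<Rightarrow> int list" where
  "deccel A V k =
     map (\<lambda>i. - (flag_diff A V i - flag_diff A V (i - 1))) [2..<Suc k] @ [flag_diff A V k]"

section \<open>Partial prolongations\<close>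

text \<open>\<open>CZ l j h\<close> stands for the coordinate \<open>z\<^sup>l\<^sup>,\<^sup>j\<^sub>h\<close>. A type \<open>\<tau>\<close> is the list of \<open>\<rho>\<^sub>1, \<dots>, \<rho>\<^sub>k\<close>.\<close>

datatype pp_index = CX | CZ nat nat nat

definition rho :: "nat list \<Rightarrow> nat \<Rightarrow> nat" where
  "rho \<tau> j = \<tau> ! (j - 1)"

definition pp_indices :: "nat list \<Rightarrow> pp_index set" where
  "pp_indices \<tau> = insert CX {CZ l j h | l j h.
     1 \<le> j \<and> j \<le> length \<tau> \<and> 1 \<le> l \<and> l \<le> rho \<tau> j \<and> h \<le> j}"

text \<open>The contact distribution of type \<open>\<tau>\<close> in the coordinate system \<open>c\<close>; the coordinate called \<open>i\<close>
  is \<open>\<lambda>p. snd c p \<bullet> \<beta> i\<close>, where \<open>\<beta>\<close> labels the standard basis by \<open>pp_indices \<tau>\<close>.\<close>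

definition contact_distribution ::
  "('m::topological_space, 'e::euclidean_space) chart set \<Rightarrow> ('m, 'e) chart \<Rightarrow>
     nat list \<Rightarrow> (pp_index \<Rightarrow> 'e) \<Rightarrow> 'm tbundle" where
  "contact_distribution A c \<tau> \<beta> p = span (insert
     (coord_vec A c p (\<beta> CX) +
        (\<Sum>j=1..length \<tau>. \<Sum>l=1..rho \<tau> j. \<Sum>h<j.
           (snd c p \<bullet> \<beta> (CZ l j (Suc h))) *\<^sub>R coord_vec A c p (\<beta> (CZ l j h))))
     {coord_vec A c p (\<beta> (CZ l j j)) | l j.
        1 \<le> j \<and> j \<le> length \<tau> \<and> 1 \<le> l \<and> l \<le> rho \<tau> j})"

definition std_atlas :: "('e::euclidean_space, 'e) chart set" where
  "std_atlas = {(UNIV, id)}"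

definition partial_prolongation ::
  "nat list \<Rightarrow> (pp_index \<Rightarrow> 'e::euclidean_space) \<Rightarrow> 'e tbundle" where
  "partial_prolongation \<tau> \<beta> = contact_distribution std_atlas (UNIV, id) \<tau> \<beta>"

definition contact_coordinates_on ::
  "('m::topological_space, 'e::euclidean_space) chart set \<Rightarrow> 'm tbundle \<Rightarrow> nat list \<Rightarrow>
     'm set \<Rightarrow> (pp_index \<Rightarrow> 'm \<Rightarrow> real) \<Rightarrow> bool" where
  "contact_coordinates_on A V \<tau> U z \<longleftrightarrow> (\<forall>p\<in>U. \<exists>c \<beta>.
     admissible_chart A c \<and> p \<in> fst c \<and> fst c \<subseteq> U \<and>
     bij_betw \<beta> (pp_indices \<tau>) Basis \<and>
     (\<forall>q\<in>fst c. \<forall>i\<in>pp_indices \<tau>. snd c q \<bullet> \<beta> i = z i q) \<and>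
     (\<forall>q\<in>fst c. V q = contact_distribution A c \<tau> \<beta> q))"

section \<open>Singular variety and Weber structures\<close>

text \<open>The quotient of the tangent space by the fibre \<open>C\<close> of the Cauchy bundle is the set of cosets
  \<open>quot C v\<close>; \<open>quot_line C v\<close> is the line through \<open>quot C v\<close>.\<close>

definition quot :: "'v::real_vector set \<Rightarrow> 'v \<Rightarrow> 'v set" where
  "quot C v = {v + u | u. u \<in> C}"

definition quot_line :: "'v::real_vector set \<Rightarrow> 'v \<Rightarrow> 'v set set" where
  "quot_line C v = {quot C (t *\<^sub>R v) | t. True}"

text \<open>The projective space of a set \<open>S\<close> of cosets forming a linear subspace of the quotient.\<close>

definition quot_proj_space :: "'v::real_vector set \<Rightarrow> 'v set set \<Rightarrow> 'v set set set" where
  "quot_proj_space C S = {quot_line C v | v. quot C v \<in> S \<and> v \<notin> C}"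

text \<open>Rank of \<open>Y \<mapsto> \<delta>(v, Y)\<close>, where \<open>\<delta>\<close> is the structure tensor of the quotient of \<open>W\<close> by its Cauchy
  bundle; its target \<open>(TM/Char W)/(W/Char W)\<close> is identified with \<open>TM/W\<close>, and the tangent vector
  \<open>v\<close> in \<open>W p\<close> represents its coset.\<close>

definition delta_rank ::
  "('m::topological_space, 'e::euclidean_space) chart set \<Rightarrow> 'm tbundle \<Rightarrow> 'm \<Rightarrow> 'm tvec \<Rightarrow> nat" where
  "delta_rank A W p v = dim_mod (W p)
     {lie_bracket A X Y p | X Y. X \<in> sections A W \<and> X p = v \<and> Y \<in> sections A W}"

text \<open>The generic rank at \<open>p\<close> is the maximal one.\<close>

definition singular_variety ::
  "('m::topological_space, 'e::euclidean_space) chart set \<Rightarrow> 'm tbundle \<Rightarrow> 'm \<Rightarrow> 'm tvec set set set" where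
  "singular_variety A W p = {quot_line (cauchy_bundle A W p) v | v.
     v \<in> W p \<and> v \<notin> cauchy_bundle A W p \<and> delta_rank A W p v < Max (delta_rank A W p ` W p)}"

text \<open>\<open>Bh\<close> is a sub-bundle of rank \<open>q\<close> of \<open>W/Char W\<close>, where \<open>Char W\<close> has rank \<open>c\<close>.\<close>

definition quot_subbundle ::
  "('m::topological_space, 'e::euclidean_space) chart set \<Rightarrow> nat \<Rightarrow> nat \<Rightarrow> 'm tbundle \<Rightarrow>
     ('m \<Rightarrow> 'm tvec set set) \<Rightarrow> bool" where
  "quot_subbundle A c q W Bh \<longleftrightarrow> (\<exists>B. subbundle A (c + q) B \<and>
     (\<forall>p. cauchy_bundle A W p \<subseteq> B p \<and> B p \<subseteq> W p \<and> Bh p = quot (cauchy_bundle A W p) ` B p))"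

text \<open>Weber structure with singular sub-bundle \<open>Bh\<close>, whose projectivized fibres are real projective
  spaces of dimension \<open>q - 1\<close>.\<close>

definition weber_structure ::
  "('m::topological_space, 'e::euclidean_space) chart set \<Rightarrow> nat \<Rightarrow> nat \<Rightarrow> 'm tbundle \<Rightarrow>
     ('m \<Rightarrow> 'm tvec set set) \<Rightarrow> bool" where
  "weber_structure A c q W Bh \<longleftrightarrow> totally_regular A W \<and> 2 \<le> q \<and>
     subbundle A (c + q + 1) W \<and> DIM('e) = c + 2 * q + 1 \<and>
     (\<forall>p. dim (cauchy_bundle A W p) = c) \<and>
     derived_bundle A W = tangent_space A \<and>
     quot_subbundle A c q W Bh \<and>
     (\<forall>p. singular_variety A W p = quot_proj_space (cauchy_bundle A W p) (Bh p))"

text \<open>The largest sub-bundle of \<open>W\<close> projecting onto \<open>Bh\<close>.\<close>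

definition resolvent_bundle ::
  "('m::topological_space, 'e::euclidean_space) chart set \<Rightarrow> 'm tbundle \<Rightarrow>
     ('m \<Rightarrow> 'm tvec set set) \<Rightarrow> 'm tbundle" where
  "resolvent_bundle A W Bh p = {v \<in> W p. quot (cauchy_bundle A W p) v \<in> Bh p}"

section \<open>Goursat bundles\<close>

text \<open>The model lives on \<open>'e\<close> itself, which is possible exactly when the number of coordinates of
  \<open>\<C>(\<tau>)\<close> is the dimension of the manifold; equality of the last ranks of the two derived flags
  forces this.\<close>

definition same_derived_type ::
  "('m::topological_space, 'e::euclidean_space) chart set \<Rightarrow> 'm tbundle \<Rightarrow> 'e tbundle \<Rightarrow> nat \<Rightarrow> bool" where
  "same_derived_type A V C k \<longleftrightarrow> (\<forall>i\<le>k.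
     flag_rank A V i = flag_rank std_atlas C i \<and>
     bundle_rank (char_flag A V i) = bundle_rank (char_flag std_atlas C i))"

definition goursat_bundle ::
  "('m::{t2_space,second_countable_topology}, 'e::euclidean_space) chart set \<Rightarrow>
     'm tbundle \<Rightarrow> nat list \<Rightarrow> bool" where
  "goursat_bundle A V \<tau> \<longleftrightarrow> (let k = length \<tau> in
     1 \<le> k \<and> 1 \<le> rho \<tau> k \<and>
     totally_regular A V \<and> has_derived_length A V k \<and> derived_flag A k V = tangent_space A \<and>
     map int \<tau> = deccel A V k \<and>
     (\<exists>\<beta> :: pp_index \<Rightarrow> 'e. bij_betw \<beta> (pp_indices \<tau>) Basis \<and>
        same_derived_type A V (partial_prolongation \<tau> \<beta>) k \<and>
        (\<forall>i\<in>{1..k-1}. integrable_bundle A (char_flag_inter A V i) \<and>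
           subbundle A (bundle_rank (char_flag_inter std_atlas (partial_prolongation \<tau> \<beta>) i))
             (char_flag_inter A V i))) \<and>
     (flag_diff A V k > 1 \<longrightarrow>
        (\<exists>c Bh. weber_structure A c (nat (flag_diff A V k)) (derived_flag A (k - 1) V) Bh \<and>
           integrable_bundle A (resolvent_bundle A (derived_flag A (k - 1) V) Bh))))"

section \<open>Fundamental functions\<close>

text \<open>Determinant of the matrix \<open>M\<close> with index range \<open>{1..n}\<close>.\<close>

definition ndet :: "nat \<Rightarrow> (nat \<Rightarrow> nat \<Rightarrow> real) \<Rightarrow> real" where
  "ndet n M = (\<Sum>\<pi> | \<pi> permutes {1..n}. of_int (sign \<pi>) * (\<Prod>i=1..n. M i (\<pi> i)))"

text \<open>\<open>f 1, \<dots>, f n\<close> are fundamental functions on \<open>U\<close> of order \<open>j < k\<close>, where \<open>n = \<rho>\<^sub>j\<close>.\<close>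

definition fundamental_lower ::
  "('m::topological_space, 'e::euclidean_space) chart set \<Rightarrow> 'm tbundle \<Rightarrow> nat \<Rightarrow> nat \<Rightarrow>
     'm set \<Rightarrow> (nat \<Rightarrow> 'm \<Rightarrow> real) \<Rightarrow> bool" where
  "fundamental_lower A V j n U f \<longleftrightarrow> (\<forall>l\<in>{1..n}. smooth_fun_on A U (f l)) \<and>
     (\<exists>\<omega> M. (\<forall>i\<in>{1..n}. one_form_on A U (\<omega> i)) \<and>
        (\<forall>p\<in>U. let \<Xi> = annihilator A (char_flag A V j) p;
                   \<Omega> = span ((\<lambda>i. \<omega> i p) ` {1..n}) in
           annihilator A (char_flag_inter A V j) p = {\<xi> + \<eta> | \<xi> \<eta>. \<xi> \<in> \<Xi> \<and> \<eta> \<in> \<Omega>} \<and>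
           \<Xi> \<inter> \<Omega> = {0} \<and>
           ndet n (M p) \<noteq> 0 \<and>
           (\<forall>l\<in>{1..n}. differential A (f l) p - (\<Sum>i=1..n. M p l i *\<^sub>R \<omega> i p) \<in> \<Xi>)))"

text \<open>\<open>f 0, \<dots>, f n\<close> are fundamental functions on \<open>U\<close> of order \<open>k\<close>, where \<open>n = \<rho>\<^sub>k\<close>. The singular
  sub-bundle \<open>Bh\<close> is determined by the singular variety.\<close>

definition fundamental_top ::
  "('m::topological_space, 'e::euclidean_space) chart set \<Rightarrow> 'm tbundle \<Rightarrow> nat \<Rightarrow> nat \<Rightarrow>
     'm set \<Rightarrow> (nat \<Rightarrow> 'm \<Rightarrow> real) \<Rightarrow> bool" where
  "fundamental_top A V k n U f \<longleftrightarrow> (\<forall>l\<le>n. smooth_fun_on A U (f l)) \<and>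
     (\<exists>c q Bh. weber_structure A c q (derived_flag A (k - 1) V) Bh \<and>
        (\<forall>p\<in>U. inj_on (\<lambda>l. differential A (f l) p) {..n} \<and>
           independent ((\<lambda>l. differential A (f l) p) ` {..n}) \<and>
           span ((\<lambda>l. differential A (f l) p) ` {..n}) =
             annihilator A (resolvent_bundle A (derived_flag A (k - 1) V) Bh) p))"

text \<open>\<open>f\<^sub>0 = f\<close> and \<open>f\<^sub>s\<^sub>+\<^sub>1 = Y f\<^sub>s / Y x\<close>\<close>

fun prolonged :: "'m vfield \<Rightarrow> ('m \<Rightarrow> real) \<Rightarrow> ('m \<Rightarrow> real) \<Rightarrow> nat \<Rightarrow> 'm \<Rightarrow> real" where
  "prolonged Y x f 0 = f"
| "prolonged Y x f (Suc s) = (\<lambda>p. Y p (prolonged Y x f s) / Y p x)"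

fun prolonged_coords ::
  "'m vfield \<Rightarrow> ('m \<Rightarrow> real) \<Rightarrow> (nat \<Rightarrow> nat \<Rightarrow> 'm \<Rightarrow> real) \<Rightarrow> pp_index \<Rightarrow> 'm \<Rightarrow> real" where
  "prolonged_coords Y x \<phi> CX = x"
| "prolonged_coords Y x \<phi> (CZ l j h) = prolonged Y x (\<phi> l j) h"

end

theory Submission
  imports Defs
begin

text \<open>Write \<open>z\<close> for the functions \<open>x\<close>, \<open>\<phi>\<^sub>s\<close>. If sections \<open>X\<close>, \<open>X'\<close> of \<open>V\<^sup>(\<^sup>i\<^sup>)\<close> are killed by
  the contact form \<open>dz\<^sub>s - z\<^sub>s\<^sub>+\<^sub>1 dx\<close>, then its value on \<open>[X, X']\<close> is
  \<open>X z\<^sub>s\<^sub>+\<^sub>1 \<cdot> X' x - X' z\<^sub>s\<^sub>+\<^sub>1 \<cdot> X x\<close>. By descending induction on \<open>i\<close> this identity shows that, where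
  \<open>Y x \<noteq> 0\<close>, the bundle \<open>V\<^sup>(\<^sup>i\<^sup>)\<close> is cut out by the contact forms with \<open>s < j - i\<close>: the Cauchy bundle of
  \<open>V\<^sup>(\<^sup>i\<^sup>)\<close> turns out to be the common kernel of \<open>dx\<close> and the \<open>dz\<^sub>s\<close> with \<open>i < j\<close>, \<open>s \<le> j - i\<close>, its
  intersection with \<open>V\<^sup>(\<^sup>i\<^sup>-\<^sup>1\<^sup>)\<close> is \<open>V\<^sup>(\<^sup>i\<^sup>-\<^sup>1\<^sup>) \<inter> ker dx\<close>, and a dimension count shows that the fundamental functions
  of order \<open>i\<close> supply exactly the differentials missing in the annihilator of the latter. The induction
  starts at \<open>i = k - 1\<close>, where \<open>V\<^sup>(\<^sup>k\<^sup>-\<^sup>1\<^sup>) \<inter> ker dx\<close> is the resolvent bundle, and at \<open>i = 0\<close> all the \<open>dz\<close>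
  are independent, so the inverse function theorem applies. Every section \<open>Y\<close> with \<open>Y x \<noteq> 0\<close> will do. Since the
  brackets of \<open>V\<close> generate \<open>TM\<close>, \<open>dx\<close> cannot annihilate \<open>V\<close> on an open set, and a generic
  section satisfies \<open>Y x \<noteq> 0\<close> on a dense set.\<close>

section \<open>Analysis on open subsets of Euclidean spaces\<close>

section \<open>Calculus of smooth maps\<close>

text \<open>The bracket identity is Cartan's formula, since the exterior derivative of
  \<open>dz_s - z_{s+1} dx\<close> is \<open>dx \<and> dz_{s+1}\<close>. The decceleration vector
  enters as a count: the codimension of \<open>V^(i)\<close> is the sum of
  \<open>rho_j (j - i)\<close> over \<open>j > i\<close>, which is exactly the number of contact
  forms with \<open>s < j - i\<close>. So at each level one inclusion and independence already give
  equality. Independence of the differentials that appear at level \<open>i\<close> rests on the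
  fact that brackets of sections of \<open>V^(i)\<close> generate all of \<open>V^(i+1)\<close>,
  whose annihilator must then be known; hence the induction carries two consecutive levels.

  An obstacle throughout is that derived bundles, Cauchy bundles and \<open>Y\<close> are made of
  global sections, while the coordinates live on a part of the manifold. Local fields are therefore
  cut off by bump functions supported where the local description holds. The section
  \<open>Y\<close> is a locally finite sum of countably many sections weighted by powers of one real
  parameter.

  Tangent vectors are functionals on all functions, a space without useful dimension theory, so
  linear algebra is done in a chart by representing covectors as vectors of
  \<open>'e\<close>.\<close>

lemma has_derivative_frechet:
  assumes "open S" "f differentiable_on S" "x \<in> S"
  shows "(f has_derivative frechet_derivative f (at x)) (at x)"
  using assms by (metis at_within_open differentiable_on_def frechet_derivative_works)

lemma differentiable_on_openI:
  assumes "\<And>x. x \<in> S \<Longrightarrow> \<exists>D. (f has_derivative D) (at x)"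
  shows "f differentiable_on S"
  using assms unfolding differentiable_on_def differentiable_def
  by (meson has_derivative_at_withinI)

lemma Ck_on_cong:
  assumes "open S" "\<And>x. x \<in> S \<Longrightarrow> f x = g x" "Ck_on n S f"
  shows "Ck_on n S g"
  using assms(2,3)
proof (induction n arbitrary: f g)
  case 0
  then show ?case by (simp cong: continuous_on_cong)
next
  case (Suc n)
  have D: "(g has_derivative frechet_derivative f (at x)) (at x)" if "x \<in> S" for x
    using has_derivative_frechet[OF \<open>open S\<close> _ that, of f] Suc.prems that \<open>open S\<close>
    by (auto intro: has_derivative_transform_within_open)
  have eq: "frechet_derivative g (at x) = frechet_derivative f (at x)" if "x \<in> S" for x
    using D[OF that] frechet_derivative_at by metis
  show ?case
    using D eq Suc.prems(2) Suc.IH by (auto intro!: differentiable_on_openI)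
qed

lemma Ck_on_subset:
  assumes "Ck_on n S f" "T \<subseteq> S"
  shows "Ck_on n T f"
  using assms
  by (induction n arbitrary: f)
     (auto intro: continuous_on_subset differentiable_on_subset)

lemma Ck_on_lower: "Ck_on (Suc n) S f \<Longrightarrow> Ck_on n S f"
proof (induction n arbitrary: f)
  case 0
  then show ?case by (auto intro: differentiable_imp_continuous_on)
next
  case (Suc n)
  then show ?case by (metis Ck_on.simps(2))
qed

text \<open>\<open>frechet_derivative\<close> is a choice operator; exhibiting a derivative
  \<open>D\<close> identifies it on an open set by uniqueness. The closure properties below all pass
  through this rule.\<close>

lemma Ck_on_SucI:
  assumes "open S" "\<And>x. x \<in> S \<Longrightarrow> (f has_derivative D x) (at x)"
    and "\<And>v. Ck_on n S (\<lambda>x. D x v)"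
  shows "Ck_on (Suc n) S f"
proof -
  have "frechet_derivative f (at x) = D x" if "x \<in> S" for x
    using assms(2)[OF that] frechet_derivative_at by metis
  with assms show ?thesis
    by (auto intro!: differentiable_on_openI intro: Ck_on_cong[OF assms(1)])
qed

lemma Ck_on_const: "Ck_on n S (\<lambda>x. c)"
  by (induction n arbitrary: c) (auto intro: differentiable_on_const)

lemma Ck_on_bounded_linear:
  assumes "open S" "bounded_linear f"
  shows "Ck_on n S f"
proof (cases n)
  case 0
  with assms show ?thesis by (simp add: linear_continuous_on)
next
  case (Suc m)
  show ?thesis
    unfolding Suc using assms
    by (intro Ck_on_SucI[where D = "\<lambda>x. f"] Ck_on_const bounded_linear_imp_has_derivative)
qed

lemma Ck_on_add:
  assumes "open S" "Ck_on n S f" "Ck_on n S g"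
  shows "Ck_on n S (\<lambda>x. f x + g x)"
  using assms(2,3)
proof (induction n arbitrary: f g)
  case 0
  then show ?case by (auto intro: continuous_on_add)
next
  case (Suc n)
  show ?case
    by (rule Ck_on_SucI[OF \<open>open S\<close>, where D =
          "\<lambda>x v. frechet_derivative f (at x) v + frechet_derivative g (at x) v"])
       (use Suc in \<open>auto intro!: has_derivative_add has_derivative_frechet[OF \<open>open S\<close>]\<close>)
qed

lemma Ck_on_linear_compose:
  assumes "open S" "bounded_linear h" "Ck_on n S f"
  shows "Ck_on n S (\<lambda>x. h (f x))"
  using assms(3)
proof (induction n arbitrary: f)
  case 0
  then show ?case
    using bounded_linear.continuous_on[OF assms(2)] by auto
next
  case (Suc n)
  show ?case
    by (rule Ck_on_SucI[OF \<open>open S\<close>, where D = "\<lambda>x v. h (frechet_derivative f (at x) v)"])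
       (use Suc in \<open>auto intro!: bounded_linear.has_derivative[OF assms(2)] has_derivative_frechet[OF \<open>open S\<close>]\<close>)
qed

lemma Ck_on_bilinear:
  assumes "open S" "bounded_bilinear b" "Ck_on n S f" "Ck_on n S g"
  shows "Ck_on n S (\<lambda>x. b (f x) (g x))"
  using assms(3,4)
proof (induction n arbitrary: f g)
  case 0
  then show ?case
    using bounded_bilinear.continuous_on[OF assms(2)] by auto
next
  case (Suc n)
  have f: "Ck_on n S f" and g: "Ck_on n S g"
    using Suc.prems Ck_on_lower by blast+
  show ?case
  proof (rule Ck_on_SucI[OF \<open>open S\<close>, where D =
      "\<lambda>x v. b (f x) (frechet_derivative g (at x) v) + b (frechet_derivative f (at x) v) (g x)"])
    show "((\<lambda>x. b (f x) (g x)) has_derivative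
      (\<lambda>v. b (f x) (frechet_derivative g (at x) v) + b (frechet_derivative f (at x) v) (g x))) (at x)"
      if "x \<in> S" for x
      using Suc.prems that
      by (auto intro!: bounded_bilinear.FDERIV[OF assms(2)] has_derivative_frechet[OF \<open>open S\<close>])
    show "Ck_on n S (\<lambda>x. b (f x) (frechet_derivative g (at x) v) + b (frechet_derivative f (at x) v) (g x))" for v
      using Suc f g by (intro Ck_on_add \<open>open S\<close> Suc.IH) auto
  qed
qed

lemma Ck_on_sum:
  assumes "open S" "\<And>i. i \<in> I \<Longrightarrow> Ck_on n S (f i)"
  shows "Ck_on n S (\<lambda>x. \<Sum>i\<in>I. f i x)"
  using assms(2)
  by (induction I rule: infinite_finite_induct) (auto intro: Ck_on_const Ck_on_add[OF \<open>open S\<close>])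

lemma Ck_on_inverse:
  fixes f :: "'a::euclidean_space \<Rightarrow> real"
  assumes "open S" "Ck_on n S f" "\<And>x. x \<in> S \<Longrightarrow> f x \<noteq> 0"
  shows "Ck_on n S (\<lambda>x. inverse (f x))"
  using assms(2)
proof (induction n)
  case 0
  then show ?case using assms(3) by (auto intro!: continuous_on_inverse)
next
  case (Suc n)
  have i: "Ck_on n S (\<lambda>x. inverse (f x))"
    using Suc Ck_on_lower by blast
  show ?case
  proof (rule Ck_on_SucI[OF \<open>open S\<close>, where D =
      "\<lambda>x v. - (inverse (f x) * frechet_derivative f (at x) v * inverse (f x))"])
    show "((\<lambda>x. inverse (f x)) has_derivative
      (\<lambda>v. - (inverse (f x) * frechet_derivative f (at x) v * inverse (f x)))) (at x)"
      if "x \<in> S" for x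
      using Suc.prems that assms(3)
      by (intro Deriv.has_derivative_inverse has_derivative_frechet[OF \<open>open S\<close>]) auto
    show "Ck_on n S (\<lambda>x. - (inverse (f x) * frechet_derivative f (at x) v * inverse (f x)))" for v
      using Suc.prems i
      by (intro Ck_on_linear_compose[OF \<open>open S\<close> bounded_linear_minus[OF bounded_linear_ident]]
            Ck_on_bilinear[OF \<open>open S\<close> bounded_bilinear_mult]) auto
  qed
qed

lemma Ck_on_compose:
  fixes f :: "'a::euclidean_space \<Rightarrow> 'b::euclidean_space" and g :: "'b \<Rightarrow> 'c::real_normed_vector"
  assumes "open S" "open T" "f ` S \<subseteq> T" "Ck_on n S f" "Ck_on n T g"
  shows "Ck_on n S (\<lambda>x. g (f x))"
  using assms(4,5)
proof (induction n arbitrary: g)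
  case 0
  then show ?case using continuous_on_compose2 assms(3) by auto
next
  case (Suc n)
  have f: "Ck_on n S f" using Suc.prems Ck_on_lower by blast
  \<comment> \<open>The hypothesis on \<open>g\<close> controls derivatives in fixed directions
    only, while the chain rule produces a direction depending on \<open>x\<close>. Expanding that
    direction in the basis reduces to fixed ones.\<close>
  have lin: "frechet_derivative g (at (f x)) w = (\<Sum>b\<in>Basis. (w \<bullet> b) *\<^sub>R frechet_derivative g (at (f x)) b)"
    if "x \<in> S" for x w
  proof -
    have l: "linear (frechet_derivative g (at (f x)))"
      using has_derivative_frechet[OF \<open>open T\<close>, of g "f x"] Suc.prems assms(3) that
      by (auto intro: has_derivative_linear)
    have "frechet_derivative g (at (f x)) w = frechet_derivative g (at (f x)) (\<Sum>b\<in>Basis. (w \<bullet> b) *\<^sub>R b)"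
      by (simp add: euclidean_representation)
    also have "\<dots> = (\<Sum>b\<in>Basis. (w \<bullet> b) *\<^sub>R frechet_derivative g (at (f x)) b)"
      by (simp add: linear_sum[OF l] linear_scale[OF l])
    finally show ?thesis .
  qed
  show ?case
  proof (rule Ck_on_SucI[OF \<open>open S\<close>, where D =
      "\<lambda>x v. frechet_derivative g (at (f x)) (frechet_derivative f (at x) v)"])
    show "((\<lambda>x. g (f x)) has_derivative
      (\<lambda>v. frechet_derivative g (at (f x)) (frechet_derivative f (at x) v))) (at x)"
      if "x \<in> S" for x
    proof (rule has_derivative_compose[of f])
      show "(f has_derivative frechet_derivative f (at x)) (at x)"
        using Suc.prems that by (auto intro!: has_derivative_frechet[OF \<open>open S\<close>])
      show "(g has_derivative frechet_derivative g (at (f x))) (at (f x))"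
        using Suc.prems that assms(3) by (auto intro!: has_derivative_frechet[OF \<open>open T\<close>])
    qed
    fix v
    have "Ck_on n S (\<lambda>x. \<Sum>b\<in>Basis. (frechet_derivative f (at x) v \<bullet> b) *\<^sub>R frechet_derivative g (at (f x)) b)"
      using Suc f
      by (intro Ck_on_sum[OF \<open>open S\<close>] Ck_on_bilinear[OF \<open>open S\<close> bounded_bilinear_scaleR]
            Ck_on_linear_compose[OF \<open>open S\<close> bounded_linear_inner_left]) auto
    then show "Ck_on n S (\<lambda>x. frechet_derivative g (at (f x)) (frechet_derivative f (at x) v))"
      by (rule Ck_on_cong[OF \<open>open S\<close>, rotated]) (metis lin)
  qed
qed

lemma Ck_on_local:
  assumes "\<And>x. x \<in> S \<Longrightarrow> \<exists>T. open T \<and> x \<in> T \<and> Ck_on n T f"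
  shows "Ck_on n S f"
  using assms
proof (induction n arbitrary: f)
  case 0
  then show ?case
    by (metis Ck_on.simps(1) continuous_at_imp_continuous_on continuous_on_eq_continuous_at)
next
  case (Suc n)
  have "f differentiable at x" if "x \<in> S" for x
    using Suc.prems[OF that] differentiable_on_eq_differentiable_at by auto
  moreover have "Ck_on n S (\<lambda>x. frechet_derivative f (at x) v)" for v
  proof (rule Suc.IH)
    show "\<exists>T. open T \<and> x \<in> T \<and> Ck_on n T (\<lambda>x. frechet_derivative f (at x) v)" if "x \<in> S" for x
      using Suc.prems[OF that] by auto
  qed
  ultimately show ?case
    by (auto intro: differentiable_at_imp_differentiable_on)
qed

subsection \<open>Smooth maps\<close>

lemma smooth_on_cong:
  assumes "open S" "\<And>x. x \<in> S \<Longrightarrow> f x = g x" "smooth_on S f"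
  shows "smooth_on S g"
  using assms unfolding smooth_on_def by (meson Ck_on_cong)

lemma smooth_on_subset: "smooth_on S f \<Longrightarrow> T \<subseteq> S \<Longrightarrow> smooth_on T f"
  unfolding smooth_on_def by (meson Ck_on_subset)

lemma smooth_on_const: "smooth_on S (\<lambda>x. c)"
  by (simp add: smooth_on_def Ck_on_const)

lemma smooth_on_bounded_linear: "open S \<Longrightarrow> bounded_linear f \<Longrightarrow> smooth_on S f"
  by (simp add: smooth_on_def Ck_on_bounded_linear)

lemma smooth_on_ident: "open S \<Longrightarrow> smooth_on S (\<lambda>x. x)"
  by (simp add: smooth_on_bounded_linear)

lemma smooth_on_linear_compose:
  "open S \<Longrightarrow> bounded_linear h \<Longrightarrow> smooth_on S f \<Longrightarrow> smooth_on S (\<lambda>x. h (f x))"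
  by (simp add: smooth_on_def Ck_on_linear_compose)

lemma smooth_on_inner_right: "open S \<Longrightarrow> smooth_on S f \<Longrightarrow> smooth_on S (\<lambda>x. f x \<bullet> c)"
  by (rule smooth_on_linear_compose[OF _ bounded_linear_inner_left])

lemma smooth_on_add:
  "open S \<Longrightarrow> smooth_on S f \<Longrightarrow> smooth_on S g \<Longrightarrow> smooth_on S (\<lambda>x. f x + g x)"
  by (simp add: smooth_on_def Ck_on_add)

lemma smooth_on_minus: "open S \<Longrightarrow> smooth_on S f \<Longrightarrow> smooth_on S (\<lambda>x. - f x)"
  by (rule smooth_on_linear_compose[OF _ bounded_linear_minus[OF bounded_linear_ident]])

lemma smooth_on_diff:
  assumes "open S" "smooth_on S f" "smooth_on S g"
  shows "smooth_on S (\<lambda>x. f x - g x)"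
  using smooth_on_add[OF assms(1,2) smooth_on_minus[OF assms(1,3)]] by simp

lemma smooth_on_sum:
  "open S \<Longrightarrow> (\<And>i. i \<in> I \<Longrightarrow> smooth_on S (f i)) \<Longrightarrow> smooth_on S (\<lambda>x. \<Sum>i\<in>I. f i x)"
  by (simp add: smooth_on_def Ck_on_sum)

lemma smooth_on_scaleR:
  "open S \<Longrightarrow> smooth_on S f \<Longrightarrow> smooth_on S g \<Longrightarrow> smooth_on S (\<lambda>x. f x *\<^sub>R g x)"
  by (simp add: smooth_on_def Ck_on_bilinear[OF _ bounded_bilinear_scaleR])

lemma smooth_on_inner:
  "open S \<Longrightarrow> smooth_on S f \<Longrightarrow> smooth_on S g \<Longrightarrow> smooth_on S (\<lambda>x. f x \<bullet> g x)"
  by (simp add: smooth_on_def Ck_on_bilinear[OF _ bounded_bilinear_inner])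

lemma smooth_on_mult:
  fixes f g :: "'a::euclidean_space \<Rightarrow> real"
  shows "open S \<Longrightarrow> smooth_on S f \<Longrightarrow> smooth_on S g \<Longrightarrow> smooth_on S (\<lambda>x. f x * g x)"
  by (simp add: smooth_on_def Ck_on_bilinear[OF _ bounded_bilinear_mult])

lemma smooth_on_divide:
  fixes f g :: "'a::euclidean_space \<Rightarrow> real"
  assumes "open S" "smooth_on S f" "smooth_on S g" "\<And>x. x \<in> S \<Longrightarrow> g x \<noteq> 0"
  shows "smooth_on S (\<lambda>x. f x / g x)"
  unfolding divide_inverse using assms
  by (intro smooth_on_mult) (auto simp: smooth_on_def intro: Ck_on_inverse)

lemma smooth_on_compose:
  fixes f :: "'a::euclidean_space \<Rightarrow> 'b::euclidean_space" and g :: "'b \<Rightarrow> 'c::real_normed_vector"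
  assumes "open S" "open T" "f ` S \<subseteq> T" "smooth_on S f" "smooth_on T g"
  shows "smooth_on S (\<lambda>x. g (f x))"
  using Ck_on_compose[OF assms(1-3)] assms(4,5) unfolding smooth_on_def by blast

lemma smooth_on_local:
  assumes "\<And>x. x \<in> S \<Longrightarrow> \<exists>T. open T \<and> x \<in> T \<and> smooth_on T f"
  shows "smooth_on S f"
  using assms unfolding smooth_on_def by (meson Ck_on_local)

lemma smooth_on_differentiable: "smooth_on S f \<Longrightarrow> f differentiable_on S"
  unfolding smooth_on_def by (metis Ck_on.simps(2))

lemma smooth_on_continuous: "smooth_on S f \<Longrightarrow> continuous_on S f"
  unfolding smooth_on_def by (metis Ck_on.simps(1))

lemma smooth_on_has_derivative:
  assumes "open S" "smooth_on S f" "x \<in> S"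
  shows "(f has_derivative frechet_derivative f (at x)) (at x)"
  using has_derivative_frechet[OF assms(1) smooth_on_differentiable[OF assms(2)] assms(3)] .

lemma smooth_on_frechet_const:
  "smooth_on S f \<Longrightarrow> smooth_on S (\<lambda>x. frechet_derivative f (at x) v)"
  unfolding smooth_on_def by (metis Ck_on.simps(2))

lemma linear_Basis_expansion:
  fixes f :: "'a::euclidean_space \<Rightarrow> 'b::real_vector"
  assumes "linear f"
  shows "f w = (\<Sum>b\<in>Basis. (w \<bullet> b) *\<^sub>R f b)"
proof -
  have "f w = f (\<Sum>b\<in>Basis. (w \<bullet> b) *\<^sub>R b)"
    by (simp add: euclidean_representation)
  then show ?thesis
    by (simp add: linear_sum[OF assms] linear_scale[OF assms])
qed

lemma smooth_on_frechet_linear: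
  assumes "open S" "smooth_on S f" "x \<in> S"
  shows "linear (frechet_derivative f (at x))"
  using smooth_on_has_derivative[OF assms] has_derivative_linear by blast

lemma smooth_on_frechet:
  fixes f :: "'a::euclidean_space \<Rightarrow> 'b::real_normed_vector"
  assumes "open S" "smooth_on S f" "smooth_on S a"
  shows "smooth_on S (\<lambda>x. frechet_derivative f (at x) (a x))"
proof (rule smooth_on_cong[OF \<open>open S\<close>])
  show "(\<Sum>b\<in>Basis. (a x \<bullet> b) *\<^sub>R frechet_derivative f (at x) b) = frechet_derivative f (at x) (a x)"
    if "x \<in> S" for x
    using linear_Basis_expansion[OF smooth_on_frechet_linear[OF assms(1,2) that]] by metis
  show "smooth_on S (\<lambda>x. \<Sum>b\<in>Basis. (a x \<bullet> b) *\<^sub>R frechet_derivative f (at x) b)"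
    using assms by (intro smooth_on_sum smooth_on_scaleR smooth_on_inner_right smooth_on_frechet_const)
qed

lemma frechet_derivative_cong_open:
  assumes "open S" "x \<in> S" "\<And>y. y \<in> S \<Longrightarrow> f y = g y"
  shows "frechet_derivative f (at x) = frechet_derivative g (at x)"
proof -
  have "(f has_derivative D) (at x) \<longleftrightarrow> (g has_derivative D) (at x)" for D
    using assms by (metis has_derivative_transform_within_open)
  then show ?thesis by (simp add: frechet_derivative_def)
qed

subsection \<open>Moving frames\<close>

text \<open>Both lemmas eliminate one vector at a time, projecting the others on its orthogonal complement.\<close>

lemma Ck_on_frame_coefficients:
  fixes w :: "nat \<Rightarrow> 'a::euclidean_space \<Rightarrow> 'b::euclidean_space"
  assumes "open S" "\<And>i. i < r \<Longrightarrow> Ck_on n S (w i)" "Ck_on n S v"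
    and "\<And>y. y \<in> S \<Longrightarrow> v y = (\<Sum>i<r. c i y *\<^sub>R w i y)"
    and "\<And>y a. y \<in> S \<Longrightarrow> (\<Sum>i<r. a i *\<^sub>R w i y) = 0 \<Longrightarrow> \<forall>i<r. a i = 0"
    and "i < r"
  shows "Ck_on n S (c i)"
  using assms(2-6)
proof (induction r arbitrary: w v i)
  case 0
  then show ?case by simp
next
  case (Suc r)
  define u where "u = w r"
  have u: "Ck_on n S u" using Suc.prems by (simp add: u_def)
  have u0: "u y \<noteq> 0" if "y \<in> S" for y
  proof
    assume "u y = 0"
    then have "(\<Sum>i<Suc r. (if i = r then 1 else 0) *\<^sub>R w i y) = 0"
      by (simp add: u_def)
    from Suc.prems(4)[OF that this] show False by (metis lessI zero_neq_one)
  qed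
  define P where "P z y = z - ((z \<bullet> u y) * inverse (u y \<bullet> u y)) *\<^sub>R u y" for z y
  note bil = Ck_on_bilinear[OF \<open>open S\<close>]
  have inv: "Ck_on n S (\<lambda>y. inverse (u y \<bullet> u y))"
    using u u0 by (intro Ck_on_inverse[OF \<open>open S\<close>] bil[OF bounded_bilinear_inner]) auto
  have CP: "Ck_on n S (\<lambda>y. P (f y) y)" if "Ck_on n S f" for f
  proof -
    have "Ck_on n S (\<lambda>y. f y + - (((f y \<bullet> u y) * inverse (u y \<bullet> u y)) *\<^sub>R u y))"
      using that u inv
      by (intro Ck_on_add[OF \<open>open S\<close>] bil[OF bounded_bilinear_scaleR] bil[OF bounded_bilinear_mult]
          bil[OF bounded_bilinear_inner] Ck_on_linear_compose[OF \<open>open S\<close> bounded_linear_minus[OF bounded_linear_ident]])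
    then show ?thesis by (simp add: P_def)
  qed
  have Pu: "P (u y) y = 0" if "y \<in> S" for y
    using u0[OF that] by (simp add: P_def)
  have linP: "linear (\<lambda>z. P z y)" for y
    by (rule linearI) (auto simp: P_def inner_add_left algebra_simps)
  have less: "Ck_on n S (c i)" if "i < r" for i
  proof (rule Suc.IH[of "\<lambda>i y. P (w i y) y" "\<lambda>y. P (v y) y", OF _ _ _ _ that])
    show "Ck_on n S (\<lambda>y. P (w i y) y)" if "i < r" for i
      using Suc.prems(1)[of i] that by (intro CP) auto
    show "Ck_on n S (\<lambda>y. P (v y) y)" using Suc.prems(2) by (rule CP)
    show "P (v y) y = (\<Sum>i<r. c i y *\<^sub>R P (w i y) y)" if "y \<in> S" for y
      using Suc.prems(3)[OF that] Pu[OF that]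
      by (simp add: linear_add[OF linP] linear_sum[OF linP] linear_scale[OF linP] u_def)
    show "\<forall>i<r. a i = 0" if y: "y \<in> S" and s: "(\<Sum>i<r. a i *\<^sub>R P (w i y) y) = 0" for y a
    proof -
      have "P (\<Sum>i<r. a i *\<^sub>R w i y) y = 0"
        using s by (simp add: linear_sum[OF linP] linear_scale[OF linP])
      then obtain t where "(\<Sum>i<r. a i *\<^sub>R w i y) = t *\<^sub>R u y"
        unfolding P_def by (metis eq_iff_diff_eq_0)
      then have "(\<Sum>i<Suc r. (if i = r then - t else a i) *\<^sub>R w i y) = 0"
        by (simp add: u_def)
      from Suc.prems(4)[OF y this] show ?thesis by (metis less_Suc_eq less_irrefl)
    qed
  qed
  show ?case
  proof (cases "i = r")
    case True
    \<comment> \<open>The projection loses the coefficient of \<open>u\<close>. Once the other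
      coefficients are under control, the remainder is a multiple of \<open>u\<close>, and pairing
      with \<open>u\<close> recovers the factor.\<close>
    have "Ck_on n S (\<lambda>y. ((v y + - (\<Sum>i<r. c i y *\<^sub>R w i y)) \<bullet> u y) * inverse (u y \<bullet> u y))"
      using Suc.prems u inv less
      by (intro Ck_on_add[OF \<open>open S\<close>] bil[OF bounded_bilinear_scaleR] bil[OF bounded_bilinear_mult]
          bil[OF bounded_bilinear_inner] Ck_on_sum[OF \<open>open S\<close>]
          Ck_on_linear_compose[OF \<open>open S\<close> bounded_linear_minus[OF bounded_linear_ident]]) auto
    then show ?thesis
      by (rule Ck_on_cong[OF \<open>open S\<close>, rotated])
         (use Suc.prems(3) u0 in \<open>auto simp: True u_def\<close>)
  next
    case False
    then show ?thesis using less Suc.prems(5) by auto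
  qed
qed

lemma smooth_extension_orthogonal:
  fixes w :: "nat \<Rightarrow> 'a::euclidean_space \<Rightarrow> 'b::euclidean_space"
  assumes "open S" "\<And>i. i < r \<Longrightarrow> smooth_on S (w i)" "smooth_on S v"
    and "\<And>y a. y \<in> S \<Longrightarrow> (\<Sum>i<r. a i *\<^sub>R w i y) = 0 \<Longrightarrow> \<forall>i<r. a i = 0"
    and "y0 \<in> S" "\<And>i. i < r \<Longrightarrow> w i y0 \<bullet> v y0 = 0"
  shows "\<exists>u. smooth_on S u \<and> u y0 = v y0 \<and> (\<forall>y\<in>S. \<forall>i<r. w i y \<bullet> u y = 0) \<and>
           (\<forall>y\<in>S. \<forall>z. z \<bullet> v y = 0 \<longrightarrow> (\<forall>i<r. z \<bullet> w i y = 0) \<longrightarrow> z \<bullet> u y = 0)"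
  using assms(2-6)
proof (induction r arbitrary: w v)
  case 0
  then show ?case by auto
next
  case (Suc r)
  define t where "t = w r"
  have t: "smooth_on S t" using Suc.prems by (simp add: t_def)
  have t0: "t y \<noteq> 0" if "y \<in> S" for y
  proof
    assume "t y = 0"
    then have "(\<Sum>i<Suc r. (if i = r then 1 else 0) *\<^sub>R w i y) = 0"
      by (simp add: t_def)
    from Suc.prems(3)[OF that this] show False by (metis lessI zero_neq_one)
  qed
  define P where "P z y = z - ((z \<bullet> t y) / (t y \<bullet> t y)) *\<^sub>R t y" for z y
  have CP: "smooth_on S (\<lambda>y. P (f y) y)" if "smooth_on S f" for f
    unfolding P_def using that t t0
    by (intro smooth_on_diff smooth_on_scaleR smooth_on_divide smooth_on_inner \<open>open S\<close>) auto
  have linP: "linear (\<lambda>z. P z y)" for y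
    by (rule linearI) (auto simp: P_def inner_add_left algebra_simps add_divide_distrib)
  have tP: "t y \<bullet> P z y = 0" if "y \<in> S" for y z
    using t0[OF that] by (simp add: P_def inner_diff_right inner_commute)
  have zP: "z \<bullet> P x y = z \<bullet> x" if "z \<bullet> t y = 0" for x y z
    using that by (simp add: P_def inner_diff_right)
  have Pv0: "P (v y0) y0 = v y0"
    using Suc.prems(5)[of r] by (simp add: P_def t_def inner_commute)
  have "\<exists>u. smooth_on S u \<and> u y0 = P (v y0) y0 \<and> (\<forall>y\<in>S. \<forall>i<r. P (w i y) y \<bullet> u y = 0) \<and>
           (\<forall>y\<in>S. \<forall>z. z \<bullet> P (v y) y = 0 \<longrightarrow> (\<forall>i<r. z \<bullet> P (w i y) y = 0) \<longrightarrow> z \<bullet> u y = 0)"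
  proof (rule Suc.IH)
    show "smooth_on S (\<lambda>y. P (w i y) y)" if "i < r" for i
      using Suc.prems(1)[of i] that by (intro CP) auto
    show "smooth_on S (\<lambda>y. P (v y) y)" using Suc.prems(2) by (rule CP)
    show "\<forall>i<r. a i = 0" if y: "y \<in> S" and s: "(\<Sum>i<r. a i *\<^sub>R P (w i y) y) = 0" for y a
    proof -
      have "P (\<Sum>i<r. a i *\<^sub>R w i y) y = 0"
        using s by (simp add: linear_sum[OF linP] linear_scale[OF linP])
      then obtain c where "(\<Sum>i<r. a i *\<^sub>R w i y) = c *\<^sub>R t y"
        unfolding P_def by (metis eq_iff_diff_eq_0)
      then have "(\<Sum>i<Suc r. (if i = r then - c else a i) *\<^sub>R w i y) = 0"
        by (simp add: t_def)
      from Suc.prems(3)[OF y this] show ?thesis by (metis less_Suc_eq less_irrefl)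
    qed
    show "P (w i y0) y0 \<bullet> P (v y0) y0 = 0" if "i < r" for i
      using Suc.prems(5)[of i] Suc.prems(5)[of r] that
      by (simp only: Pv0) (simp add: P_def inner_diff_left t_def)
  qed (use Suc.prems in auto)
  then obtain u where u: "smooth_on S u" "u y0 = P (v y0) y0"
    "\<And>y i. y \<in> S \<Longrightarrow> i < r \<Longrightarrow> P (w i y) y \<bullet> u y = 0"
    "\<And>y z. y \<in> S \<Longrightarrow> z \<bullet> P (v y) y = 0 \<Longrightarrow> (\<forall>i<r. z \<bullet> P (w i y) y = 0) \<Longrightarrow> z \<bullet> u y = 0"
    by blast
  \<comment> \<open>The last clause of the induction hypothesis says that \<open>u\<close> stays in
    the span of the projected vectors, all of which are orthogonal to \<open>t\<close>. The clause
    is carried along for this conclusion.\<close>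
  have tu: "t y \<bullet> u y = 0" if "y \<in> S" for y
    using u(4)[OF that] tP[OF that] by blast
  show ?case
  proof (intro exI conjI ballI allI impI)
    show "smooth_on S u" by (fact u(1))
    show "u y0 = v y0" using u(2) Pv0 by simp
    show "w i y \<bullet> u y = 0" if "y \<in> S" "i < Suc r" for y i
    proof (cases "i = r")
      case True
      then show ?thesis using tu[OF that(1)] by (simp add: t_def)
    next
      case False
      then have "P (w i y) y \<bullet> u y = 0" using u(3) that by simp
      then show ?thesis using tu[OF that(1)] by (simp add: P_def inner_diff_left)
    qed
    show "z \<bullet> u y = 0" if "y \<in> S" "z \<bullet> v y = 0" "\<forall>i<Suc r. z \<bullet> w i y = 0" for y z
      using that by (intro u(4)) (auto simp: zP t_def)
  qed
qed

subsection \<open>The inverse function theorem\<close>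

text \<open>The components of \<open>g' y v\<close> are the coefficients of the fixed vector
  \<open>v\<close> in the frame of the columns of the derivative of \<open>f\<close> at
  \<open>g y\<close>. If \<open>g\<close> is of class \<open>Ck\<close>, so is this frame, hence so
  are the coefficients, and \<open>g\<close> gains one order of differentiability.\<close>

lemma smooth_inverse:
  fixes g :: "'a::euclidean_space \<Rightarrow> 'a"
  assumes "open S" "open T" "smooth_on S f" "g ` T \<subseteq> S"
    and "\<And>y. y \<in> T \<Longrightarrow> (g has_derivative g' y) (at y)"
    and "\<And>y. y \<in> T \<Longrightarrow> g' y = inv (frechet_derivative f (at (g y)))"
    and "\<And>y. y \<in> T \<Longrightarrow> bij (frechet_derivative f (at (g y)))"
  shows "smooth_on T g"
proof -
  obtain e :: "nat \<Rightarrow> 'a" where e: "bij_betw e {..<DIM('a)} Basis"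
    using ex_bij_betw_nat_finite[OF finite_Basis] by (metis atLeast0LessThan)
  have e_inj: "i = j" if "e i = e j" "i < DIM('a)" "j < DIM('a)" for i j
    using e that by (auto simp: bij_betw_def inj_on_def)
  have e_B: "e i \<in> Basis" if "i < DIM('a)" for i using e that by (auto simp: bij_betw_def)
  have sumB: "(\<Sum>b\<in>Basis. h b) = (\<Sum>i<DIM('a). h (e i))" for h :: "'a \<Rightarrow> 'a"
    using sum.reindex_bij_betw[OF e, of h] by simp
  have lin: "linear (frechet_derivative f (at (g y)))" if "y \<in> T" for y
    using smooth_on_frechet_linear[OF assms(1,3)] assms(4) that by auto
  have "Ck_on n T g" for n
  proof (induction n)
    case 0
    then show ?case
      using assms(5) by (auto intro!: continuous_at_imp_continuous_on has_derivative_continuous)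
  next
    case (Suc n)
    show ?case
    proof (rule Ck_on_SucI[OF \<open>open T\<close> assms(5)])
      fix v
      have "Ck_on n T (\<lambda>y. g' y v \<bullet> e i)" if "i < DIM('a)" for i
      proof (rule Ck_on_frame_coefficients[OF \<open>open T\<close>, where w = "\<lambda>i y. frechet_derivative f (at (g y)) (e i)"
          and v = "\<lambda>y. v" and r = "DIM('a)", OF _ _ _ _ that])
        show "Ck_on n T (\<lambda>y. frechet_derivative f (at (g y)) (e i))" for i
          by (rule Ck_on_compose[OF \<open>open T\<close> \<open>open S\<close> assms(4) Suc])
             (use smooth_on_frechet_const[OF assms(3)] in \<open>unfold smooth_on_def, blast\<close>)
        show "v = (\<Sum>i<DIM('a). (g' y v \<bullet> e i) *\<^sub>R frechet_derivative f (at (g y)) (e i))"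
          if y: "y \<in> T" for y
        proof -
          have "v = frechet_derivative f (at (g y)) (g' y v)"
            using assms(6,7)[OF y] by (simp add: bij_is_surj surj_f_inv_f)
          also have "\<dots> = (\<Sum>b\<in>Basis. (g' y v \<bullet> b) *\<^sub>R frechet_derivative f (at (g y)) b)"
            by (rule linear_Basis_expansion[OF lin[OF y]])
          also have "\<dots> = (\<Sum>i<DIM('a). (g' y v \<bullet> e i) *\<^sub>R frechet_derivative f (at (g y)) (e i))"
            by (rule sumB)
          finally show ?thesis .
        qed
        show "\<forall>i<DIM('a). a i = 0"
          if y: "y \<in> T" and s: "(\<Sum>i<DIM('a). a i *\<^sub>R frechet_derivative f (at (g y)) (e i)) = 0" for y a
        proof -
          let ?u = "\<Sum>i<DIM('a). a i *\<^sub>R e i"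
          have "frechet_derivative f (at (g y)) ?u = 0"
            using s by (simp add: linear_sum[OF lin[OF y]] linear_scale[OF lin[OF y]])
          then have "?u = 0"
            using assms(7)[OF y] linear_0[OF lin[OF y]] by (metis bij_is_inj injD)
          moreover have "?u \<bullet> e j = a j" if "j < DIM('a)" for j
          proof -
            have "?u \<bullet> e j = (\<Sum>i<DIM('a). if i = j then a j else 0)"
              unfolding inner_sum_left
              by (rule sum.cong) (use e_inj e_B that in \<open>auto simp: inner_Basis\<close>)
            then show ?thesis using that by simp
          qed
          ultimately show ?thesis by force
        qed
      qed (auto intro: Ck_on_const)
      then have "Ck_on n T (\<lambda>y. \<Sum>i<DIM('a). (g' y v \<bullet> e i) *\<^sub>R e i)"
        by (intro Ck_on_sum Ck_on_bilinear[OF _ bounded_bilinear_scaleR] Ck_on_const \<open>open T\<close>) auto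
      moreover have "(\<Sum>i<DIM('a). (g' y v \<bullet> e i) *\<^sub>R e i) = g' y v" for y
        using sumB[of "\<lambda>b. (g' y v \<bullet> b) *\<^sub>R b"] by (simp add: euclidean_representation)
      ultimately show "Ck_on n T (\<lambda>y. g' y v)" by simp
    qed
  qed
  then show ?thesis by (simp add: smooth_on_def)
qed

text \<open>The \<open>C1\<close> inverse function theorem provides the inverse, and
  \<open>smooth_inverse\<close> raises its regularity. The passage to \<open>Blinfun\<close> gives
  the derivative as a continuous map into bounded linear operators.\<close>

lemma smooth_local_diffeomorphism:
  fixes f :: "'a::euclidean_space \<Rightarrow> 'a"
  assumes "open S" "smooth_on S f" "x0 \<in> S" "inj (frechet_derivative f (at x0))"
  obtains U T g where "open U" "U \<subseteq> S" "x0 \<in> U" "open T" "homeomorphism U T f g" "smooth_on T g"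
proof -
  let ?D = "\<lambda>x. frechet_derivative f (at x)"
  define f' where "f' x = Blinfun (?D x)" for x
  have der: "(f has_derivative ?D x) (at x)" if "x \<in> S" for x
    using smooth_on_has_derivative[OF assms(1,2) that] .
  then have app: "blinfun_apply (f' x) = ?D x" if "x \<in> S" for x
    unfolding f'_def using that by (intro bounded_linear_Blinfun_apply) (auto dest: has_derivative_bounded_linear)
  have cont: "continuous_on S f'"
  proof (rule continuous_on_blinfun_componentwise)
    fix b :: 'a
    have "continuous_on S (\<lambda>x. ?D x b)"
      using smooth_on_continuous[OF smooth_on_frechet_const[OF assms(2)]] .
    then show "continuous_on S (\<lambda>x. blinfun_apply (f' x) b)"
      by (rule continuous_on_eq) (simp add: app)
  qed
  have lin: "linear (?D x0)" using smooth_on_frechet_linear[OF assms(1-3)] .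
  obtain g0 where g0: "linear g0" "g0 \<circ> ?D x0 = id"
    using linear_injective_left_inverse[OF lin assms(4)] by blast
  have "Blinfun g0 o\<^sub>L f' x0 = id_blinfun"
    using g0 app[OF assms(3)]
    by (intro blinfun_eqI) (simp add: bounded_linear_Blinfun_apply linear_conv_bounded_linear fun_eq_iff)
  with inverse_function_theorem[OF assms(1) _ cont assms(3), of f "Blinfun g0"] der app
  obtain U T g g' where U: "open U" "U \<subseteq> S" "x0 \<in> U" "open T" "homeomorphism U T f g"
    and g: "\<And>y. y \<in> T \<Longrightarrow> (g has_derivative g' y) (at y)"
      "\<And>y. y \<in> T \<Longrightarrow> g' y = inv (blinfun_apply (f' (g y)))"
      "\<And>y. y \<in> T \<Longrightarrow> bij (blinfun_apply (f' (g y)))"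
    by metis
  have gU: "g ` T \<subseteq> S" using U by (auto simp: homeomorphism_def)
  have f'g: "blinfun_apply (f' (g y)) = ?D (g y)" if "y \<in> T" for y
    using app gU that by blast
  have "smooth_on T g"
    using g f'g by (intro smooth_inverse[OF assms(1) U(4) assms(2) gU g(1)]) metis+
  with U show ?thesis using that by blast
qed

subsection \<open>Bump functions\<close>

lemma power_exp_tendsto_0: "((\<lambda>t::real. inverse t ^ n * exp (- inverse t)) \<longlongrightarrow> 0) (at_right 0)"
proof -
  have "((\<lambda>t::real. inverse t ^ n / exp (inverse t)) \<longlongrightarrow> 0) (at_right 0)"
    by (rule filterlim_compose[OF tendsto_power_div_exp_0 filterlim_inverse_at_top_right])
  then show ?thesis by (simp add: exp_minus divide_inverse)
qed

text \<open>\<open>flat 0\<close> is the usual \<open>exp (-1/t)\<close> extended by 0. The powers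
  of \<open>1/t\<close> make the family stable under differentiation, so smoothness can be proved
  for all \<open>n\<close> at once.\<close>

definition flat :: "nat \<Rightarrow> real \<Rightarrow> real" where
  "flat n t = (if t \<le> 0 then 0 else inverse t ^ n * exp (- inverse t))"

lemma flat_has_derivative:
  "(flat n has_derivative (\<lambda>h. h * (flat (n + 2) t - real n * flat (n + 1) t))) (at t)"
proof -
  consider "t < 0" | "t > 0" | "t = 0" by linarith
  then show ?thesis
  proof cases
    case 1
    have "((\<lambda>t. 0) has_derivative (\<lambda>h. 0)) (at t)" by simp
    then show ?thesis
      by (rule has_derivative_transform_within_open[of _ _ _ _ "{..<0}", THEN has_derivative_eq_rhs])
         (use 1 in \<open>auto simp: flat_def\<close>)
  next
    case 2
    have "((\<lambda>t. inverse t ^ n * exp (- inverse t)) has_real_derivative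
        (flat (n + 2) t - real n * flat (n + 1) t)) (at t)"
    proof (rule DERIV_cong)
      have i: "(inverse has_real_derivative - (inverse t ^ Suc (Suc 0))) (at t)"
        using 2 by (intro DERIV_inverse) auto
      show "((\<lambda>t. inverse t ^ n * exp (- inverse t)) has_real_derivative
          real n * (- (inverse t ^ Suc (Suc 0)) * inverse t ^ (n - Suc 0)) * exp (- inverse t) +
          exp (- inverse t) * - (- (inverse t ^ Suc (Suc 0))) * inverse t ^ n) (at t)"
        by (rule DERIV_mult[OF DERIV_power[OF i] DERIV_fun_exp[OF DERIV_minus[OF i]]])
      show "real n * (- (inverse t ^ Suc (Suc 0)) * inverse t ^ (n - Suc 0)) * exp (- inverse t) +
          exp (- inverse t) * - (- (inverse t ^ Suc (Suc 0))) * inverse t ^ n =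
          flat (n + 2) t - real n * flat (n + 1) t"
        using 2 by (cases n) (simp_all add: flat_def algebra_simps)
    qed
    then have "(flat n has_real_derivative (flat (n + 2) t - real n * flat (n + 1) t)) (at t)"
      by (rule has_field_derivative_transform_within_open[of _ _ _ "{0<..}"]) (use 2 in \<open>auto simp: flat_def\<close>)
    then show ?thesis
      unfolding has_field_derivative_def by (rule has_derivative_eq_rhs) (auto simp: fun_eq_iff)
  next
    case 3
    \<comment> \<open>For positive \<open>h\<close> the difference quotient at 0 is
      \<open>flat (n + 1) h\<close>, so the same limit applies with exponent
      \<open>Suc n\<close>.\<close>
    have "((\<lambda>h. flat n h / h) \<longlongrightarrow> 0) (at 0)"
    proof (rule filterlim_split_at_real)
      show "((\<lambda>h. flat n h / h) \<longlongrightarrow> 0) (at_left 0)"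
        by (rule tendsto_eventually) (auto simp: flat_def eventually_at_left_field intro!: exI[of _ "-1"])
      show "((\<lambda>h. flat n h / h) \<longlongrightarrow> 0) (at_right 0)"
        by (rule Lim_transform_eventually[OF power_exp_tendsto_0[of "Suc n"]])
           (auto simp: flat_def divide_inverse mult_ac eventually_at_right_field intro!: exI[of _ 1])
    qed
    then have "(flat n has_real_derivative 0) (at 0)"
      by (simp add: has_field_derivative_iff flat_def)
    then show ?thesis
      unfolding has_field_derivative_def 3 by (rule has_derivative_eq_rhs) (simp add: flat_def fun_eq_iff)
  qed
qed

lemma smooth_on_flat: "smooth_on UNIV (flat n)"
proof -
  have "Ck_on k UNIV (flat n)" for k n
  proof (induction k arbitrary: n)
    case 0
    then show ?case
      by (auto intro!: continuous_at_imp_continuous_on has_derivative_continuous flat_has_derivative)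
  next
    case (Suc k)
    have "Ck_on k UNIV (\<lambda>t. v *\<^sub>R (flat (n + 2) t + (- real n) *\<^sub>R flat (n + 1) t))" for v
      by (intro Ck_on_add Ck_on_bilinear[OF _ bounded_bilinear_scaleR] Ck_on_const Suc.IH open_UNIV)
    then show ?case
      by (intro Ck_on_SucI[OF open_UNIV flat_has_derivative]) simp
  qed
  then show ?thesis by (simp add: smooth_on_def)
qed

lemma smooth_bump:
  fixes y :: "'a::euclidean_space"
  assumes "0 < r"
  obtains h :: "'a \<Rightarrow> real" where "smooth_on UNIV h"
    "\<And>z. z \<in> ball y (r / 2) \<Longrightarrow> h z = 1" "\<And>z. z \<notin> ball y r \<Longrightarrow> h z = 0"
proof -
  \<comment> \<open>A smooth step: 0 for \<open>t \<le> 0\<close> and 1 for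
    \<open>t \<ge> 1\<close>. The denominator is positive because \<open>t\<close> and
    \<open>1 - t\<close> are never both nonpositive.\<close>
  define a where "a t = flat 0 t / (flat 0 t + flat 0 (1 - t))" for t
  have pos: "flat 0 t + flat 0 (1 - t) > 0" for t
    by (auto simp: flat_def add_pos_pos)
  have m: "smooth_on UNIV (\<lambda>t::real. flat 0 (1 - t))"
    by (rule smooth_on_compose[OF open_UNIV open_UNIV _ _ smooth_on_flat])
       (auto intro!: smooth_on_diff smooth_on_const smooth_on_ident)
  have sa: "smooth_on UNIV a"
    unfolding a_def using pos
    by (intro smooth_on_divide smooth_on_add smooth_on_flat m open_UNIV) (metis less_irrefl)
  \<comment> \<open>The factor 4/3 makes \<open>s\<close> equal to 1 at distance
    \<open>r / 2\<close> from \<open>y\<close>, while \<open>s\<close> is 0 at distance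
    \<open>r\<close>. The squared distance keeps \<open>s\<close> smooth at \<open>y\<close>
    itself.\<close>
  define s where "s z = (4/3) * (1 - ((z - y) \<bullet> (z - y)) / r^2)" for z :: 'a
  have ss: "smooth_on UNIV s"
    unfolding s_def
    by (intro smooth_on_mult smooth_on_diff smooth_on_divide smooth_on_inner smooth_on_const smooth_on_ident open_UNIV)
       (use assms in auto)
  have n: "(z - y) \<bullet> (z - y) = (dist y z)^2" for z
    by (metis dist_commute dist_norm power2_norm_eq_inner)
  have "smooth_on UNIV (\<lambda>z. a (s z))"
    by (rule smooth_on_compose[OF open_UNIV open_UNIV _ ss sa]) auto
  moreover have "a (s z) = 1" if "z \<in> ball y (r / 2)" for z
  proof -
    have "(dist y z)^2 \<le> (r / 2)^2"
      using that assms by (intro power_mono) auto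
    then have "s z \<ge> 1" using assms by (simp add: s_def n field_simps)
    then show ?thesis by (simp add: a_def flat_def)
  qed
  moreover have "a (s z) = 0" if "z \<notin> ball y r" for z
  proof -
    have "r^2 \<le> (dist y z)^2"
      using that assms by (intro power_mono) auto
    then have "s z \<le> 0" using assms by (simp add: s_def n field_simps)
    then show ?thesis by (simp add: a_def flat_def)
  qed
  ultimately show ?thesis using that by blast
qed

subsection \<open>Symmetry of second derivatives\<close>

text \<open>Mean value theorem in direction \<open>u\<close> for the increment in \<open>v\<close>,
  then in direction \<open>v\<close>. The second difference is symmetric in \<open>u\<close> and
  \<open>v\<close>, which is the source of the symmetry of second derivatives.\<close>

lemma second_difference_mvt:
  fixes f :: "'a::euclidean_space \<Rightarrow> real"
  assumes "open S" "smooth_on S f" "cball x r \<subseteq> S" "0 < t" "t * (norm u + norm v) \<le> r"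
  shows "\<exists>z. dist x z \<le> t * (norm u + norm v) \<and>
    f (x + t *\<^sub>R u + t *\<^sub>R v) - f (x + t *\<^sub>R u) - f (x + t *\<^sub>R v) + f x =
    t\<^sup>2 * frechet_derivative (\<lambda>y. frechet_derivative f (at y) u) (at z) v"
proof -
  let ?D = "\<lambda>y. frechet_derivative f (at y)"
  let ?g = "\<lambda>y. ?D y u"
  let ?E = "\<lambda>y. frechet_derivative ?g (at y)"
  have near: "dist x (x + p *\<^sub>R u + q *\<^sub>R v) \<le> t * (norm u + norm v)" "x + p *\<^sub>R u + q *\<^sub>R v \<in> S"
    if "0 \<le> p" "p \<le> t" "0 \<le> q" "q \<le> t" for p q
  proof -
    have "norm (p *\<^sub>R u + q *\<^sub>R v) \<le> p * norm u + q * norm v"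
      using norm_triangle_ineq[of "p *\<^sub>R u" "q *\<^sub>R v"] that by simp
    also have "\<dots> \<le> t * norm u + t * norm v"
      using that by (intro add_mono mult_right_mono) auto
    finally have "norm (p *\<^sub>R u + q *\<^sub>R v) \<le> t * (norm u + norm v)"
      by (simp add: distrib_left)
    moreover have "dist x (x + p *\<^sub>R u + q *\<^sub>R v) = norm (p *\<^sub>R u + q *\<^sub>R v)"
      unfolding add.assoc dist_norm by (metis add_diff_cancel_left' norm_minus_commute)
    ultimately show *: "dist x (x + p *\<^sub>R u + q *\<^sub>R v) \<le> t * (norm u + norm v)"
      by simp
    then show "x + p *\<^sub>R u + q *\<^sub>R v \<in> S" using assms by auto
  qed
  have dline: "((\<lambda>p. f (x + p *\<^sub>R u + q *\<^sub>R v)) has_real_derivative ?D (x + p *\<^sub>R u + q *\<^sub>R v) u) (at p)"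
    if "0 \<le> p" "p \<le> t" "0 \<le> q" "q \<le> t" for p q
  proof -
    have "((\<lambda>p. x + p *\<^sub>R u + q *\<^sub>R v) has_derivative (\<lambda>h. h *\<^sub>R u)) (at p)"
      by (auto intro!: derivative_eq_intros)
    from has_derivative_compose[OF this smooth_on_has_derivative[OF assms(1,2) near(2)[OF that]]]
    show ?thesis
      using linear_scale[OF smooth_on_frechet_linear[OF assms(1,2) near(2)[OF that]]]
      unfolding has_field_derivative_def
      by (auto elim!: has_derivative_eq_rhs simp: fun_eq_iff)
  qed
  have g: "smooth_on S ?g" using smooth_on_frechet_const[OF assms(2)] .
  have eline: "((\<lambda>q. ?g (x + p *\<^sub>R u + q *\<^sub>R v)) has_real_derivative ?E (x + p *\<^sub>R u + q *\<^sub>R v) v) (at q)"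
    if "0 \<le> p" "p \<le> t" "0 \<le> q" "q \<le> t" for p q
  proof -
    have "((\<lambda>q. x + p *\<^sub>R u + q *\<^sub>R v) has_derivative (\<lambda>h. h *\<^sub>R v)) (at q)"
      by (auto intro!: derivative_eq_intros)
    from has_derivative_compose[OF this smooth_on_has_derivative[OF assms(1) g near(2)[OF that]]]
    show ?thesis
      using linear_scale[OF smooth_on_frechet_linear[OF assms(1) g near(2)[OF that]]]
      unfolding has_field_derivative_def
      by (auto elim!: has_derivative_eq_rhs simp: fun_eq_iff)
  qed
  have "((\<lambda>p. f (x + p *\<^sub>R u + t *\<^sub>R v) - f (x + p *\<^sub>R u + 0 *\<^sub>R v)) has_real_derivative
      ?g (x + p *\<^sub>R u + t *\<^sub>R v) - ?g (x + p *\<^sub>R u + 0 *\<^sub>R v)) (at p)" if "0 \<le> p" "p \<le> t" for p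
    by (intro DERIV_diff dline that) (use assms(4) in auto)
  from MVT2[OF assms(4) this] obtain p where p: "0 < p" "p < t" and
    1: "(f (x + t *\<^sub>R u + t *\<^sub>R v) - f (x + t *\<^sub>R u + 0 *\<^sub>R v)) - (f (x + 0 *\<^sub>R u + t *\<^sub>R v) - f (x + 0 *\<^sub>R u + 0 *\<^sub>R v))
       = (t - 0) * (?g (x + p *\<^sub>R u + t *\<^sub>R v) - ?g (x + p *\<^sub>R u + 0 *\<^sub>R v))"
    by auto
  have "((\<lambda>q. ?g (x + p *\<^sub>R u + q *\<^sub>R v)) has_real_derivative ?E (x + p *\<^sub>R u + q *\<^sub>R v) v) (at q)"
    if "0 \<le> q" "q \<le> t" for q
    by (rule eline) (use that p in auto)
  from MVT2[OF assms(4) this] obtain q where q: "0 < q" "q < t" and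
    2: "?g (x + p *\<^sub>R u + t *\<^sub>R v) - ?g (x + p *\<^sub>R u + 0 *\<^sub>R v) = (t - 0) * ?E (x + p *\<^sub>R u + q *\<^sub>R v) v"
    by auto
  show ?thesis
    using 1 near(1)[of p q] p q
    by (intro exI[of _ "x + p *\<^sub>R u + q *\<^sub>R v"]) (unfold 2, simp add: power2_eq_square)
qed

lemma second_derivative_symmetric:
  fixes f :: "'a::euclidean_space \<Rightarrow> real"
  assumes "open S" "smooth_on S f" "x \<in> S"
  shows "frechet_derivative (\<lambda>y. frechet_derivative f (at y) u) (at x) v =
         frechet_derivative (\<lambda>y. frechet_derivative f (at y) v) (at x) u"
proof -
  define E where "E u v y = frechet_derivative (\<lambda>y. frechet_derivative f (at y) u) (at y) v" for u v y
  have cont: "continuous_on S (E u v)" for u v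
    unfolding E_def using smooth_on_frechet_const assms(2) smooth_on_continuous by blast
  obtain r where r: "r > 0" "cball x r \<subseteq> S"
    using assms open_contains_cball by blast
  define K where "K = norm u + norm v"
  have K: "K \<ge> 0" by (simp add: K_def)
  have "\<bar>E u v x - E v u x\<bar> \<le> 2 * e" if e: "e > 0" for e
  proof -
    have near: "\<exists>d>0. \<forall>z. dist x z < d \<longrightarrow> \<bar>E a b z - E a b x\<bar> < e" for a b
    proof -
      have "isCont (E a b) x" using cont assms(1,3) by (simp add: continuous_on_eq_continuous_at)
      then have "\<exists>d>0. \<forall>z. dist z x < d \<longrightarrow> dist (E a b z) (E a b x) < e"
        using e unfolding continuous_at_eps_delta dist_real_def by (simp add: dist_real_def)
      then show ?thesis by (simp add: dist_real_def dist_commute)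
    qed
    obtain d1 where d1: "d1 > 0" "\<And>z. dist x z < d1 \<Longrightarrow> \<bar>E u v z - E u v x\<bar> < e" using near by blast
    obtain d2 where d2: "d2 > 0" "\<And>z. dist x z < d2 \<Longrightarrow> \<bar>E v u z - E v u x\<bar> < e" using near by blast
    \<comment> \<open>Small enough for both mean value points to lie in the ball of radius
      \<open>r\<close> and within both continuity radii; the added 1 avoids division by zero when
      \<open>u\<close> and \<open>v\<close> vanish.\<close>
    define t where "t = min r (min d1 d2) / (K + 1)"
    have t: "t > 0" using r d1 d2 K by (simp add: t_def)
    have tK: "t * K < min r (min d1 d2)"
    proof -
      define m where "m = min r (min d1 d2)"
      have "m > 0" using r d1 d2 by (simp add: m_def)
      then show ?thesis unfolding t_def m_def[symmetric] using K by (simp add: field_simps)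
    qed
    obtain z where z: "dist x z \<le> t * K" "f (x + t *\<^sub>R u + t *\<^sub>R v) - f (x + t *\<^sub>R u) - f (x + t *\<^sub>R v) + f x = t\<^sup>2 * E u v z"
      using second_difference_mvt[OF assms(1,2) r(2) t, of u v] tK unfolding K_def E_def by force
    obtain y where y: "dist x y \<le> t * K" "f (x + t *\<^sub>R v + t *\<^sub>R u) - f (x + t *\<^sub>R v) - f (x + t *\<^sub>R u) + f x = t\<^sup>2 * E v u y"
      using second_difference_mvt[OF assms(1,2) r(2) t, of v u] tK unfolding K_def E_def
      by (force simp: add.commute)
    have "t\<^sup>2 * E u v z = t\<^sup>2 * E v u y"
      using z(2) y(2) by (simp only: add.assoc add.commute[of "t *\<^sub>R u"])
    then have "E u v z = E v u y" using t by simp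
    moreover have "\<bar>E u v z - E u v x\<bar> < e" "\<bar>E v u y - E v u x\<bar> < e"
      using d1(2) d2(2) z(1) y(1) tK by auto
    ultimately show ?thesis by linarith
  qed
  \<comment> \<open>A nonzero difference \<open>d\<close> would satisfy
    \<open>\<bar>d\<bar> \<le> \<bar>d\<bar> / 2\<close>.\<close>
  from this[of "\<bar>E u v x - E v u x\<bar> / 4"] have "\<bar>E u v x - E v u x\<bar> = 0"
    by force
  then show ?thesis by (simp add: E_def)
qed

section \<open>Smooth functions, tangent vectors and vector fields on a manifold\<close>

section \<open>Charts and smooth functions\<close>

lemma is_chartD:
  assumes "is_chart c"
  shows "open (fst c)" "open (snd c ` fst c)" "continuous_on (fst c) (snd c)"
    "continuous_on (snd c ` fst c) (chart_inv c)"
    "p \<in> fst c \<Longrightarrow> chart_inv c (snd c p) = p"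
    "y \<in> snd c ` fst c \<Longrightarrow> chart_inv c y \<in> fst c"
    "y \<in> snd c ` fst c \<Longrightarrow> snd c (chart_inv c y) = y"
  using assms by (auto simp: is_chart_def homeomorphism_def)

lemma is_chart_open_image:
  assumes "is_chart c" "open N"
  shows "open (snd c ` (fst c \<inter> N))"
proof -
  have "homeomorphism (fst c) (snd c ` fst c) (snd c) (chart_inv c)"
    using assms(1) by (simp add: is_chart_def)
  then have "openin (top_of_set (snd c ` fst c)) (snd c ` (fst c \<inter> N))"
    using assms(2) by (metis homeomorphism_imp_open_map openin_open_Int)
  then show ?thesis using is_chartD(2)[OF assms(1)] openin_open_trans by blast
qed

lemma is_chart_open_preimage:
  assumes "is_chart c" "open S"
  shows "open (fst c \<inter> snd c -` S)"
  by (rule continuous_open_preimage[OF is_chartD(3,1)[OF assms(1)] assms(2)])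

lemma is_chart_image_inv:
  assumes "is_chart c" "y \<in> snd c ` (fst c \<inter> N)"
  shows "chart_inv c y \<in> fst c" "chart_inv c y \<in> N" "snd c (chart_inv c y) = y"
  using assms is_chartD(5,6,7)[OF assms(1)] by auto

lemma sum_fun_apply: "(\<Sum>i\<in>I. f i) x = (\<Sum>i\<in>I. f i x)"
  by (induction I rule: infinite_finite_induct) auto

locale manifold =
  fixes A :: "('m::{t2_space,second_countable_topology}, 'e::euclidean_space) chart set"
  assumes atlas: "smooth_atlas A"
begin

lemma atlas_chart: "c \<in> A \<Longrightarrow> is_chart c"
  using atlas by (auto simp: smooth_atlas_def)

lemma atlas_admissible: "c \<in> A \<Longrightarrow> admissible_chart A c"
  using atlas by (auto simp: smooth_atlas_def admissible_chart_def)

lemma atlas_cover: obtains c where "c \<in> A" "p \<in> fst c"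
proof -
  have "p \<in> (\<Union>c\<in>A. fst c)" using atlas by (simp add: smooth_atlas_def)
  then show ?thesis using that by blast
qed

lemma admissible_is_chart: "admissible_chart A c \<Longrightarrow> is_chart c"
  by (simp add: admissible_chart_def)

lemma transition_smooth:
  assumes "admissible_chart A c" "d \<in> A"
  shows "smooth_on (snd c ` (fst c \<inter> fst d)) (snd d \<circ> chart_inv c)"
    "smooth_on (snd d ` (fst c \<inter> fst d)) (snd c \<circ> chart_inv d)"
  using assms by (auto simp: admissible_chart_def compatible_def)

lemma smooth_change_chart:
  assumes c: "is_chart c" and d: "is_chart d" and N: "open N"
    and s: "smooth_on (snd c ` (fst c \<inter> fst d)) (snd d \<circ> chart_inv c)"
    and f: "smooth_on (snd d ` (fst d \<inter> N)) (f \<circ> chart_inv d)"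
  shows "smooth_on (snd c ` (fst c \<inter> (fst d \<inter> N))) (f \<circ> chart_inv c)"
proof (rule smooth_on_cong)
  show o: "open (snd c ` (fst c \<inter> (fst d \<inter> N)))"
    by (intro is_chart_open_image[OF c] open_Int is_chartD(1)[OF d] N)
  show "smooth_on (snd c ` (fst c \<inter> (fst d \<inter> N))) (\<lambda>y. (f \<circ> chart_inv d) ((snd d \<circ> chart_inv c) y))"
  proof (rule smooth_on_compose[OF o is_chart_open_image[OF d N] _ _ f])
    show "smooth_on (snd c ` (fst c \<inter> (fst d \<inter> N))) (snd d \<circ> chart_inv c)"
      by (rule smooth_on_subset[OF s]) auto
  qed (use is_chartD(5)[OF c] in auto)
  show "(f \<circ> chart_inv d) ((snd d \<circ> chart_inv c) y) = (f \<circ> chart_inv c) y"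
    if "y \<in> snd c ` (fst c \<inter> (fst d \<inter> N))" for y
    using that is_chartD(5)[OF c] is_chartD(5)[OF d] by auto
qed

lemma smooth_fun_onI:
  assumes "open U"
    and "\<And>p. p \<in> U \<Longrightarrow> \<exists>c N. admissible_chart A c \<and> p \<in> fst c \<and> open N \<and> p \<in> N \<and>
           smooth_on (snd c ` (fst c \<inter> N)) (f \<circ> chart_inv c)"
  shows "smooth_fun_on A U f"
  unfolding smooth_fun_on_def
proof (intro conjI ballI \<open>open U\<close> smooth_on_local)
  fix d y assume d: "d \<in> A" and y: "y \<in> snd d ` (fst d \<inter> U)"
  then obtain p where p: "p \<in> fst d" "p \<in> U" "y = snd d p" by auto
  obtain c N where c: "admissible_chart A c" "p \<in> fst c" "open N" "p \<in> N"
    "smooth_on (snd c ` (fst c \<inter> N)) (f \<circ> chart_inv c)" using assms(2)[OF p(2)] by blast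
  have "smooth_on (snd d ` (fst d \<inter> (fst c \<inter> N))) (f \<circ> chart_inv d)"
    by (rule smooth_change_chart[OF atlas_chart[OF d] admissible_is_chart[OF c(1)] c(3) _ c(5)])
       (metis transition_smooth(2)[OF c(1) d] Int_commute)
  moreover have "open (snd d ` (fst d \<inter> (fst c \<inter> N)))"
    by (intro is_chart_open_image[OF atlas_chart[OF d]] open_Int is_chartD(1)[OF admissible_is_chart[OF c(1)]] c(3))
  ultimately show "\<exists>T. open T \<and> y \<in> T \<and> smooth_on T (f \<circ> chart_inv d)"
    using p c by blast
qed

lemma smooth_fun_on_chart:
  assumes "smooth_fun_on A U f" "admissible_chart A c"
  shows "smooth_on (snd c ` (fst c \<inter> U)) (f \<circ> chart_inv c)"
proof (rule smooth_on_local)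
  fix y assume "y \<in> snd c ` (fst c \<inter> U)"
  then obtain p where p: "p \<in> fst c" "p \<in> U" "y = snd c p" by auto
  obtain d where d: "d \<in> A" "p \<in> fst d" by (rule atlas_cover)
  have U: "open U" using assms by (simp add: smooth_fun_on_def)
  have "smooth_on (snd c ` (fst c \<inter> (fst d \<inter> U))) (f \<circ> chart_inv c)"
    by (rule smooth_change_chart[OF admissible_is_chart[OF assms(2)] atlas_chart[OF d(1)] U
          transition_smooth(1)[OF assms(2) d(1)]])
       (use assms(1) d(1) in \<open>simp add: smooth_fun_on_def\<close>)
  moreover have "open (snd c ` (fst c \<inter> (fst d \<inter> U)))"
    by (intro is_chart_open_image[OF admissible_is_chart[OF assms(2)]] open_Int is_chartD(1)[OF atlas_chart[OF d(1)]] U)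
  ultimately show "\<exists>T. open T \<and> y \<in> T \<and> smooth_on T (f \<circ> chart_inv c)"
    using p d by blast
qed

lemma smooth_fun_on_open: "smooth_fun_on A U f \<Longrightarrow> open U"
  by (simp add: smooth_fun_on_def)

lemma smooth_fun_on_subset:
  "smooth_fun_on A U f \<Longrightarrow> open W \<Longrightarrow> W \<subseteq> U \<Longrightarrow> smooth_fun_on A W f"
  unfolding smooth_fun_on_def by (meson Int_mono image_mono order_refl smooth_on_subset)

lemma smooth_fun_on_local:
  assumes "open U" "\<And>p. p \<in> U \<Longrightarrow> \<exists>N. p \<in> N \<and> smooth_fun_on A N f"
  shows "smooth_fun_on A U f"
proof (rule smooth_fun_onI[OF assms(1)])
  fix p assume "p \<in> U"
  then obtain N where N: "p \<in> N" "smooth_fun_on A N f" using assms(2) by blast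
  obtain c where c: "c \<in> A" "p \<in> fst c" by (rule atlas_cover)
  then show "\<exists>c N. admissible_chart A c \<and> p \<in> fst c \<and> open N \<and> p \<in> N \<and>
           smooth_on (snd c ` (fst c \<inter> N)) (f \<circ> chart_inv c)"
    using N atlas_admissible[OF c(1)] smooth_fun_on_chart[OF N(2) atlas_admissible[OF c(1)]] smooth_fun_on_open[OF N(2)]
    by (intro exI[of _ c] exI[of _ N]) simp
qed

lemma smooth_fun_on_cong:
  assumes "smooth_fun_on A U f" "\<And>p. p \<in> U \<Longrightarrow> f p = g p"
  shows "smooth_fun_on A U g"
  unfolding smooth_fun_on_def
proof (intro conjI ballI)
  show U: "open U" using assms(1) by (rule smooth_fun_on_open)
  fix c assume c: "c \<in> A"
  show "smooth_on (snd c ` (fst c \<inter> U)) (g \<circ> chart_inv c)"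
    by (rule smooth_on_cong[OF is_chart_open_image[OF atlas_chart[OF c] U] _ smooth_fun_on_chart[OF assms(1) atlas_admissible[OF c]]])
       (use assms(2) is_chart_image_inv[OF atlas_chart[OF c]] in auto)
qed

lemma smooth_fun_on_combine:
  assumes "open U" "\<And>c. c \<in> A \<Longrightarrow> open (snd c ` (fst c \<inter> U)) \<Longrightarrow> smooth_on (snd c ` (fst c \<inter> U)) (\<lambda>y. f (chart_inv c y))"
  shows "smooth_fun_on A U f"
  unfolding smooth_fun_on_def comp_def by (auto intro!: assms is_chart_open_image[OF atlas_chart])

lemma smooth_fun_onD:
  "smooth_fun_on A U f \<Longrightarrow> c \<in> A \<Longrightarrow> smooth_on (snd c ` (fst c \<inter> U)) (\<lambda>y. f (chart_inv c y))"
  by (simp add: smooth_fun_on_def comp_def)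

lemma smooth_fun_on_const: "open U \<Longrightarrow> smooth_fun_on A U (\<lambda>q. r)"
  by (rule smooth_fun_on_combine) (auto intro: smooth_on_const)

lemma smooth_fun_on_add:
  "smooth_fun_on A U f \<Longrightarrow> smooth_fun_on A U g \<Longrightarrow> smooth_fun_on A U (\<lambda>q. f q + g q)"
  by (rule smooth_fun_on_combine, erule smooth_fun_on_open)
     (rule smooth_on_add[OF _ smooth_fun_onD smooth_fun_onD])

lemma smooth_fun_on_diff:
  "smooth_fun_on A U f \<Longrightarrow> smooth_fun_on A U g \<Longrightarrow> smooth_fun_on A U (\<lambda>q. f q - g q)"
  by (rule smooth_fun_on_combine, erule smooth_fun_on_open)
     (rule smooth_on_diff[OF _ smooth_fun_onD smooth_fun_onD])

lemma smooth_fun_on_mult: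
  "smooth_fun_on A U f \<Longrightarrow> smooth_fun_on A U g \<Longrightarrow> smooth_fun_on A U (\<lambda>q. f q * g q)"
  by (rule smooth_fun_on_combine, erule smooth_fun_on_open)
     (rule smooth_on_mult[OF _ smooth_fun_onD smooth_fun_onD])

lemma smooth_fun_on_divide:
  assumes "smooth_fun_on A U f" "smooth_fun_on A U g" "\<And>q. q \<in> U \<Longrightarrow> g q \<noteq> 0"
  shows "smooth_fun_on A U (\<lambda>q. f q / g q)"
  by (rule smooth_fun_on_combine[OF smooth_fun_on_open[OF assms(1)]])
     (intro smooth_on_divide smooth_fun_onD[OF assms(1)] smooth_fun_onD[OF assms(2)],
      use assms(3) is_chart_image_inv[OF atlas_chart] in auto)

lemma smooth_fun_on_prod:
  assumes "open U" "\<And>i. i \<in> I \<Longrightarrow> smooth_fun_on A U (f i)"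
  shows "smooth_fun_on A U (\<lambda>q. \<Prod>i\<in>I. f i q)"
  using assms(2)
  by (induction I rule: infinite_finite_induct) (auto intro: smooth_fun_on_const smooth_fun_on_mult assms(1))

lemma smooth_fun_on_lift:
  assumes "admissible_chart A c" "open N" "N \<subseteq> fst c" "smooth_on (snd c ` N) g"
    and "\<And>q. q \<in> N \<Longrightarrow> f q = g (snd c q)"
  shows "smooth_fun_on A N f"
proof (rule smooth_fun_onI[OF assms(2)])
  fix p assume p: "p \<in> N"
  have NI: "fst c \<inter> N = N" using assms(3) by blast
  have "smooth_on (snd c ` (fst c \<inter> N)) (f \<circ> chart_inv c)"
    by (rule smooth_on_cong[OF is_chart_open_image[OF admissible_is_chart[OF assms(1)] assms(2)], of g])
       (use assms is_chartD(5)[OF admissible_is_chart[OF assms(1)]] NI in auto)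
  then show "\<exists>c N. admissible_chart A c \<and> p \<in> fst c \<and> open N \<and> p \<in> N \<and>
           smooth_on (snd c ` (fst c \<inter> N)) (f \<circ> chart_inv c)"
    using assms(1-3) p by (intro exI[of _ c] exI[of _ N]) auto
qed

lemma smooth_fun_on_coordinate:
  assumes "admissible_chart A c"
  shows "smooth_fun_on A (fst c) (\<lambda>q. snd c q \<bullet> b)"
  using is_chartD(1,2)[OF admissible_is_chart[OF assms]]
  by (intro smooth_fun_on_lift[OF assms, where g = "\<lambda>y. y \<bullet> b"] smooth_on_inner_right smooth_on_ident) auto

lemma smooth_nearI: "smooth_fun_on A U f \<Longrightarrow> p \<in> U \<Longrightarrow> smooth_near A p f"
  by (auto simp: smooth_near_def)

lemma smooth_near_cong:
  assumes "open N" "p \<in> N" "\<And>q. q \<in> N \<Longrightarrow> f q = g q"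
  shows "smooth_near A p f \<longleftrightarrow> smooth_near A p g"
proof -
  have "smooth_near A p g" if "smooth_near A p f" and eq: "\<And>q. q \<in> N \<Longrightarrow> f q = g q" for f g
  proof -
    obtain U where U: "p \<in> U" "smooth_fun_on A U f"
      using \<open>smooth_near A p f\<close> unfolding smooth_near_def by blast
    have "smooth_fun_on A (U \<inter> N) f"
      by (intro smooth_fun_on_subset[OF U(2)] open_Int smooth_fun_on_open[OF U(2)] assms(1)) auto
    then have "smooth_fun_on A (U \<inter> N) g" by (rule smooth_fun_on_cong) (auto simp: eq)
    then show ?thesis using U assms(2) by (auto intro: smooth_nearI)
  qed
  with assms(3) show ?thesis by metis
qed

lemma smooth_near_common:
  assumes "smooth_near A p f" "smooth_near A p g"
  obtains U where "p \<in> U" "open U" "smooth_fun_on A U f" "smooth_fun_on A U g"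
proof -
  obtain U V where "p \<in> U" "smooth_fun_on A U f" "p \<in> V" "smooth_fun_on A V g"
    using assms by (auto simp: smooth_near_def)
  then show ?thesis
    using that[of "U \<inter> V"] by (metis IntI inf_le1 inf_le2 open_Int smooth_fun_on_open smooth_fun_on_subset)
qed

lemma smooth_near_mult: "smooth_near A p f \<Longrightarrow> smooth_near A p g \<Longrightarrow> smooth_near A p (\<lambda>q. f q * g q)"
  by (metis smooth_near_common smooth_fun_on_mult smooth_nearI)

section \<open>Tangent vectors\<close>

abbreviation T :: "'m \<Rightarrow> 'm tvec set" where "T \<equiv> tangent_space A"

lemma smooth_near_derivative:
  assumes "admissible_chart A c" "p \<in> fst c" "smooth_near A p f"
  shows "((f \<circ> chart_inv c) has_derivative frechet_derivative (f \<circ> chart_inv c) (at (snd c p))) (at (snd c p))"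
proof -
  obtain U where U: "p \<in> U" "smooth_fun_on A U f" using assms by (auto simp: smooth_near_def)
  show ?thesis
    by (rule smooth_on_has_derivative[OF is_chart_open_image[OF admissible_is_chart[OF assms(1)] smooth_fun_on_open[OF U(2)]]
          smooth_fun_on_chart[OF U(2) assms(1)]]) (use U assms in auto)
qed

lemma coord_vec_smooth:
  "smooth_near A p f \<Longrightarrow> coord_vec A c p v f = frechet_derivative (f \<circ> chart_inv c) (at (snd c p)) v"
  by (simp add: coord_vec_def)

lemma coord_vec_linear:
  assumes "admissible_chart A c" "p \<in> fst c"
  shows "linear (coord_vec A c p)"
proof (rule linearI)
  fix u v :: 'e and r :: real
  have lin: "linear (frechet_derivative (f \<circ> chart_inv c) (at (snd c p)))" if "smooth_near A p f" for f
    using smooth_near_derivative[OF assms that] has_derivative_linear by blast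
  show "coord_vec A c p (u + v) = coord_vec A c p u + coord_vec A c p v"
    by (rule ext) (auto simp: coord_vec_def linear_add[OF lin])
  show "coord_vec A c p (r *\<^sub>R u) = r *\<^sub>R coord_vec A c p u"
    by (rule ext) (auto simp: coord_vec_def linear_scale[OF lin] scaleR_fun_def)
qed

text \<open>The chain rule for the transition map. One of the charts is taken from the atlas because
  admissibility only promises compatibility with atlas charts.\<close>

lemma coord_vec_change:
  assumes "admissible_chart A c" "admissible_chart A d" "c \<in> A \<or> d \<in> A" "p \<in> fst c" "p \<in> fst d"
  shows "coord_vec A c p v = coord_vec A d p (frechet_derivative (snd d \<circ> chart_inv c) (at (snd c p)) v)"
proof (rule ext)
  fix f
  note c = admissible_is_chart[OF assms(1)] and d = admissible_is_chart[OF assms(2)]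
  show "coord_vec A c p v f = coord_vec A d p (frechet_derivative (snd d \<circ> chart_inv c) (at (snd c p)) v) f"
  proof (cases "smooth_near A p f")
    case True
    let ?S = "snd c ` (fst c \<inter> fst d)"
    have S: "open ?S" using is_chart_open_image[OF c is_chartD(1)[OF d]] .
    have "smooth_on ?S (snd d \<circ> chart_inv c)"
      using assms(3) transition_smooth(1)[OF assms(1)] transition_smooth(2)[OF assms(2)] by (metis Int_commute)
    from smooth_on_has_derivative[OF S this, of "snd c p"]
    have 1: "((snd d \<circ> chart_inv c) has_derivative frechet_derivative (snd d \<circ> chart_inv c) (at (snd c p))) (at (snd c p))"
      using assms by auto
    have "(snd d \<circ> chart_inv c) (snd c p) = snd d p" using is_chartD(5)[OF c] assms by simp
    with smooth_near_derivative[OF assms(2,5) True]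
    have "((f \<circ> chart_inv d) has_derivative frechet_derivative (f \<circ> chart_inv d) (at (snd d p))) (at ((snd d \<circ> chart_inv c) (snd c p)))"
      by simp
    from has_derivative_compose[OF 1 this]
    have "((f \<circ> chart_inv c) has_derivative (\<lambda>v. frechet_derivative (f \<circ> chart_inv d) (at (snd d p))
       (frechet_derivative (snd d \<circ> chart_inv c) (at (snd c p)) v))) (at (snd c p))"
      by (rule has_derivative_transform_within_open[OF _ S])
         (use assms is_chartD(5)[OF c] is_chartD(5)[OF d] in auto)
    then have "frechet_derivative (f \<circ> chart_inv c) (at (snd c p)) = (\<lambda>v. frechet_derivative (f \<circ> chart_inv d) (at (snd d p))
       (frechet_derivative (snd d \<circ> chart_inv c) (at (snd c p)) v))"
      using frechet_derivative_at by metis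
    with True show ?thesis by (simp add: coord_vec_smooth)
  qed (simp add: coord_vec_def)
qed

lemma coord_vec_in_tangent:
  assumes "admissible_chart A c" "p \<in> fst c"
  shows "coord_vec A c p v \<in> T p"
proof -
  obtain d where d: "d \<in> A" "p \<in> fst d" by (rule atlas_cover)
  then show ?thesis
    unfolding tangent_space_def
    using coord_vec_change[OF assms(1) atlas_admissible[OF d(1)] _ assms(2) d(2)] by blast
qed

lemma tangent_space_chart:
  assumes "admissible_chart A c" "p \<in> fst c"
  shows "T p = range (coord_vec A c p)"
proof
  show "range (coord_vec A c p) \<subseteq> T p" using coord_vec_in_tangent[OF assms] by auto
  show "T p \<subseteq> range (coord_vec A c p)"
    using coord_vec_change[OF atlas_admissible assms(1) _ _ assms(2)] by (auto simp: tangent_space_def)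
qed

text \<open>A tangent vector sees only the germ of a function. This includes its default value 0,
  since \<open>smooth_near\<close> depends on the germ as well.\<close>

lemma tangent_cong:
  assumes "v \<in> T p" "open N" "p \<in> N" "\<And>q. q \<in> N \<Longrightarrow> f q = g q"
  shows "v f = v g"
proof -
  obtain c u where c: "c \<in> A" "p \<in> fst c" "v = coord_vec A c p u" using assms(1) by (auto simp: tangent_space_def)
  note ch = atlas_chart[OF c(1)]
  have "frechet_derivative (f \<circ> chart_inv c) (at (snd c p)) = frechet_derivative (g \<circ> chart_inv c) (at (snd c p))"
    by (rule frechet_derivative_cong_open[OF is_chart_open_image[OF ch assms(2)]])
       (use assms c is_chart_image_inv[OF ch] in auto)
  with smooth_near_cong[OF assms(2-4)] show ?thesis by (simp add: c(3) coord_vec_def)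
qed

lemma tangent_const: "v \<in> T p \<Longrightarrow> v (\<lambda>q. r) = 0"
  by (auto simp: tangent_space_def coord_vec_def comp_def)

lemma tangent_mult:
  assumes "v \<in> T p" "smooth_near A p f" "smooth_near A p g"
  shows "v (\<lambda>q. f q * g q) = f p * v g + v f * g p"
proof -
  obtain c u where c: "c \<in> A" "p \<in> fst c" "v = coord_vec A c p u" using assms(1) by (auto simp: tangent_space_def)
  note ad = atlas_admissible[OF c(1)]
  have "((\<lambda>q. f q * g q) \<circ> chart_inv c has_derivative (\<lambda>v. f p * frechet_derivative (g \<circ> chart_inv c) (at (snd c p)) v
     + frechet_derivative (f \<circ> chart_inv c) (at (snd c p)) v * g p)) (at (snd c p))"
    using has_derivative_mult[OF smooth_near_derivative[OF ad c(2) assms(2)] smooth_near_derivative[OF ad c(2) assms(3)]]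
      is_chartD(5)[OF atlas_chart[OF c(1)] c(2)]
    by (simp add: comp_def)
  from frechet_derivative_at[OF this, symmetric] show ?thesis
    by (simp add: assms(2,3) c(3) coord_vec_smooth smooth_near_mult)
qed

lemma tangent_subspace: "subspace (T p)"
proof -
  obtain c where c: "c \<in> A" "p \<in> fst c" by (rule atlas_cover)
  note ad = atlas_admissible[OF c(1)]
  show ?thesis
    unfolding tangent_space_chart[OF ad c(2)]
    using linear_subspace_image[OF coord_vec_linear[OF ad c(2)] subspace_UNIV] by simp
qed

lemma coord_vec_lift:
  assumes "admissible_chart A c" "p \<in> fst c" "open N" "p \<in> N" "N \<subseteq> fst c" "smooth_on (snd c ` N) g"
    and "\<And>q. q \<in> N \<Longrightarrow> f q = g (snd c q)"
  shows "coord_vec A c p v f = frechet_derivative g (at (snd c p)) v"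
proof -
  note ch = admissible_is_chart[OF assms(1)]
  have "fst c \<inter> N = N" using assms by blast
  then have "open (snd c ` N)" using is_chart_open_image[OF ch assms(3)] by simp
  then have "frechet_derivative (f \<circ> chart_inv c) (at (snd c p)) = frechet_derivative g (at (snd c p))"
    by (rule frechet_derivative_cong_open) (use assms is_chartD(5)[OF ch] in auto)
  moreover have "smooth_near A p f" using smooth_fun_on_lift[OF assms(1,3,5-7)] assms(4) by (rule smooth_nearI)
  ultimately show ?thesis by (simp add: coord_vec_smooth)
qed

lemma coord_vec_coordinate:
  assumes "admissible_chart A c" "p \<in> fst c"
  shows "coord_vec A c p v (\<lambda>q. snd c q \<bullet> b) = v \<bullet> b"
proof -
  have "coord_vec A c p v (\<lambda>q. snd c q \<bullet> b) = frechet_derivative (\<lambda>y. y \<bullet> b) (at (snd c p)) v"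
    using is_chartD(1,2)[OF admissible_is_chart[OF assms(1)]] assms
    by (intro coord_vec_lift[where N = "fst c"] smooth_on_inner_right smooth_on_ident) auto
  also have "frechet_derivative (\<lambda>y. y \<bullet> b) (at (snd c p)) = (\<lambda>v. v \<bullet> b)"
    by (rule sym, rule frechet_derivative_at) (auto intro!: derivative_eq_intros)
  finally show ?thesis .
qed

lemma coord_vec_inj:
  assumes "admissible_chart A c" "p \<in> fst c"
  shows "inj (coord_vec A c p)"
proof (rule injI, rule euclidean_eqI)
  fix u v b assume "coord_vec A c p u = coord_vec A c p v"
  then show "u \<bullet> b = v \<bullet> b" using coord_vec_coordinate[OF assms, of _ b] by metis
qed

lemma tangent_coordinates:
  assumes "admissible_chart A c" "p \<in> fst c" "v \<in> T p"
  shows "v = coord_vec A c p (\<Sum>b\<in>Basis. v (\<lambda>q. snd c q \<bullet> b) *\<^sub>R b)"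
proof -
  obtain u where u: "v = coord_vec A c p u" using assms tangent_space_chart by auto
  show ?thesis by (simp add: u coord_vec_coordinate[OF assms(1,2)] euclidean_representation)
qed

lemma dim_coord_vec_image:
  assumes "admissible_chart A c" "p \<in> fst c"
  shows "dim (coord_vec A c p ` S) = dim S"
  using coord_vec_linear[OF assms] coord_vec_inj[OF assms]
  by (metis dim_image_eq inj_on_subset subset_UNIV)

end

section \<open>Vector fields\<close>

text \<open>The product rule, after expanding the moving direction \<open>a y\<close> in the basis.
  It separates a term of first order in \<open>f\<close> from a Hessian term with \<open>a\<close>
  frozen at \<open>x\<close>; in a Lie bracket the Hessian terms cancel by symmetry.\<close>

lemma frechet_derivative_frechet_apply:
  fixes f :: "'a::euclidean_space \<Rightarrow> real" and a :: "'a \<Rightarrow> 'a"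
  assumes "open S" "smooth_on S f" "smooth_on S a" "x \<in> S"
  shows "frechet_derivative (\<lambda>y. frechet_derivative f (at y) (a y)) (at x) v =
    frechet_derivative f (at x) (frechet_derivative a (at x) v) +
    frechet_derivative (\<lambda>y. frechet_derivative f (at y) (a x)) (at x) v"
proof -
  let ?D = "\<lambda>y. frechet_derivative f (at y)"
  let ?E = "\<lambda>b. frechet_derivative (\<lambda>y. ?D y b) (at x)"
  note linD = smooth_on_frechet_linear[OF assms(1,2)]
  have E: "((\<lambda>y. ?D y b) has_derivative ?E b) (at x)" for b
    using smooth_on_has_derivative[OF assms(1) smooth_on_frechet_const[OF assms(2)] assms(4)] .
  have a: "(a has_derivative frechet_derivative a (at x)) (at x)"
    using smooth_on_has_derivative[OF assms(1,3,4)] .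
  have "((\<lambda>y. \<Sum>b\<in>Basis. (a y \<bullet> b) * ?D y b) has_derivative
     (\<lambda>v. \<Sum>b\<in>Basis. (a x \<bullet> b) * ?E b v + (frechet_derivative a (at x) v \<bullet> b) * ?D x b)) (at x)"
    by (intro has_derivative_sum has_derivative_mult has_derivative_inner_left a E)
  then have "((\<lambda>y. ?D y (a y)) has_derivative
     (\<lambda>v. \<Sum>b\<in>Basis. (a x \<bullet> b) * ?E b v + (frechet_derivative a (at x) v \<bullet> b) * ?D x b)) (at x)"
    by (rule has_derivative_transform_within_open[OF _ assms(1,4)])
       (use linear_Basis_expansion[OF linD] in auto)
  from frechet_derivative_at[OF this, symmetric]
  have 1: "frechet_derivative (\<lambda>y. ?D y (a y)) (at x) v =
      (\<Sum>b\<in>Basis. (a x \<bullet> b) * ?E b v) + ?D x (frechet_derivative a (at x) v)"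
    using linear_Basis_expansion[OF linD[OF assms(4)], of "frechet_derivative a (at x) v"]
    by (simp add: sum.distrib)
  have "((\<lambda>y. \<Sum>b\<in>Basis. (a x \<bullet> b) * ?D y b) has_derivative (\<lambda>v. \<Sum>b\<in>Basis. (a x \<bullet> b) * ?E b v)) (at x)"
    by (intro has_derivative_sum has_derivative_mult_right E)
  then have "((\<lambda>y. ?D y (a x)) has_derivative (\<lambda>v. \<Sum>b\<in>Basis. (a x \<bullet> b) * ?E b v)) (at x)"
    by (rule has_derivative_transform_within_open[OF _ assms(1,4)])
       (use linear_Basis_expansion[OF linD] in auto)
  from frechet_derivative_at[OF this, symmetric] 1 show ?thesis by simp
qed

context manifold
begin

definition components :: "('m, 'e) chart \<Rightarrow> 'm vfield \<Rightarrow> 'e \<Rightarrow> 'e" where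
  "components c X y = (\<Sum>b\<in>Basis. X (chart_inv c y) (\<lambda>q. snd c q \<bullet> b) *\<^sub>R b)"

lemma vector_field_tangent: "vector_field_on A U X \<Longrightarrow> p \<in> U \<Longrightarrow> X p \<in> T p"
  by (simp add: vector_field_on_def)

lemma vector_field_smooth:
  "vector_field_on A U X \<Longrightarrow> smooth_fun_on A W f \<Longrightarrow> W \<subseteq> U \<Longrightarrow> smooth_fun_on A W (\<lambda>p. X p f)"
  by (simp add: vector_field_on_def)

lemma vector_field_subset: "vector_field_on A U X \<Longrightarrow> W \<subseteq> U \<Longrightarrow> vector_field_on A W X"
  unfolding vector_field_on_def by blast

lemma vector_field_components:
  assumes "vector_field_on A U X" "admissible_chart A c" "q \<in> fst c" "q \<in> U"
  shows "X q = coord_vec A c q (components c X (snd c q))"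
  using tangent_coordinates[OF assms(2,3) vector_field_tangent[OF assms(1,4)]]
    is_chartD(5)[OF admissible_is_chart[OF assms(2)] assms(3)]
  by (simp add: components_def)

lemma components_smooth:
  assumes "vector_field_on A U X" "open U" "admissible_chart A c"
  shows "smooth_on (snd c ` (fst c \<inter> U)) (components c X)"
proof -
  note ch = admissible_is_chart[OF assms(3)]
  have o: "open (fst c \<inter> U)" using is_chartD(1)[OF ch] assms(2) by blast
  have "smooth_on (snd c ` (fst c \<inter> U)) (\<lambda>y. X (chart_inv c y) (\<lambda>q. snd c q \<bullet> b))" for b
  proof -
    have "smooth_fun_on A (fst c \<inter> U) (\<lambda>p. X p (\<lambda>q. snd c q \<bullet> b))"
      by (intro vector_field_smooth[OF assms(1)] smooth_fun_on_subset[OF smooth_fun_on_coordinate[OF assms(3)]] o) auto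
    from smooth_fun_on_chart[OF this assms(3)] show ?thesis by (simp add: comp_def Int_assoc[symmetric])
  qed
  then show ?thesis
    unfolding components_def
    by (intro smooth_on_sum smooth_on_scaleR smooth_on_const is_chart_open_image[OF ch assms(2)])
qed

lemma vector_field_lift:
  assumes "admissible_chart A c" "open N" "N \<subseteq> fst c" "smooth_on (snd c ` N) a"
    and "\<And>q. q \<in> N \<Longrightarrow> X q = coord_vec A c q (a (snd c q))"
  shows "vector_field_on A N X"
  unfolding vector_field_on_def
proof (intro conjI ballI allI impI)
  show "X q \<in> T q" if "q \<in> N" for q
    using assms that coord_vec_in_tangent[OF assms(1)] by auto
  fix W f assume W: "W \<subseteq> N \<and> smooth_fun_on A W f"
  then have Wo: "open W" and Wc: "W \<subseteq> fst c" "fst c \<inter> W = W" using smooth_fun_on_open assms(3) by auto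
  note ch = admissible_is_chart[OF assms(1)]
  have o: "open (snd c ` W)" using is_chart_open_image[OF ch Wo] Wc by simp
  show "smooth_fun_on A W (\<lambda>p. X p f)"
  proof (rule smooth_fun_on_lift[OF assms(1) Wo Wc(1)])
    show "smooth_on (snd c ` W) (\<lambda>y. frechet_derivative (f \<circ> chart_inv c) (at y) (a y))"
    proof (rule smooth_on_frechet[OF o])
      show "smooth_on (snd c ` W) (f \<circ> chart_inv c)"
        using smooth_fun_on_chart[OF conjunct2[OF W] assms(1)] Wc by simp
      show "smooth_on (snd c ` W) a" using W by (intro smooth_on_subset[OF assms(4)]) auto
    qed
    show "X q f = frechet_derivative (f \<circ> chart_inv c) (at (snd c q)) (a (snd c q))" if "q \<in> W" for q
      using W assms(5) that by (auto simp: coord_vec_smooth smooth_nearI)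
  qed
qed

lemma vector_field_local:
  assumes "\<And>p. p \<in> U \<Longrightarrow> \<exists>N Z. open N \<and> p \<in> N \<and> vector_field_on A N Z \<and> (\<forall>q\<in>N. X q = Z q)"
  shows "vector_field_on A U X"
  unfolding vector_field_on_def
proof (intro conjI ballI allI impI)
  show "X p \<in> T p" if "p \<in> U" for p
    using assms[OF that] vector_field_tangent by metis
  fix W f assume W: "W \<subseteq> U \<and> smooth_fun_on A W f"
  then have f: "smooth_fun_on A W f" by blast
  show "smooth_fun_on A W (\<lambda>p. X p f)"
  proof (rule smooth_fun_on_local[OF smooth_fun_on_open[OF f]])
    fix p assume "p \<in> W"
    with W obtain N Z where N: "open N" "p \<in> N" "vector_field_on A N Z" "\<And>q. q \<in> N \<Longrightarrow> X q = Z q"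
      using assms[of p] by blast
    have "smooth_fun_on A (W \<inter> N) f"
      by (intro smooth_fun_on_subset[OF f] open_Int smooth_fun_on_open[OF f] N(1)) auto
    from vector_field_smooth[OF N(3) this] have "smooth_fun_on A (W \<inter> N) (\<lambda>p. Z p f)" by auto
    then have "smooth_fun_on A (W \<inter> N) (\<lambda>p. X p f)"
      by (rule smooth_fun_on_cong) (use N(4) in auto)
    with N(2) \<open>p \<in> W\<close> show "\<exists>N. p \<in> N \<and> smooth_fun_on A N (\<lambda>p. X p f)" by blast
  qed
qed

lemma vector_field_zero: "vector_field_on A U (\<lambda>p. 0)"
  unfolding vector_field_on_def
  using subspace_0[OF tangent_subspace] smooth_fun_on_const[OF smooth_fun_on_open] by auto

lemma vector_field_add:
  assumes "vector_field_on A U X" "vector_field_on A U Y"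
  shows "vector_field_on A U (\<lambda>p. X p + Y p)"
  unfolding vector_field_on_def
  using vector_field_tangent[OF assms(1)] vector_field_tangent[OF assms(2)]
    vector_field_smooth[OF assms(1)] vector_field_smooth[OF assms(2)]
  by (auto intro: subspace_add[OF tangent_subspace] smooth_fun_on_add)

lemma vector_field_scale:
  assumes "smooth_fun_on A U g" "vector_field_on A U X"
  shows "vector_field_on A U (\<lambda>p. g p *\<^sub>R X p)"
  unfolding vector_field_on_def
proof (intro conjI ballI allI impI)
  show "g p *\<^sub>R X p \<in> T p" if "p \<in> U" for p
    using vector_field_tangent[OF assms(2) that] by (rule subspace_scale[OF tangent_subspace])
  fix W f assume W: "W \<subseteq> U \<and> smooth_fun_on A W f"
  have "smooth_fun_on A W g"
    using W by (intro smooth_fun_on_subset[OF assms(1)]) (auto simp: smooth_fun_on_open)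
  moreover have "smooth_fun_on A W (\<lambda>p. X p f)" using W by (intro vector_field_smooth[OF assms(2)]) auto
  ultimately show "smooth_fun_on A W (\<lambda>p. (g p *\<^sub>R X p) f)"
    using smooth_fun_on_mult by (simp add: scaleR_fun_def)
qed

lemma vector_field_sum:
  "(\<And>i. i \<in> I \<Longrightarrow> vector_field_on A U (X i)) \<Longrightarrow> vector_field_on A U (\<lambda>p. \<Sum>i\<in>I. X i p)"
  by (induction I rule: infinite_finite_induct) (auto intro: vector_field_zero vector_field_add)

subsection \<open>Lie brackets\<close>

text \<open>In a chart the bracket is differentiation along \<open>w = Db(a) - Da(b)\<close>, where
  \<open>a\<close> and \<open>b\<close> are the components of the fields; the second derivatives of
  \<open>f\<close> cancel. This is what makes the commutator a tangent vector in the sense of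
  \<open>tangent_space\<close>.\<close>

lemma lie_bracket_tangent:
  assumes "vector_field_on A U X" "vector_field_on A U Y" "open U" "p \<in> U"
  shows "lie_bracket A X Y p \<in> T p"
proof -
  obtain c where c: "c \<in> A" "p \<in> fst c" by (rule atlas_cover)
  note ad = atlas_admissible[OF c(1)] and ch = atlas_chart[OF c(1)]
  define a where "a = components c X"
  define b where "b = components c Y"
  let ?y = "snd c p"
  define w where "w = frechet_derivative b (at ?y) (a ?y) - frechet_derivative a (at ?y) (b ?y)"
  have iter: "Z p (\<lambda>q. Z' q f) = frechet_derivative (f \<circ> chart_inv c) (at ?y)
      (frechet_derivative (components c Z') (at ?y) (components c Z ?y)) +
      frechet_derivative (\<lambda>y. frechet_derivative (f \<circ> chart_inv c) (at y) (components c Z' ?y)) (at ?y) (components c Z ?y)"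
    if Z: "vector_field_on A U Z" and Z': "vector_field_on A U Z'"
      and W: "smooth_fun_on A W f" "p \<in> W" "W \<subseteq> U" "W \<subseteq> fst c" for Z Z' f W
  proof -
    have Wo: "open W" using smooth_fun_on_open W by blast
    have cW: "fst c \<inter> W = W" using W by blast
    have o: "open (snd c ` W)" using is_chart_open_image[OF ch Wo] cW by simp
    have F: "smooth_on (snd c ` W) (f \<circ> chart_inv c)" using smooth_fun_on_chart[OF W(1) ad] cW by simp
    have cs: "smooth_on (snd c ` W) (components c Z')"
      using components_smooth[OF Z' assms(3) ad] by (rule smooth_on_subset) (use W in auto)
    have eq: "Z' q f = frechet_derivative (f \<circ> chart_inv c) (at (snd c q)) (components c Z' (snd c q))" if "q \<in> W" for q
    proof -
      have "q \<in> fst c" "q \<in> U" using that W by auto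
      from vector_field_components[OF Z' ad this]
      have "Z' q f = coord_vec A c q (components c Z' (snd c q)) f" by simp
      then show ?thesis using smooth_nearI[OF W(1) that] by (simp add: coord_vec_smooth)
    qed
    have "Z p = coord_vec A c p (components c Z ?y)"
      using vector_field_components[OF Z ad c(2)] assms(4) by simp
    then have "Z p (\<lambda>q. Z' q f) = coord_vec A c p (components c Z ?y) (\<lambda>q. Z' q f)" by simp
    also have "\<dots> = frechet_derivative (\<lambda>y. frechet_derivative (f \<circ> chart_inv c) (at y) (components c Z' y)) (at ?y) (components c Z ?y)"
    proof (rule coord_vec_lift[OF ad c(2) Wo W(2,4)])
      show "smooth_on (snd c ` W) (\<lambda>y. frechet_derivative (f \<circ> chart_inv c) (at y) (components c Z' y))"
        by (intro smooth_on_frechet o F cs)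
    qed (rule eq)
    also have "\<dots> = frechet_derivative (f \<circ> chart_inv c) (at ?y)
      (frechet_derivative (components c Z') (at ?y) (components c Z ?y)) +
      frechet_derivative (\<lambda>y. frechet_derivative (f \<circ> chart_inv c) (at y) (components c Z' ?y)) (at ?y) (components c Z ?y)"
      by (rule frechet_derivative_frechet_apply[OF o F cs]) (use W in auto)
    finally show ?thesis .
  qed
  have "lie_bracket A X Y p f = coord_vec A c p w f" for f
  proof (cases "smooth_near A p f")
    case True
    then obtain W0 where W0: "p \<in> W0" "smooth_fun_on A W0 f" by (auto simp: smooth_near_def)
    define W where "W = W0 \<inter> (U \<inter> fst c)"
    have W: "smooth_fun_on A W f" "p \<in> W" "W \<subseteq> U" "W \<subseteq> fst c"
      unfolding W_def using W0 assms(3,4) c is_chartD(1)[OF ch]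
      by (auto intro!: smooth_fun_on_subset[OF W0(2)] smooth_fun_on_open[OF W0(2)])
    let ?F = "f \<circ> chart_inv c"
    have cW: "fst c \<inter> W = W" using W by blast
    have o: "open (snd c ` W)" using is_chart_open_image[OF ch smooth_fun_on_open[OF W(1)]] cW by simp
    have F: "smooth_on (snd c ` W) ?F" using smooth_fun_on_chart[OF W(1) ad] cW by simp
    have y: "?y \<in> snd c ` W" using W by auto
    have "lie_bracket A X Y p f = X p (\<lambda>q. Y q f) - Y p (\<lambda>q. X q f)" using True by (simp add: lie_bracket_def)
    also have "\<dots> = frechet_derivative ?F (at ?y) w"
      unfolding iter[OF assms(1,2) W] iter[OF assms(2,1) W] w_def a_def b_def
      using second_derivative_symmetric[OF o F y, of "components c Y ?y" "components c X ?y"]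
        linear_diff[OF smooth_on_frechet_linear[OF o F y]]
      by simp
    finally show ?thesis using True by (simp add: coord_vec_smooth)
  qed (simp add: lie_bracket_def coord_vec_def)
  then have "lie_bracket A X Y p = coord_vec A c p w" by (rule ext)
  then show ?thesis using coord_vec_in_tangent[OF ad c(2)] by simp
qed

lemma lie_bracket_apply:
  "smooth_near A p f \<Longrightarrow> lie_bracket A X Y p f = X p (\<lambda>q. Y q f) - Y p (\<lambda>q. X q f)"
  by (simp add: lie_bracket_def)

lemma lie_bracket_vector_field:
  assumes "vector_field_on A U X" "vector_field_on A U Y" "open U"
  shows "vector_field_on A U (lie_bracket A X Y)"
  unfolding vector_field_on_def
proof (intro conjI ballI allI impI)
  show "lie_bracket A X Y p \<in> T p" if "p \<in> U" for p
    using lie_bracket_tangent[OF assms that] .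
  fix W f assume W: "W \<subseteq> U \<and> smooth_fun_on A W f"
  have "smooth_fun_on A W (\<lambda>p. X p (\<lambda>q. Y q f) - Y p (\<lambda>q. X q f))"
    using W by (intro smooth_fun_on_diff vector_field_smooth[OF assms(1)] vector_field_smooth[OF assms(2)]) auto
  then show "smooth_fun_on A W (\<lambda>p. lie_bracket A X Y p f)"
    by (rule smooth_fun_on_cong) (use W in \<open>auto simp: lie_bracket_apply smooth_nearI\<close>)
qed

lemma lie_bracket_zero_left:
  assumes "vector_field_on A UNIV Y" "open N" "p \<in> N" "\<And>q. q \<in> N \<Longrightarrow> X q = 0"
  shows "lie_bracket A X Y p = 0"
proof (rule ext)
  fix f
  have Yp: "Y p \<in> T p" using vector_field_tangent[OF assms(1)] by simp
  have "Y p (\<lambda>q. X q f) = Y p (\<lambda>q. 0)"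
    by (rule tangent_cong[OF Yp assms(2,3)]) (simp add: assms(4))
  then show "lie_bracket A X Y p f = 0 f"
    using tangent_const[OF Yp, of 0] assms(3,4) by (simp add: lie_bracket_def)
qed

subsection \<open>Extension of vector fields\<close>

text \<open>The closed set \<open>K\<close> outside which \<open>g\<close> vanishes is part of the
  result because extension by zero needs the open sets \<open>N\<close> and \<open>- K\<close> to
  cover the manifold.\<close>

lemma manifold_bump:
  assumes "open N" "p \<in> N"
  shows "\<exists>g N' K. smooth_fun_on A UNIV g \<and> open N' \<and> p \<in> N' \<and> N' \<subseteq> N \<and> (\<forall>q\<in>N'. g q = 1) \<and>
    closed K \<and> K \<subseteq> N \<and> (\<forall>q. q \<notin> K \<longrightarrow> g q = 0)"
proof -
  obtain c where c: "c \<in> A" "p \<in> fst c" by (rule atlas_cover)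
  note ad = atlas_admissible[OF c(1)] and ch = atlas_chart[OF c(1)]
  define M where "M = fst c \<inter> N"
  have Mo: "open M" using is_chartD(1)[OF ch] assms(1) by (simp add: M_def open_Int)
  have "open (snd c ` M)" "snd c p \<in> snd c ` M"
    using is_chart_open_image[OF ch assms(1)] assms c by (auto simp: M_def)
  then obtain r where r: "r > 0" "cball (snd c p) r \<subseteq> snd c ` M"
    using open_contains_cball by blast
  obtain h :: "'e \<Rightarrow> real" where h: "smooth_on UNIV h" "\<And>z. z \<in> ball (snd c p) (r / 2) \<Longrightarrow> h z = 1"
    "\<And>z. z \<notin> ball (snd c p) r \<Longrightarrow> h z = 0"
    using smooth_bump[OF r(1)] by blast
  define g where "g q = (if q \<in> M then h (snd c q) else 0)" for q
  define K where "K = chart_inv c ` cball (snd c p) r"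
  define N' where "N' = M \<inter> (fst c \<inter> snd c -` ball (snd c p) (r / 2))"
  have KM: "K \<subseteq> M"
    using r(2) is_chartD(5)[OF ch] by (auto simp: K_def M_def)
  have "compact K"
    unfolding K_def using r(2)
    by (intro compact_continuous_image continuous_on_subset[OF is_chartD(4)[OF ch]] compact_cball) (auto simp: M_def)
  \<comment> \<open>The Hausdorff property makes this compact set closed in the whole manifold, not
    merely in the chart domain.\<close>
  then have Kc: "closed K" by (rule compact_imp_closed)
  have g0: "g q = 0" if "q \<notin> K" for q
  proof (cases "q \<in> M")
    case True
    then have "snd c q \<notin> cball (snd c p) r"
      using that is_chartD(5)[OF ch, of q] True unfolding K_def M_def by (metis IntD1 imageI)
    then have "h (snd c q) = 0" by (intro h(3)) auto
    then show ?thesis by (simp add: g_def)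
  qed (simp add: g_def)
  have "smooth_fun_on A UNIV g"
  proof (rule smooth_fun_on_local[OF open_UNIV])
    fix q
    show "\<exists>N. q \<in> N \<and> smooth_fun_on A N g"
    proof (cases "q \<in> K")
      case True
      have "smooth_fun_on A M g"
        by (rule smooth_fun_on_lift[OF ad Mo _ smooth_on_subset[OF h(1)]]) (auto simp: g_def M_def)
      then show ?thesis using True KM by blast
    next
      case False
      have "smooth_fun_on A (- K) g"
        by (rule smooth_fun_on_cong[OF smooth_fun_on_const[of _ 0]]) (use Kc g0 in auto)
      then show ?thesis using False by blast
    qed
  qed
  moreover have "open N'" unfolding N'_def using Mo is_chart_open_preimage[OF ch] by blast
  moreover have "p \<in> N'" using assms c r by (simp add: N'_def M_def)
  moreover have "N' \<subseteq> N" by (auto simp: N'_def M_def)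
  moreover have "g q = 1" if "q \<in> N'" for q using that h(2) by (auto simp: N'_def g_def)
  moreover have "K \<subseteq> N" using KM by (auto simp: M_def)
  ultimately show ?thesis using Kc g0
    by (intro exI[of _ g] exI[of _ N'] exI[of _ K]) simp
qed

lemma vector_field_extend:
  assumes "vector_field_on A N X" "open N" "smooth_fun_on A UNIV g" "closed K" "K \<subseteq> N"
    "\<And>q. q \<notin> K \<Longrightarrow> g q = 0"
  shows "vector_field_on A UNIV (\<lambda>q. if q \<in> N then g q *\<^sub>R X q else 0)"
proof (rule vector_field_local)
  fix p
  have N: "vector_field_on A N (\<lambda>q. g q *\<^sub>R X q)"
    by (intro vector_field_scale smooth_fun_on_subset[OF assms(3)] assms(1,2)) auto
  show "\<exists>N' Z. open N' \<and> p \<in> N' \<and> vector_field_on A N' Z \<and>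
      (\<forall>q\<in>N'. (if q \<in> N then g q *\<^sub>R X q else 0) = Z q)"
  proof (cases "p \<in> N")
    case True
    then show ?thesis using N assms(2)
      by (intro exI[of _ N] exI[of _ "\<lambda>q. g q *\<^sub>R X q"]) auto
  next
    case False
    then show ?thesis using assms(4,5,6)
      by (intro exI[of _ "- K"] exI[of _ "\<lambda>q. 0"]) (auto intro: vector_field_zero)
  qed
qed

end

section \<open>Linear algebra of covectors, and the ranks of the derived flag\<close>

section \<open>Linear algebra of families\<close>

lemma span_image_obtain_coeffs:
  fixes f :: "'i \<Rightarrow> 'v::real_vector"
  assumes "finite I" "v \<in> span (f ` I)"
  shows "\<exists>a. v = (\<Sum>i\<in>I. a i *\<^sub>R f i)"
  using assms(2)
proof (induction rule: span_induct)
  case (step x)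
  then obtain i where i: "i \<in> I" "x = f i" by auto
  have "(\<Sum>j\<in>I. (if j = i then 1 else 0) *\<^sub>R f j) = (\<Sum>j\<in>I. if j = i then f i else 0)"
    by (rule sum.cong) auto
  then have "x = (\<Sum>j\<in>I. (if j = i then 1 else 0) *\<^sub>R f j)"
    using i assms(1) by simp
  then show ?case by (rule exI[of _ "\<lambda>j. if j = i then 1 else 0"])
next
  case base
  have "\<exists>c. (\<Sum>i\<in>I. a i *\<^sub>R f i) + (\<Sum>i\<in>I. b i *\<^sub>R f i) = (\<Sum>i\<in>I. c i *\<^sub>R f i)" for a b
    by (rule exI[of _ "\<lambda>i. a i + b i"]) (simp add: scaleR_add_left sum.distrib)
  moreover have "\<exists>c. r *\<^sub>R (\<Sum>i\<in>I. a i *\<^sub>R f i) = (\<Sum>i\<in>I. c i *\<^sub>R f i)" for a r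
    by (rule exI[of _ "\<lambda>i. r * a i"]) (simp add: scaleR_sum_right)
  moreover have "\<exists>c. 0 = (\<Sum>i\<in>I. c i *\<^sub>R f i)"
    by (rule exI[of _ "\<lambda>i. 0"]) simp
  ultimately show ?case unfolding subspace_def by (auto; metis)
qed

text \<open>Independence of a family rather than of its image: a repeated value counts as a
  dependence, as it must when members are counted by their indices.\<close>

definition indep_family :: "'i set \<Rightarrow> ('i \<Rightarrow> 'v::real_vector) \<Rightarrow> bool" where
  "indep_family I w \<longleftrightarrow> (\<forall>a. (\<Sum>i\<in>I. a i *\<^sub>R w i) = 0 \<longrightarrow> (\<forall>i\<in>I. a i = 0))"

lemma indep_family_iff:
  assumes "finite I"
  shows "indep_family I w \<longleftrightarrow> inj_on w I \<and> independent (w ` I)"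
proof
  assume w: "indep_family I w"
  have inj: "inj_on w I"
  proof (rule inj_onI, rule ccontr)
    fix i j assume ij: "i \<in> I" "j \<in> I" "w i = w j" "i \<noteq> j"
    have "(\<Sum>k\<in>I. ((if k = i then 1 else 0) - (if k = j then 1 else 0)) *\<^sub>R w k) =
        (\<Sum>k\<in>I. (if k = i then w i else 0)) - (\<Sum>k\<in>I. (if k = j then w j else 0))"
      unfolding sum_subtractf[symmetric] by (rule sum.cong) auto
    also have "\<dots> = 0" using ij assms by simp
    finally show False using w ij unfolding indep_family_def by fastforce
  qed
  have "independent (w ` I)"
  proof (rule independent_if_scalars_zero)
    show "finite (w ` I)" using assms by simp
    fix g v assume s: "(\<Sum>x\<in>w ` I. g x *\<^sub>R x) = 0" and v: "v \<in> w ` I"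
    have "(\<Sum>i\<in>I. g (w i) *\<^sub>R w i) = 0" using s by (simp add: sum.reindex[OF inj])
    with w v show "g v = 0" unfolding indep_family_def by fastforce
  qed
  with inj show "inj_on w I \<and> independent (w ` I)" ..
next
  assume w: "inj_on w I \<and> independent (w ` I)"
  show "indep_family I w"
    unfolding indep_family_def
  proof (intro allI impI ballI)
    fix a i assume s: "(\<Sum>i\<in>I. a i *\<^sub>R w i) = 0" and i: "i \<in> I"
    have "(\<Sum>v\<in>w ` I. a (inv_into I w v) *\<^sub>R v) = 0"
      using s w by (simp add: sum.reindex)
    then have "a (inv_into I w (w i)) = 0"
      using w i assms independentD[of "w ` I" "w ` I" "\<lambda>v. a (inv_into I w v)" "w i"] by blast
    then show "a i = 0" using w i by simp
  qed
qed

lemma dim_orthogonal_family: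
  fixes w :: "'i \<Rightarrow> 'a::euclidean_space"
  shows "dim {v. \<forall>i\<in>I. w i \<bullet> v = 0} + dim (w ` I) = DIM('a)"
proof -
  have "{v. \<forall>i\<in>I. w i \<bullet> v = 0} = {v \<in> UNIV. \<forall>u\<in>span (w ` I). orthogonal u v}"
  proof (intro equalityI subsetI CollectI conjI ballI UNIV_I)
    fix v u assume "v \<in> {v. \<forall>i\<in>I. w i \<bullet> v = 0}" "u \<in> span (w ` I)"
    then have "orthogonal v u"
      by (intro orthogonal_to_span[of u "w ` I"]) (auto simp: orthogonal_def inner_commute)
    then show "orthogonal u v" by (simp add: orthogonal_commute)
  next
    fix v i assume "v \<in> {v \<in> UNIV. \<forall>u\<in>span (w ` I). orthogonal u v}" "i \<in> I"
    then show "w i \<bullet> v = 0" by (auto simp: orthogonal_def span_base)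
  qed
  then show ?thesis
    using dim_subspace_orthogonal_to_vectors[of "span (w ` I)" UNIV] by simp
qed

lemma orthogonal_family_dual:
  fixes w :: "'i \<Rightarrow> 'a::euclidean_space"
  assumes "finite I" "\<And>v. (\<And>i. i \<in> I \<Longrightarrow> w i \<bullet> v = 0) \<Longrightarrow> h \<bullet> v = 0"
  shows "\<exists>a. h = (\<Sum>i\<in>I. a i *\<^sub>R w i)"
proof -
  have "h \<in> (span (w ` I))\<^sup>\<bottom>\<^sup>\<bottom>"
    unfolding orthogonal_comp_def
  proof (intro CollectI ballI)
    fix v assume "v \<in> {x. \<forall>y\<in>span (w ` I). orthogonal y x}"
    then have "h \<bullet> v = 0" by (intro assms(2)) (auto simp: orthogonal_def span_base)
    then show "orthogonal v h" by (simp add: orthogonal_def inner_commute)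
  qed
  then have "h \<in> span (w ` I)" by (simp add: orthogonal_comp_self)
  then show ?thesis using span_image_obtain_coeffs[OF assms(1)] by blast
qed

lemma indep_family_dim:
  fixes w :: "'i \<Rightarrow> 'a::euclidean_space"
  assumes "finite I"
  shows "indep_family I w \<longleftrightarrow> dim (w ` I) = card I"
proof -
  have fin: "finite (w ` I)" using assms by simp
  have 1: "dim (w ` I) \<le> card (w ` I)" using dim_le_card'[OF fin] .
  have 2: "card (w ` I) \<le> card I" using card_image_le[OF assms] .
  show ?thesis
    unfolding indep_family_iff[OF assms]
    using 1 2 assms fin card_image[of w I] dim_eq_card_independent[of "w ` I"] eq_card_imp_inj_on[OF assms, of w]
      card_eq_dim[of "w ` I" "w ` I"] span_superset[of "w ` I"]
    by (metis le_antisym order_refl)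
qed

context manifold
begin

section \<open>Linear algebra in the tangent spaces\<close>

text \<open>Linearity on \<open>T p\<close> alone. Members of \<open>cotangent_space\<close> must
  vanish off \<open>T p\<close>, whereas evaluation of functionals at a function \<open>f\<close>,
  the working form of \<open>df\<close>, does not.\<close>

definition tlin :: "'m \<Rightarrow> 'm covec \<Rightarrow> bool" where
  "tlin p \<alpha> \<longleftrightarrow> (\<forall>u\<in>T p. \<forall>v\<in>T p. \<alpha> (u + v) = \<alpha> u + \<alpha> v) \<and> (\<forall>r. \<forall>v\<in>T p. \<alpha> (r *\<^sub>R v) = r * \<alpha> v)"

definition tindep :: "'m \<Rightarrow> 'i set \<Rightarrow> ('i \<Rightarrow> 'm covec) \<Rightarrow> bool" where
  "tindep p I \<alpha> \<longleftrightarrow> (\<forall>a. (\<forall>v\<in>T p. (\<Sum>i\<in>I. a i * \<alpha> i v) = 0) \<longrightarrow> (\<forall>i\<in>I. a i = 0))"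

lemma tindepD: "tindep p I \<alpha> \<Longrightarrow> (\<And>v. v \<in> T p \<Longrightarrow> (\<Sum>i\<in>I. a i * \<alpha> i v) = 0) \<Longrightarrow> i \<in> I \<Longrightarrow> a i = 0"
  unfolding tindep_def by blast

lemma tlin_eval: "tlin p (\<lambda>v. v f)"
  by (simp add: tlin_def scaleR_fun_def)

lemma tlin_add: "tlin p \<alpha> \<Longrightarrow> tlin p \<beta> \<Longrightarrow> tlin p (\<lambda>v. \<alpha> v + \<beta> v)"
  by (simp add: tlin_def algebra_simps)

lemma tlin_diff: "tlin p \<alpha> \<Longrightarrow> tlin p \<beta> \<Longrightarrow> tlin p (\<lambda>v. \<alpha> v - \<beta> v)"
  by (simp add: tlin_def algebra_simps)

lemma tlin_scale: "tlin p \<alpha> \<Longrightarrow> tlin p (\<lambda>v. r * \<alpha> v)"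
  by (simp add: tlin_def algebra_simps)

lemma tlin_sum: "(\<And>i. i \<in> I \<Longrightarrow> tlin p (\<alpha> i)) \<Longrightarrow> tlin p (\<lambda>v. \<Sum>i\<in>I. \<alpha> i v)"
  by (induction I rule: infinite_finite_induct) (auto intro: tlin_add simp: tlin_def algebra_simps)

lemma tlin_cotangent: "\<alpha> \<in> cotangent_space A p \<Longrightarrow> tlin p \<alpha>"
  by (simp add: cotangent_space_def tlin_def)

text \<open>The Riesz representation in a chart. Kernels, dimensions and dependences on
  \<open>T p\<close> become statements about vectors of \<open>'e\<close>, where orthogonal
  complements are available.\<close>

lemma tlin_representation:
  assumes "admissible_chart A c" "p \<in> fst c" "tlin p \<alpha>"
  shows "\<exists>w. \<forall>u. \<alpha> (coord_vec A c p u) = w \<bullet> u"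
proof (intro exI allI)
  fix u
  let ?L = "coord_vec A c p"
  have lin: "linear (\<lambda>u. \<alpha> (?L u))"
    using assms(3) coord_vec_in_tangent[OF assms(1,2)]
    by (intro linearI)
       (simp_all add: tlin_def linear_add[OF coord_vec_linear[OF assms(1,2)]] linear_scale[OF coord_vec_linear[OF assms(1,2)]])
  show "\<alpha> (?L u) = (\<Sum>b\<in>Basis. \<alpha> (?L b) *\<^sub>R b) \<bullet> u"
    using linear_Basis_expansion[OF lin, of u]
    unfolding inner_sum_left inner_scaleR_left by (simp add: inner_commute mult.commute)
qed

lemma tindep_representation:
  assumes "admissible_chart A c" "p \<in> fst c" "\<And>i u. i \<in> I \<Longrightarrow> \<alpha> i (coord_vec A c p u) = w i \<bullet> u"
  shows "tindep p I \<alpha> \<longleftrightarrow> indep_family I w"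
proof -
  have "(\<forall>v\<in>T p. (\<Sum>i\<in>I. a i * \<alpha> i v) = 0) \<longleftrightarrow> (\<Sum>i\<in>I. a i *\<^sub>R w i) = 0" for a
  proof -
    have "(\<forall>v\<in>T p. (\<Sum>i\<in>I. a i * \<alpha> i v) = 0) \<longleftrightarrow> (\<forall>u. (\<Sum>i\<in>I. a i *\<^sub>R w i) \<bullet> u = 0)"
      unfolding tangent_space_chart[OF assms(1,2)] using assms(3) by (simp add: inner_sum_left)
    then show ?thesis by (metis inner_eq_zero_iff inner_zero_left)
  qed
  then show ?thesis unfolding tindep_def indep_family_def by simp
qed

lemma tlin_family_representation:
  assumes "admissible_chart A c" "p \<in> fst c" "\<And>i. i \<in> I \<Longrightarrow> tlin p (\<alpha> i)"
  shows "\<exists>w. \<forall>i\<in>I. \<forall>u. \<alpha> i (coord_vec A c p u) = w i \<bullet> u"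
  using tlin_representation[OF assms(1,2)] assms(3) by (intro bchoice) blast

lemma tangent_set_image:
  assumes "admissible_chart A c" "p \<in> fst c" "S \<subseteq> T p"
  shows "S = coord_vec A c p ` {u. coord_vec A c p u \<in> S}"
  using assms(3) unfolding tangent_space_chart[OF assms(1,2)] by auto

lemma tangent_dim:
  assumes "admissible_chart A c" "p \<in> fst c" "S \<subseteq> T p"
  shows "dim S = dim {u. coord_vec A c p u \<in> S}"
  using dim_coord_vec_image[OF assms(1,2)] tangent_set_image[OF assms] by metis

lemma tangent_dim_mono:
  assumes "S \<subseteq> S'" "S' \<subseteq> T p"
  shows "dim S \<le> dim S'"
proof -
  obtain c where c: "c \<in> A" "p \<in> fst c" by (rule atlas_cover)
  note ad = atlas_admissible[OF c(1)]
  show ?thesis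
    using tangent_dim[OF ad c(2)] assms by (auto intro!: dim_subset)
qed

lemma tangent_dim_total: "dim (T p) = DIM('e)"
proof -
  obtain c where c: "c \<in> A" "p \<in> fst c" by (rule atlas_cover)
  note ad = atlas_admissible[OF c(1)]
  show ?thesis using dim_coord_vec_image[OF ad c(2), of UNIV] tangent_space_chart[OF ad c(2)] by simp
qed

lemma subspace_coord_preimage:
  assumes "admissible_chart A c" "p \<in> fst c" "subspace S"
  shows "subspace {u. coord_vec A c p u \<in> S}"
  using assms(3) coord_vec_linear[OF assms(1,2)]
  by (auto simp: subspace_def linear_add linear_scale linear_0)

lemma tangent_subspace_eq:
  assumes "S \<subseteq> S'" "S' \<subseteq> T p" "subspace S" "subspace S'" "dim S' \<le> dim S"
  shows "S = S'"
proof -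
  obtain c where c: "c \<in> A" "p \<in> fst c" by (rule atlas_cover)
  note ad = atlas_admissible[OF c(1)]
  let ?P = "\<lambda>S. {u. coord_vec A c p u \<in> S}"
  have S: "S \<subseteq> T p" using assms(1,2) by (rule order_trans)
  have "dim (?P S') \<le> dim (?P S)"
    using assms(5) tangent_dim[OF ad c(2) S] tangent_dim[OF ad c(2) assms(2)] by simp
  then have "?P S = ?P S'"
    by (intro subspace_dim_equal subspace_coord_preimage[OF ad c(2)] assms(3,4)) (use assms(1) in auto)
  then have "coord_vec A c p ` ?P S = coord_vec A c p ` ?P S'" by simp
  then show ?thesis
    unfolding tangent_set_image[OF ad c(2) S, symmetric] tangent_set_image[OF ad c(2) assms(2), symmetric] .
qed

lemma tlin_kernel_dim:
  assumes "finite I" "\<And>i. i \<in> I \<Longrightarrow> tlin p (\<alpha> i)" "tindep p I \<alpha>"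
  shows "dim {v \<in> T p. \<forall>i\<in>I. \<alpha> i v = 0} + card I = DIM('e)"
proof -
  obtain c where c: "c \<in> A" "p \<in> fst c" by (rule atlas_cover)
  note ad = atlas_admissible[OF c(1)]
  obtain w where w: "\<And>i u. i \<in> I \<Longrightarrow> \<alpha> i (coord_vec A c p u) = w i \<bullet> u"
    using tlin_family_representation[OF ad c(2), of I \<alpha>] assms(2) by blast
  have "dim {v \<in> T p. \<forall>i\<in>I. \<alpha> i v = 0} = dim {u. \<forall>i\<in>I. w i \<bullet> u = 0}"
    using w coord_vec_in_tangent[OF ad c(2)] by (subst tangent_dim[OF ad c(2)]) auto
  moreover have "dim (w ` I) = card I"
    using assms(3) tindep_representation[OF ad c(2), of I \<alpha> w] w indep_family_dim[OF assms(1), of w] by simp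
  ultimately show ?thesis using dim_orthogonal_family[where I = I and w = w] by simp
qed

text \<open>By the double orthogonal complement in a chart. It turns the description of a bundle as
  a common kernel into a linear relation between covectors.\<close>

lemma tlin_dual:
  assumes "finite I" "\<And>i. i \<in> I \<Longrightarrow> tlin p (\<alpha> i)" "tlin p \<beta>"
    and "\<And>v. v \<in> T p \<Longrightarrow> (\<And>i. i \<in> I \<Longrightarrow> \<alpha> i v = 0) \<Longrightarrow> \<beta> v = 0"
  shows "\<exists>a. \<forall>v\<in>T p. \<beta> v = (\<Sum>i\<in>I. a i * \<alpha> i v)"
proof -
  obtain c where c: "c \<in> A" "p \<in> fst c" by (rule atlas_cover)
  note ad = atlas_admissible[OF c(1)]
  obtain w where w: "\<And>i u. i \<in> I \<Longrightarrow> \<alpha> i (coord_vec A c p u) = w i \<bullet> u"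
    using tlin_family_representation[OF ad c(2), of I \<alpha>] assms(2) by blast
  obtain h where h: "\<And>u. \<beta> (coord_vec A c p u) = h \<bullet> u"
    using tlin_representation[OF ad c(2) assms(3)] by blast
  have "h \<bullet> u = 0" if "\<And>i. i \<in> I \<Longrightarrow> w i \<bullet> u = 0" for u
    using assms(4)[OF coord_vec_in_tangent[OF ad c(2)]] w h that by metis
  from orthogonal_family_dual[OF assms(1) this] obtain a where "h = (\<Sum>i\<in>I. a i *\<^sub>R w i)" by blast
  then have "\<forall>v\<in>T p. \<beta> v = (\<Sum>i\<in>I. a i * \<alpha> i v)"
    using h w unfolding tangent_space_chart[OF ad c(2)] by (auto simp: inner_sum_left)
  then show ?thesis by blast
qed

text \<open>The covectors on \<open>T p\<close> that vanish on \<open>K\<close> form a space of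
  dimension \<open>DIM('e) - dim K\<close>, so a spanning family with that many members has no room
  for a dependence.\<close>

lemma tindep_if_spanning:
  assumes "finite I" "\<And>i. i \<in> I \<Longrightarrow> tlin p (\<alpha> i)" "K \<subseteq> T p" "subspace K" "dim K + card I = DIM('e)"
    and "\<And>\<beta>. tlin p \<beta> \<Longrightarrow> (\<And>v. v \<in> K \<Longrightarrow> \<beta> v = 0) \<Longrightarrow> \<exists>a. \<forall>v\<in>T p. \<beta> v = (\<Sum>i\<in>I. a i * \<alpha> i v)"
  shows "tindep p I \<alpha>"
proof -
  obtain c where c: "c \<in> A" "p \<in> fst c" by (rule atlas_cover)
  note ad = atlas_admissible[OF c(1)]
  obtain w where w: "\<And>i u. i \<in> I \<Longrightarrow> \<alpha> i (coord_vec A c p u) = w i \<bullet> u"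
    using tlin_family_representation[OF ad c(2), of I \<alpha>] assms(2) by blast
  define L where "L = coord_vec A c p"
  have Lin: "L u \<in> T p" for u unfolding L_def by (rule coord_vec_in_tangent[OF ad c(2)])
  have Linj: "L u = L v \<Longrightarrow> u = v" for u v
    unfolding L_def using coord_vec_inj[OF ad c(2)] by (auto dest: injD)
  note linL = coord_vec_linear[OF ad c(2), folded L_def]
  define K' where "K' = {u. L u \<in> K}"
  have K': "subspace K'" "dim K' = dim K"
    using subspace_coord_preimage[OF ad c(2) assms(4)] tangent_dim[OF ad c(2) assms(3)] by (simp_all add: K'_def L_def)
  have "{h \<in> UNIV. \<forall>u\<in>K'. orthogonal u h} \<subseteq> span (w ` I)"
  proof
    fix h assume h: "h \<in> {h \<in> UNIV. \<forall>u\<in>K'. orthogonal u h}"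
    \<comment> \<open>The covector on \<open>T p\<close> represented by \<open>h\<close>, obtained
      by inverting the injective coordinate map \<open>L\<close>.\<close>
    define \<beta> where "\<beta> v = h \<bullet> (THE u. L u = v)" for v
    have \<beta>: "\<beta> (L u) = h \<bullet> u" for u
      unfolding \<beta>_def using Linj by (metis (mono_tags, lifting) theI)
    have "tlin p \<beta>"
      unfolding tlin_def
    proof (intro conjI ballI allI)
      fix u v r assume u: "u \<in> T p" and v: "v \<in> T p"
      then obtain a b where ab: "u = L a" "v = L b"
        unfolding L_def tangent_space_chart[OF ad c(2)] by auto
      show "\<beta> (u + v) = \<beta> u + \<beta> v"
        unfolding ab linear_add[OF linL, symmetric] \<beta> by (rule inner_add_right)
    next
      fix v r assume v: "v \<in> T p"
      then obtain b where b: "v = L b"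
        unfolding L_def tangent_space_chart[OF ad c(2)] by auto
      show "\<beta> (r *\<^sub>R v) = r * \<beta> v"
        unfolding b linear_scale[OF linL, symmetric] \<beta> by simp
    qed
    moreover have "\<beta> v = 0" if v: "v \<in> K" for v
    proof -
      obtain b where b: "v = L b"
        using v assms(3) unfolding L_def tangent_space_chart[OF ad c(2)] by auto
      then have "b \<in> K'" using v by (simp add: K'_def)
      then show ?thesis using h by (auto simp: b \<beta> orthogonal_def inner_commute)
    qed
    ultimately obtain a where a: "\<forall>v\<in>T p. \<beta> v = (\<Sum>i\<in>I. a i * \<alpha> i v)" using assms(6) by blast
    have "h \<bullet> u = (\<Sum>i\<in>I. a i *\<^sub>R w i) \<bullet> u" for u
    proof -
      have "h \<bullet> u = (\<Sum>i\<in>I. a i * \<alpha> i (L u))" using a Lin \<beta> by metis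
      then show ?thesis using w by (simp add: L_def inner_sum_left)
    qed
    then have "h = (\<Sum>i\<in>I. a i *\<^sub>R w i)" by (metis vector_eq_rdot inner_commute)
    then show "h \<in> span (w ` I)" by (simp only:) (intro span_sum span_scale span_base imageI)
  qed
  then have "dim {h \<in> UNIV. \<forall>u\<in>K'. orthogonal u h} \<le> dim (span (w ` I))" by (rule dim_subset)
  moreover have "dim {h \<in> UNIV. \<forall>u\<in>K'. orthogonal u h} + dim K' = DIM('e)"
    using dim_subspace_orthogonal_to_vectors[OF K'(1) subspace_UNIV] by simp
  ultimately have "card I \<le> dim (w ` I)" using K'(2) assms(5) by simp
  moreover have "dim (w ` I) \<le> card I"
    using dim_le_card'[of "w ` I"] card_image_le[OF assms(1), of w] assms(1) by simp
  ultimately show ?thesis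
    using tindep_representation[OF ad c(2), of I \<alpha> w] w indep_family_dim[OF assms(1), of w] by simp
qed

lemma tangent_hyperplane_dim:
  assumes "S \<subseteq> T p" "subspace S" "y \<in> S" "y f \<noteq> 0"
  shows "dim {v \<in> S. v f = 0} + 1 = dim S"
proof -
  obtain c where c: "c \<in> A" "p \<in> fst c" by (rule atlas_cover)
  note ad = atlas_admissible[OF c(1)]
  define L where "L = coord_vec A c p"
  note linL = coord_vec_linear[OF ad c(2), folded L_def]
  obtain w where w: "\<And>u. L u f = w \<bullet> u"
    using tlin_representation[OF ad c(2) tlin_eval[where f = f], folded L_def] by blast
  define S' where "S' = {u. L u \<in> S}"
  define K where "K = {u \<in> S'. w \<bullet> u = 0}"
  have S': "subspace S'" using subspace_coord_preimage[OF ad c(2) assms(2)] by (simp add: S'_def L_def)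
  then have K: "subspace K" unfolding K_def by (auto simp: subspace_def inner_add_right)
  obtain u0 where u0: "y = L u0" using assms(1,3) unfolding L_def tangent_space_chart[OF ad c(2)] by auto
  have u0': "u0 \<in> S'" "w \<bullet> u0 \<noteq> 0" using assms(3,4) w by (auto simp: S'_def u0)
  have "dim (insert u0 K) = dim K + 1"
  proof -
    have "u0 \<notin> span K" using K u0' by (simp add: span_eq_iff[THEN iffD2]) (simp add: K_def)
    then show ?thesis by (simp add: dim_insert)
  qed
  moreover have "span (insert u0 K) = S'"
  proof
    show "span (insert u0 K) \<subseteq> S'" by (rule span_minimal[OF _ S']) (use u0' in \<open>auto simp: K_def\<close>)
    show "S' \<subseteq> span (insert u0 K)"
    proof
      fix u assume u: "u \<in> S'"
      define t where "t = (w \<bullet> u) / (w \<bullet> u0)"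
      have "u - t *\<^sub>R u0 \<in> K"
        using u u0' S' by (auto simp: K_def t_def inner_diff_right intro: subspace_diff subspace_scale)
      then show "u \<in> span (insert u0 K)" unfolding span_breakdown_eq using span_base by blast
    qed
  qed
  ultimately have "dim K + 1 = dim S'" by (metis dim_span)
  moreover have "dim {v \<in> S. v f = 0} = dim K"
    using assms(1) by (subst tangent_dim[OF ad c(2)]) (auto simp: K_def S'_def L_def[symmetric] w)
  moreover have "dim S = dim S'" using tangent_dim[OF ad c(2) assms(1)] by (simp add: S'_def L_def)
  ultimately show ?thesis by simp
qed

section \<open>Derived flags\<close>

text \<open>Regularity asserts local frames for \<open>V\<close> and constant structure ranks for
  the flag, but no frames for the derived bundles. What passes from a bundle to its derived bundle,
  and suffices for bracket arguments, is that every fibre vector is the value of a global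
  section.\<close>

definition filled :: "'m tbundle \<Rightarrow> bool" where
  "filled V \<longleftrightarrow> (\<forall>p. V p \<subseteq> T p \<and> subspace (V p) \<and> (\<forall>v\<in>V p. \<exists>X\<in>sections A V. X p = v))"

lemma filledD:
  assumes "filled V"
  shows "V p \<subseteq> T p" "subspace (V p)" "v \<in> V p \<Longrightarrow> \<exists>X\<in>sections A V. X p = v"
  using assms by (auto simp: filled_def)

lemma sectionsD:
  assumes "X \<in> sections A V"
  shows "vector_field_on A UNIV X" "X p \<in> V p"
  using assms by (auto simp: sections_def)

text \<open>A local frame multiplied by a bump function \<open>g\<close> consists of global
  sections. It still spans wherever \<open>g\<close> is nonzero, not only where
  \<open>g = 1\<close>; the construction of locally finite generators relies on the stronger
  form.\<close>

lemma subbundle_global_frame: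
  assumes "subbundle A r V"
  shows "\<exists>N G g. open N \<and> p \<in> N \<and> smooth_fun_on A UNIV g \<and> (\<forall>q\<in>N. g q = 1) \<and>
    (\<forall>a<r. G a \<in> sections A V) \<and> (\<forall>q. g q \<noteq> 0 \<longrightarrow> V q = span ((\<lambda>a. G a q) ` {..<r}))"
proof -
  have V: "\<And>p. subspace (V p)" using assms by (auto simp: subbundle_def)
  obtain U X where U: "open U" "p \<in> U" "\<And>i. i < r \<Longrightarrow> vector_field_on A U (X i)"
    "\<And>q. q \<in> U \<Longrightarrow> V q = span ((\<lambda>i. X i q) ` {..<r})"
  proof -
    have "\<exists>U X. open U \<and> p \<in> U \<and> (\<forall>i<r. vector_field_on A U (X i)) \<and>
        (\<forall>q\<in>U. V q = span ((\<lambda>i. X i q) ` {..<r}))"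
      using assms by (simp add: subbundle_def)
    then show ?thesis using that by blast
  qed
  obtain g N K where g: "smooth_fun_on A UNIV g" "open N" "p \<in> N" "N \<subseteq> U" "\<forall>q\<in>N. g q = 1"
    "closed K" "K \<subseteq> U" "\<forall>q. q \<notin> K \<longrightarrow> g q = 0"
    using manifold_bump[OF U(1,2)] by blast
  define G where "G a q = (if q \<in> U then g q *\<^sub>R X a q else 0)" for a q
  have XV: "X a q \<in> V q" if "a < r" "q \<in> U" for a q
    using that by (auto simp: U(4) intro: span_base)
  have "G a \<in> sections A V" if a: "a < r" for a
    unfolding sections_def
  proof (intro CollectI conjI allI)
    show "vector_field_on A UNIV (G a)"
      unfolding G_def by (rule vector_field_extend[OF U(3)[OF a] U(1) g(1,6,7)]) (use g(8) in blast)
    show "G a q \<in> V q" for q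
      using XV[OF a] V by (simp add: G_def subspace_0 subspace_scale)
  qed
  moreover have "V q = span ((\<lambda>a. G a q) ` {..<r})" if q: "g q \<noteq> 0" for q
  proof -
    have qU: "q \<in> U" using g(7,8) q by blast
    have "X a q \<in> span ((\<lambda>a. G a q) ` {..<r})" if "a < r" for a
    proof -
      have "X a q = inverse (g q) *\<^sub>R G a q" using qU q by (simp add: G_def)
      also have "\<dots> \<in> span ((\<lambda>a. G a q) ` {..<r})" using that by (intro span_scale span_base) auto
      finally show ?thesis .
    qed
    then have 1: "span ((\<lambda>a. X a q) ` {..<r}) \<subseteq> span ((\<lambda>a. G a q) ` {..<r})"
      by (intro span_minimal subspace_span) auto
    have "G a q \<in> V q" if "a < r" for a using XV[OF that qU] V by (simp add: G_def subspace_0 subspace_scale)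
    then have "span ((\<lambda>a. G a q) ` {..<r}) \<subseteq> V q" by (intro span_minimal V) auto
    with 1 show ?thesis using U(4)[OF qU] by simp
  qed
  ultimately show ?thesis using g
    by (intro exI[of _ N] exI[of _ G] exI[of _ g]) simp
qed

lemma subbundle_filled:
  assumes "subbundle A r V"
  shows "filled V"
  unfolding filled_def
proof (intro allI conjI ballI)
  fix p
  have V: "\<And>p. V p \<subseteq> T p" "\<And>p. subspace (V p)" using assms by (auto simp: subbundle_def)
  then show "V p \<subseteq> T p" "subspace (V p)" by auto
  fix v assume v: "v \<in> V p"
  obtain N g G where "p \<in> N" "smooth_fun_on A UNIV g" "\<forall>q\<in>N. g q = 1" and G: "\<forall>a<r. G a \<in> sections A V"
    and span: "\<forall>q. g q \<noteq> 0 \<longrightarrow> V q = span ((\<lambda>a. G a q) ` {..<r})"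
    using subbundle_global_frame[OF assms, of p] by (elim exE conjE) (rule that, assumption+)
  then have "v \<in> span ((\<lambda>a. G a p) ` {..<r})" using v by auto
  then obtain b where b: "v = (\<Sum>a<r. b a *\<^sub>R G a p)"
    using span_image_obtain_coeffs by blast
  have "(\<lambda>q. \<Sum>a<r. b a *\<^sub>R G a q) \<in> sections A V"
    using G V(2) unfolding sections_def
    by (auto intro!: vector_field_sum vector_field_scale smooth_fun_on_const subspace_sum subspace_scale)
  then show "\<exists>X\<in>sections A V. X p = v" by (rule bexI[rotated]) (simp add: b)
qed

lemma derived_bundle_superset: "V p \<subseteq> derived_bundle A V p"
  unfolding derived_bundle_def using span_superset by blast

lemma lie_bracket_derived:
  "X \<in> sections A V \<Longrightarrow> Y \<in> sections A V \<Longrightarrow> lie_bracket A X Y p \<in> derived_bundle A V p"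
  unfolding derived_bundle_def by (intro span_base) blast

lemma sections_mono: "(\<And>p. V p \<subseteq> W p) \<Longrightarrow> X \<in> sections A V \<Longrightarrow> X \<in> sections A W"
  by (auto simp: sections_def)

text \<open>Generators of a fibre are values of sections of \<open>V\<close> or of brackets of such
  sections, and both are global sections of the derived bundle; constant linear combinations reach
  the whole span.\<close>

lemma derived_bundle_filled:
  assumes "filled V"
  shows "filled (derived_bundle A V)"
  unfolding filled_def
proof (intro allI conjI ballI)
  fix p
  have br: "lie_bracket A X Y p \<in> T p" if "X \<in> sections A V" "Y \<in> sections A V" for X Y p
    using that by (intro lie_bracket_tangent[of UNIV]) (auto dest: sectionsD)
  have "V p \<union> {lie_bracket A X Y p | X Y. X \<in> sections A V \<and> Y \<in> sections A V} \<subseteq> T p"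
    using br filledD(1)[OF assms] by blast
  then show "derived_bundle A V p \<subseteq> T p"
    unfolding derived_bundle_def by (rule span_minimal[OF _ tangent_subspace])
  show "subspace (derived_bundle A V p)" unfolding derived_bundle_def by (rule subspace_span)
  have sub: "\<And>p. subspace (derived_bundle A V p)" unfolding derived_bundle_def by (rule subspace_span)
  fix v assume "v \<in> derived_bundle A V p"
  then show "\<exists>X\<in>sections A (derived_bundle A V). X p = v"
    unfolding derived_bundle_def[of A V p]
  proof (induction rule: span_induct)
    case (step v)
    then consider "v \<in> V p" | X Y where "X \<in> sections A V" "Y \<in> sections A V" "v = lie_bracket A X Y p"
      by blast
    then show ?case
    proof cases
      case 1
      then obtain X where X: "X \<in> sections A V" "X p = v" using filledD(3)[OF assms] by blast
      have "X \<in> sections A (derived_bundle A V)"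
        by (rule sections_mono[of V]) (fact derived_bundle_superset, fact X(1))
      with X(2) show ?thesis by blast
    next
      case 2
      have "vector_field_on A UNIV (lie_bracket A X Y)"
        using 2 by (intro lie_bracket_vector_field) (auto dest: sectionsD)
      then have "lie_bracket A X Y \<in> sections A (derived_bundle A V)"
        using lie_bracket_derived 2 by (auto simp: sections_def)
      then show ?thesis using 2 by blast
    qed
  next
    case base
    show ?case
    proof (rule subspaceI)
      have "(\<lambda>q. 0) \<in> sections A (derived_bundle A V)"
        using vector_field_zero sub by (auto simp: sections_def subspace_0)
      then show "0 \<in> {v. \<exists>X\<in>sections A (derived_bundle A V). X p = v}" by force
    next
      fix u v assume "u \<in> {v. \<exists>X\<in>sections A (derived_bundle A V). X p = v}" "v \<in> {v. \<exists>X\<in>sections A (derived_bundle A V). X p = v}"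
      then obtain X Y where XY: "X \<in> sections A (derived_bundle A V)" "Y \<in> sections A (derived_bundle A V)" "X p = u" "Y p = v" by blast
      then have "(\<lambda>q. X q + Y q) \<in> sections A (derived_bundle A V)"
        using vector_field_add sub by (auto simp: sections_def subspace_add)
      with XY show "u + v \<in> {v. \<exists>X\<in>sections A (derived_bundle A V). X p = v}" by force
    next
      fix r u assume "u \<in> {v. \<exists>X\<in>sections A (derived_bundle A V). X p = v}"
      then obtain X where X: "X \<in> sections A (derived_bundle A V)" "X p = u" by blast
      then have "(\<lambda>q. r *\<^sub>R X q) \<in> sections A (derived_bundle A V)"
        using vector_field_scale[OF smooth_fun_on_const[OF open_UNIV]] sub by (auto simp: sections_def subspace_scale)
      with X show "r *\<^sub>R u \<in> {v. \<exists>X\<in>sections A (derived_bundle A V). X p = v}" by force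
    qed
  qed
qed

lemma derived_flag_0: "derived_flag A 0 V = V"
  by (simp add: derived_flag_def)

lemma derived_flag_Suc: "derived_flag A (Suc i) V = derived_bundle A (derived_flag A i V)"
  by (simp add: derived_flag_def)

lemma derived_flag_filled: "filled V \<Longrightarrow> filled (derived_flag A i V)"
  by (induction i) (simp_all add: derived_flag_0 derived_flag_Suc derived_bundle_filled)

lemma derived_flag_mono: "i \<le> j \<Longrightarrow> derived_flag A i V p \<subseteq> derived_flag A j V p"
  by (induction rule: dec_induct) (use derived_bundle_superset derived_flag_Suc in auto)

text \<open>The structure rank is the jump of the fibre dimension from one level to the next, so
  constancy of all structure ranks propagates constancy of the dimensions upwards.\<close>

lemma derived_flag_dim:
  assumes "regular_bundle A V" "filled V"
  shows "dim (derived_flag A i V p) = flag_rank A V i"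
proof -
  obtain r where r: "subbundle A r V" using assms by (auto simp: regular_bundle_def)
  have "\<exists>d. \<forall>p. dim (derived_flag A i V p) = d"
  proof (induction i)
    case 0
    then show ?case using r by (auto simp: derived_flag_0 subbundle_def)
  next
    case (Suc i)
    then obtain d where d: "\<And>p. dim (derived_flag A i V p) = d" by blast
    let ?F = "derived_flag A i V"
    obtain s where s: "\<And>p. structure_rank A ?F p = s"
      using assms by (auto simp: regular_bundle_def)
    have "dim (derived_flag A (Suc i) V p) = s + d" for p
    proof -
      have F: "filled (derived_flag A (Suc i) V)" using derived_flag_filled[OF assms(2)] .
      \<comment> \<open>Needed because \<open>dim_mod\<close> subtracts natural numbers: the
        inclusion ensures that nothing is truncated.\<close>
      have "dim (?F p) \<le> dim (derived_flag A (Suc i) V p)"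
        using filledD(1)[OF F] derived_flag_mono[of i "Suc i"] by (intro tangent_dim_mono) auto
      moreover have "s = dim (derived_flag A (Suc i) V p) - dim (?F p)"
        using s[of p] by (simp add: structure_rank_def dim_mod_def derived_flag_Suc derived_bundle_def Un_commute)
      ultimately show ?thesis using d[of p] by simp
    qed
    then show ?case by blast
  qed
  then obtain d where d: "\<And>p. dim (derived_flag A i V p) = d" by blast
  have "flag_rank A V i = d"
    unfolding flag_rank_def bundle_rank_def using d by (intro the_equality) auto
  then show ?thesis using d by simp
qed

end

section \<open>Determinants\<close>

text \<open>Composing permutations with the transposition of \<open>r\<close> and \<open>s\<close>
  preserves the products and flips the signs, so the determinant equals its own negative.\<close>

lemma ndet_equal_rows:
  assumes "r \<in> {1..n}" "s \<in> {1..n}" "r \<noteq> s" "M r = M s"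
  shows "ndet n M = 0"
proof -
  let ?t = "Transposition.transpose r s"
  let ?f = "\<lambda>\<pi>. of_int (sign \<pi>) * (\<Prod>i=1..n. M i (\<pi> i)) :: real"
  have t: "?t permutes {1..n}" using assms(1,2) by (rule permutes_swap_id)
  have Mt: "M (?t i) = M i" for i using assms(4) by (auto simp: Transposition.transpose_def)
  have "?f (\<pi> \<circ> ?t) = - ?f \<pi>" if \<pi>: "\<pi> permutes {1..n}" for \<pi>
  proof -
    have "(\<Prod>i=1..n. M i (\<pi> i)) = (\<Prod>i=1..n. M (?t i) (\<pi> (?t i)))"
      using prod.permute[OF t, of "\<lambda>i. M i (\<pi> i)"] by (simp add: comp_def)
    then have "(\<Prod>i=1..n. M i ((\<pi> \<circ> ?t) i)) = (\<Prod>i=1..n. M i (\<pi> i))" by (simp add: Mt)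
    moreover have "sign (\<pi> \<circ> ?t) = - sign \<pi>"
    proof -
      have "permutation \<pi>" using \<pi> permutation_permutes by blast
      then show ?thesis using assms(3) by (simp add: sign_compose permutation_swap_id sign_swap_id)
    qed
    ultimately show ?thesis by simp
  qed
  then have "(\<Sum>\<pi> | \<pi> permutes {1..n}. ?f (\<pi> \<circ> ?t)) = (\<Sum>\<pi> | \<pi> permutes {1..n}. - ?f \<pi>)"
    by (intro sum.cong) auto
  then have "ndet n M = - ndet n M"
    using sum_permutations_compose_right[OF t, of ?f] by (simp add: ndet_def sum_negf)
  then show ?thesis by simp
qed

lemma ndet_row_linear:
  assumes "r \<in> {1..n}"
  shows "ndet n (M(r := (\<lambda>m. \<Sum>l\<in>L. b l * N l m))) = (\<Sum>l\<in>L. b l * ndet n (M(r := N l)))"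
proof -
  have "(\<Prod>i=1..n. (M(r := R)) i (\<pi> i)) = R (\<pi> r) * (\<Prod>i\<in>{1..n} - {r}. M i (\<pi> i))" for R and \<pi> :: "nat \<Rightarrow> nat"
  proof -
    have "(\<Prod>i=1..n. (M(r := R)) i (\<pi> i)) = R (\<pi> r) * (\<Prod>i\<in>{1..n} - {r}. (M(r := R)) i (\<pi> i))"
      using assms by (subst prod.remove[of _ r]) auto
    also have "(\<Prod>i\<in>{1..n} - {r}. (M(r := R)) i (\<pi> i)) = (\<Prod>i\<in>{1..n} - {r}. M i (\<pi> i))"
      by (rule prod.cong) auto
    finally show ?thesis .
  qed
  note e = this
  have "ndet n (M(r := (\<lambda>m. \<Sum>l\<in>L. b l * N l m))) =
    (\<Sum>\<pi> | \<pi> permutes {1..n}. \<Sum>l\<in>L. of_int (sign \<pi>) * (b l * N l (\<pi> r) * (\<Prod>i\<in>{1..n} - {r}. M i (\<pi> i))))"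
    unfolding ndet_def e by (simp add: sum_distrib_left sum_distrib_right)
  also have "\<dots> = (\<Sum>l\<in>L. \<Sum>\<pi> | \<pi> permutes {1..n}. of_int (sign \<pi>) * (b l * N l (\<pi> r) * (\<Prod>i\<in>{1..n} - {r}. M i (\<pi> i))))"
    by (rule sum.swap)
  also have "\<dots> = (\<Sum>l\<in>L. b l * ndet n (M(r := N l)))"
    unfolding ndet_def e by (simp add: sum_distrib_left mult_ac)
  finally show ?thesis .
qed

text \<open>Put the vanishing combination of rows in place of row \<open>r\<close>. The determinant
  is then 0, while by linearity and the rule for equal rows it is \<open>b r\<close> times the
  original one.\<close>

lemma ndet_nonzero_rows_indep:
  assumes "ndet n M \<noteq> 0" "\<And>m. m \<in> {1..n} \<Longrightarrow> (\<Sum>l=1..n. b l * M l m) = 0" "r \<in> {1..n}"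
  shows "b r = 0"
proof -
  have "ndet n (M(r := (\<lambda>m. \<Sum>l=1..n. b l * M l m))) = 0"
    unfolding ndet_def
  proof (rule sum.neutral, rule ballI)
    fix \<pi> assume "\<pi> \<in> {\<pi>. \<pi> permutes {1..n}}"
    then have "\<pi> permutes {1..n}" by simp
    then have \<pi>: "\<pi> r \<in> {1..n}" using assms(3) by (simp only: permutes_in_image)
    have "(M(r := (\<lambda>m. \<Sum>l=1..n. b l * M l m))) r (\<pi> r) = 0"
      using assms(2)[OF \<pi>] unfolding fun_upd_same .
    then have "(\<Prod>i=1..n. (M(r := (\<lambda>m. \<Sum>l=1..n. b l * M l m))) i (\<pi> i)) = 0"
      using assms(3) by (intro prod_zero) (auto simp del: fun_upd_apply)
    then show "of_int (sign \<pi>) * (\<Prod>i=1..n. (M(r := (\<lambda>m. \<Sum>l=1..n. b l * M l m))) i (\<pi> i)) = 0"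
      by (simp only: mult_zero_right)
  qed
  then have "(\<Sum>l=1..n. b l * ndet n (M(r := M l))) = 0"
    using ndet_row_linear[OF assms(3), where M = M and L = "{1..n}" and b = b and N = M] by simp
  moreover have "b l * ndet n (M(r := M l)) = (if l = r then b r * ndet n M else 0)" if "l \<in> {1..n}" for l
    using ndet_equal_rows[of r n l "M(r := M l)"] that assms(3) by auto
  ultimately have "(\<Sum>l=1..n. if l = r then b r * ndet n M else 0) = 0" by simp
  then show ?thesis using assms(1,3) by simp
qed

section \<open>Coordinates of a partial prolongation\<close>

text \<open>With \<open>x\<close>, the coordinates in \<open>zset \<tau> i\<close> cut out \<open>V\<^sup>(\<^sup>i\<^sup>) \<inter> ker dx\<close>, and those in \<open>zset' \<tau> i\<close> cut out
  the Cauchy bundle of \<open>V\<^sup>(\<^sup>i\<^sup>)\<close>.\<close>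

definition zset :: "nat list \<Rightarrow> nat \<Rightarrow> pp_index set" where
  "zset \<tau> i = {CZ l j s | l j s. i < j \<and> j \<le> length \<tau> \<and> 1 \<le> l \<and> l \<le> rho \<tau> j \<and> s + i < j}"

definition zset' :: "nat list \<Rightarrow> nat \<Rightarrow> pp_index set" where
  "zset' \<tau> i = {CZ l j s | l j s. i < j \<and> j \<le> length \<tau> \<and> 1 \<le> l \<and> l \<le> rho \<tau> j \<and> s + i \<le> j}"

text \<open>There is no bound on \<open>s\<close>, so the set is closed under \<open>up\<close>: the
  prolonged functions and their relation to \<open>Y\<close> make sense at every order.\<close>

definition zall :: "nat list \<Rightarrow> pp_index set" where
  "zall \<tau> = {CZ l j s | l j s. 1 \<le> j \<and> j \<le> length \<tau> \<and> 1 \<le> l \<and> l \<le> rho \<tau> j}"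

fun up :: "pp_index \<Rightarrow> pp_index" where
  "up CX = CX"
| "up (CZ l j s) = CZ l j (Suc s)"

lemma zset_image:
  "zset \<tau> i = (\<lambda>(j, l, s). CZ l j s) ` (SIGMA j:{Suc i..length \<tau>}. {1..rho \<tau> j} \<times> {..<j - i})"
  by (force simp: zset_def image_iff)

lemma zset'_image:
  "zset' \<tau> i = (\<lambda>(j, l, s). CZ l j s) ` (SIGMA j:{Suc i..length \<tau>}. {1..rho \<tau> j} \<times> {..j - i})"
  by (force simp: zset'_def image_iff)

lemma finite_zset: "finite (zset \<tau> i)"
  unfolding zset_image by auto

lemma finite_zset': "finite (zset' \<tau> i)"
  unfolding zset'_image by auto

text \<open>This number is the codimension of \<open>V^(i)\<close> that the decceleration vector
  prescribes.\<close>

lemma card_zset: "card (zset \<tau> i) = (\<Sum>j=Suc i..length \<tau>. rho \<tau> j * (j - i))"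
  unfolding zset_image by (subst card_image) (auto simp: inj_on_def card_cartesian_product)

lemma CX_notin [simp]: "CX \<notin> zset \<tau> i" "CX \<notin> zset' \<tau> i" "CX \<notin> zall \<tau>"
  by (auto simp: zset_def zset'_def zall_def)

lemma zset_subsets: "zset \<tau> i \<subseteq> zset' \<tau> i" "zset' \<tau> i \<subseteq> zall \<tau>" "zset \<tau> i \<subseteq> zall \<tau>" "zset \<tau> (Suc i) \<subseteq> zset \<tau> i"
  by (force simp: zset_def zset'_def zall_def)+

lemma up_zset: "\<xi> \<in> zset \<tau> i \<Longrightarrow> up \<xi> \<in> zset' \<tau> i"
  by (auto simp: zset_def zset'_def)

lemma up_zall: "\<xi> \<in> zall \<tau> \<Longrightarrow> up \<xi> \<in> zall \<tau>"
  by (auto simp: zall_def)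

text \<open>The difference \<open>zset \<tau> i - zset \<tau> (Suc i)\<close> consists of the
  indices with \<open>s + i + 1 = j\<close>. Their successors are the indices with
  \<open>s + i = j\<close>, which is all that \<open>zset'\<close> adds to
  \<open>zset\<close>.\<close>

lemma zset'_cases: "\<xi> \<in> zset' \<tau> i \<Longrightarrow> \<xi> \<in> zset \<tau> i \<or> (\<exists>\<eta>\<in>zset \<tau> i - zset \<tau> (Suc i). \<xi> = up \<eta>)"
proof -
  assume "\<xi> \<in> zset' \<tau> i"
  then obtain l j s where \<xi>: "\<xi> = CZ l j s" "i < j" "j \<le> length \<tau>" "1 \<le> l" "l \<le> rho \<tau> j" "s + i \<le> j"
    by (auto simp: zset'_def)
  show ?thesis
  proof (cases "s + i = j")
    case True
    then obtain t where t: "s = Suc t" using \<xi> by (cases s) auto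
    then have "CZ l j t \<in> zset \<tau> i - zset \<tau> (Suc i)" "\<xi> = up (CZ l j t)"
      using \<xi> True by (auto simp: zset_def)
    then show ?thesis by blast
  next
    case False
    then show ?thesis using \<xi> by (auto simp: zset_def)
  qed
qed

lemma up_top_notin: "\<eta> \<in> zset \<tau> i - zset \<tau> (Suc i) \<Longrightarrow> up \<eta> \<notin> zset \<tau> i"
  by (auto simp: zset_def)

lemma inj_on_up: "CX \<notin> S \<Longrightarrow> inj_on up S"
proof (rule inj_onI)
  fix a b assume "CX \<notin> S" "a \<in> S" "b \<in> S" "up a = up b"
  then show "a = b" by (cases a; cases b) auto
qed

lemma zset'_split: "zset' \<tau> i = zset \<tau> i \<union> up ` (zset \<tau> i - zset \<tau> (Suc i))"
proof (intro equalityI subsetI)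
  fix \<xi> assume "\<xi> \<in> zset' \<tau> i"
  from zset'_cases[OF this] show "\<xi> \<in> zset \<tau> i \<union> up ` (zset \<tau> i - zset \<tau> (Suc i))" by auto
next
  fix \<xi> assume "\<xi> \<in> zset \<tau> i \<union> up ` (zset \<tau> i - zset \<tau> (Suc i))"
  then show "\<xi> \<in> zset' \<tau> i" using zset_subsets(1)[of \<tau> i] by (auto simp: up_zset)
qed

lemma sum_zset'_split:
  "(\<Sum>\<xi>\<in>insert CX (zset' \<tau> i). f \<xi>) = (\<Sum>\<xi>\<in>insert CX (zset \<tau> i). f \<xi>) + (\<Sum>\<xi>\<in>zset \<tau> i - zset \<tau> (Suc i). f (up \<xi>))"
    for f :: "pp_index \<Rightarrow> 'b::comm_monoid_add"
proof -
  have "(\<Sum>\<xi>\<in>zset' \<tau> i. f \<xi>) = (\<Sum>\<xi>\<in>zset \<tau> i. f \<xi>) + (\<Sum>\<xi>\<in>up ` (zset \<tau> i - zset \<tau> (Suc i)). f \<xi>)"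
    unfolding zset'_split using up_top_notin by (intro sum.union_disjoint) (auto simp: finite_zset)
  also have "(\<Sum>\<xi>\<in>up ` (zset \<tau> i - zset \<tau> (Suc i)). f \<xi>) = (\<Sum>\<xi>\<in>zset \<tau> i - zset \<tau> (Suc i). f (up \<xi>))"
    by (subst sum.reindex) (auto intro: inj_on_up)
  finally show ?thesis by (simp add: finite_zset finite_zset' add.assoc)
qed

text \<open>For \<open>j > i\<close> the conditions \<open>s + (i - 1) < j\<close> and
  \<open>s + i \<le> j\<close> agree; for \<open>j = i\<close> only \<open>s = 0\<close> survives.
  Thus one step down the flag brings in exactly the fundamental functions of order
  \<open>i\<close>.\<close>

lemma zset_pred:
  assumes "1 \<le> i" "i \<le> length \<tau>"
  shows "zset \<tau> (i - 1) = zset' \<tau> i \<union> (\<lambda>l. CZ l i 0) ` {1..rho \<tau> i}"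
proof (intro equalityI subsetI)
  fix \<xi> assume "\<xi> \<in> zset \<tau> (i - 1)"
  then obtain l j s where e: "\<xi> = CZ l j s" "i - 1 < j" "j \<le> length \<tau>" "1 \<le> l" "l \<le> rho \<tau> j" "s + (i - 1) < j"
    by (auto simp: zset_def)
  show "\<xi> \<in> zset' \<tau> i \<union> (\<lambda>l. CZ l i 0) ` {1..rho \<tau> i}"
  proof (cases "j = i")
    case True
    then have "s = 0" using e assms by linarith
    then show ?thesis using e True by auto
  next
    case False
    then have "i < j" "s + i \<le> j" using e assms by linarith+
    then show ?thesis using e by (auto simp: zset'_def)
  qed
next
  fix \<xi> assume "\<xi> \<in> zset' \<tau> i \<union> (\<lambda>l. CZ l i 0) ` {1..rho \<tau> i}"
  then show "\<xi> \<in> zset \<tau> (i - 1)" using assms by (auto simp: zset_def zset'_def)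
qed

lemma pp_indices_zset': "pp_indices \<tau> = insert CX (zset' \<tau> 0)"
proof -
  have "{CZ l j h | l j h. 1 \<le> j \<and> j \<le> length \<tau> \<and> 1 \<le> l \<and> l \<le> rho \<tau> j \<and> h \<le> j} = zset' \<tau> 0"
    unfolding zset'_def by (intro Collect_cong ex_cong1) auto
  then show ?thesis by (simp add: pp_indices_def)
qed

section \<open>The descending induction: contact forms cut out each bundle of the flag\<close>

section \<open>Descending along the derived flag\<close>

text \<open>The facts from which the descent runs, on an open \<open>W\<close> where
  \<open>Y x\<close> does not vanish: the codimensions of the flag (\<open>dim_flag\<close>), the
  data at level \<open>k - 1\<close> (\<open>top_indep\<close>, \<open>top_kill\<close>) and the
  fundamental functions of lower order.\<close>

locale prolongation = manifold A
  for A :: "('m::{t2_space,second_countable_topology}, 'e::euclidean_space) chart set" +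
  fixes V :: "'m tbundle" and \<tau> :: "nat list" and k :: nat and U W :: "'m set"
    and x :: "'m \<Rightarrow> real" and \<phi> :: "nat \<Rightarrow> nat \<Rightarrow> 'm \<Rightarrow> real" and Y :: "'m vfield"
  assumes V_filled: "filled V"
    and k_def: "k = length \<tau>"
    and k_pos: "1 \<le> k" "1 \<le> rho \<tau> k"
    and dim_flag: "i \<le> k \<Longrightarrow> dim (derived_flag A i V p) + (\<Sum>j=Suc i..k. rho \<tau> j * (j - i)) = DIM('e)"
    and W_open: "open W" and W_sub: "W \<subseteq> U"
    and Y_sec: "Y \<in> sections A V" and Yx: "p \<in> W \<Longrightarrow> Y p x \<noteq> 0"
    and x_smooth: "smooth_fun_on A W x"
    and \<phi>_smooth: "1 \<le> j \<Longrightarrow> j \<le> k \<Longrightarrow> 1 \<le> l \<Longrightarrow> l \<le> rho \<tau> j \<Longrightarrow> smooth_fun_on A W (\<phi> l j)"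
    and top_indep: "p \<in> W \<Longrightarrow>
      tindep p (insert CX (zset \<tau> (k - 1))) (\<lambda>\<xi> v. v (prolonged_coords Y x \<phi> \<xi>))"
    and top_kill: "p \<in> W \<Longrightarrow> v \<in> derived_flag A (k - 1) V p \<Longrightarrow> v x = 0 \<Longrightarrow> 1 \<le> l \<Longrightarrow> l \<le> rho \<tau> k \<Longrightarrow> v (\<phi> l k) = 0"
    and lower: "1 \<le> j \<Longrightarrow> j \<le> k - 1 \<Longrightarrow> 0 < rho \<tau> j \<Longrightarrow> fundamental_lower A V j (rho \<tau> j) U (\<lambda>l. \<phi> l j)"
begin

abbreviation z :: "pp_index \<Rightarrow> 'm \<Rightarrow> real" where "z \<equiv> prolonged_coords Y x \<phi>"
abbreviation dz :: "pp_index \<Rightarrow> 'm covec" where "dz \<equiv> \<lambda>\<xi> v. v (z \<xi>)"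
abbreviation F :: "nat \<Rightarrow> 'm tbundle" where "F i \<equiv> derived_flag A i V"

definition contact_form :: "'m \<Rightarrow> pp_index \<Rightarrow> 'm covec" where
  "contact_form p \<xi> v = v (z \<xi>) - z (up \<xi>) p * v x"

lemmas F_filled = derived_flag_filled[OF V_filled]
lemmas F_tangent = filledD(1)[OF F_filled]
lemmas F_subspace = filledD(2)[OF F_filled]
lemmas F_section = filledD(3)[OF F_filled]

lemma V_sections: "X \<in> sections A V \<Longrightarrow> X \<in> sections A (F i)"
  using derived_flag_mono[of 0 i V] by (auto simp: sections_def derived_flag_0)

lemma tlin_contact_form: "tlin p (contact_form p \<xi>)"
  unfolding contact_form_def by (intro tlin_diff tlin_scale tlin_eval)

lemma Y_field: "vector_field_on A UNIV Y"
  using Y_sec by (rule sectionsD)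

lemma smooth_z:
  assumes "\<xi> \<in> insert CX (zall \<tau>)"
  shows "smooth_fun_on A W (z \<xi>)"
proof -
  have "smooth_fun_on A W (prolonged Y x (\<phi> l j) s)"
    if "1 \<le> j" "j \<le> k" "1 \<le> l" "l \<le> rho \<tau> j" for l j s
  proof (induction s)
    case 0
    then show ?case using \<phi>_smooth[OF that] by simp
  next
    case (Suc s)
    then show ?case
      by (auto intro!: smooth_fun_on_divide vector_field_smooth[OF Y_field] x_smooth Yx)
  qed
  then show ?thesis using assms x_smooth by (auto simp: zall_def k_def)
qed

lemma Y_z: "p \<in> W \<Longrightarrow> \<xi> \<in> zall \<tau> \<Longrightarrow> Y p (z \<xi>) = z (up \<xi>) p * Y p x"
  using Yx by (auto simp: zall_def)

text \<open>In Cartan's formula the terms that differentiate the values of the form drop out,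
  because these values vanish on all of \<open>W\<close> and not just at \<open>p\<close>.
  Concretely, \<open>X' z_s = z_{s+1} X' x\<close> is differentiated by the Leibniz rule, and the
  terms with factor \<open>z (up \<xi>) p\<close> are absorbed by the form.\<close>

lemma contact_form_lie_bracket:
  assumes "vector_field_on A UNIV X" "vector_field_on A UNIV X'" "p \<in> W" "\<xi> \<in> zall \<tau>"
    and "\<And>q. q \<in> W \<Longrightarrow> contact_form q \<xi> (X q) = 0" "\<And>q. q \<in> W \<Longrightarrow> contact_form q \<xi> (X' q) = 0"
  shows "contact_form p \<xi> (lie_bracket A X X' p) = X p (z (up \<xi>)) * X' p x - X' p (z (up \<xi>)) * X p x"
proof -
  have zs: "smooth_near A p (z \<xi>)" "smooth_near A p (z (up \<xi>))" "smooth_near A p x"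
    using smooth_z[of \<xi>] smooth_z[of "up \<xi>"] x_smooth assms(3,4) up_zall smooth_nearI by auto
  have iter: "Z p (\<lambda>q. Z' q (z \<xi>)) = z (up \<xi>) p * Z p (\<lambda>q. Z' q x) + Z p (z (up \<xi>)) * Z' p x"
    if Z: "vector_field_on A UNIV Z" and Z': "vector_field_on A UNIV Z'" "\<And>q. q \<in> W \<Longrightarrow> contact_form q \<xi> (Z' q) = 0" for Z Z'
  proof -
    have Zp: "Z p \<in> T p" using vector_field_tangent[OF Z] by simp
    have "smooth_near A p (\<lambda>q. Z' q x)"
      using vector_field_smooth[OF Z'(1) x_smooth] assms(3) by (auto intro: smooth_nearI)
    note m = tangent_mult[OF Zp zs(2) this]
    have "Z p (\<lambda>q. Z' q (z \<xi>)) = Z p (\<lambda>q. z (up \<xi>) q * Z' q x)"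
      by (rule tangent_cong[OF Zp W_open assms(3)]) (use Z'(2) in \<open>simp add: contact_form_def\<close>)
    with m show ?thesis by simp
  qed
  show ?thesis
    unfolding contact_form_def lie_bracket_apply[OF zs(1)] lie_bracket_apply[OF zs(3)]
    using iter[OF assms(1,2,6)] iter[OF assms(2,1,5)] by (simp add: algebra_simps)
qed

lemma indep_contact_form:
  assumes "tindep p (insert CX (zset \<tau> i)) dz"
  shows "tindep p (zset \<tau> i) (contact_form p)"
  unfolding tindep_def
proof (intro allI impI ballI)
  fix a \<xi> assume a: "\<forall>v\<in>T p. (\<Sum>\<xi>\<in>zset \<tau> i. a \<xi> * contact_form p \<xi> v) = 0" and \<xi>: "\<xi> \<in> zset \<tau> i"
  \<comment> \<open>Expanding the contact forms collects all their \<open>dx\<close> parts into one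
    coefficient, placed at \<open>CX\<close>.\<close>
  define b where "b = a(CX := - (\<Sum>\<xi>\<in>zset \<tau> i. a \<xi> * z (up \<xi>) p))"
  have "(\<Sum>\<xi>\<in>insert CX (zset \<tau> i). b \<xi> * v (z \<xi>)) = 0" if "v \<in> T p" for v
  proof -
    have "(\<Sum>\<xi>\<in>zset \<tau> i. b \<xi> * v (z \<xi>)) = (\<Sum>\<xi>\<in>zset \<tau> i. a \<xi> * v (z \<xi>))"
      by (rule sum.cong) (auto simp: b_def)
    moreover have "(\<Sum>\<xi>\<in>zset \<tau> i. a \<xi> * contact_form p \<xi> v) =
        (\<Sum>\<xi>\<in>zset \<tau> i. a \<xi> * v (z \<xi>)) - (\<Sum>\<xi>\<in>zset \<tau> i. a \<xi> * z (up \<xi>) p) * v x"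
      by (simp add: contact_form_def right_diff_distrib sum_subtractf sum_distrib_right mult.assoc)
    ultimately show ?thesis using a that by (simp add: finite_zset b_def)
  qed
  from tindepD[OF assms this, of \<xi>] \<xi> have "b \<xi> = 0" by simp
  then show "a \<xi> = 0" using \<xi> by (auto simp: b_def split: if_splits)
qed

text \<open>Independence is required of \<open>dx\<close> and the \<open>dz\<close> together. It
  implies independence of the contact forms and also rules out that one of the differentials is a
  multiple of \<open>dx\<close>.\<close>

definition adapted :: "nat \<Rightarrow> bool" where
  "adapted i \<longleftrightarrow> (\<forall>p\<in>W. tindep p (insert CX (zset \<tau> i)) dz \<and>
     F i p = {v \<in> T p. \<forall>\<xi>\<in>zset \<tau> i. contact_form p \<xi> v = 0})"

lemma adaptedD:
  assumes "adapted i" "p \<in> W"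
  shows "tindep p (insert CX (zset \<tau> i)) dz"
    "F i p = {v \<in> T p. \<forall>\<xi>\<in>zset \<tau> i. contact_form p \<xi> v = 0}"
  using assms by (auto simp: adapted_def)

lemma adapted_section:
  assumes "adapted i" "X \<in> sections A (F i)" "q \<in> W" "\<xi> \<in> zset \<tau> i"
  shows "contact_form q \<xi> (X q) = 0"
  using sectionsD(2)[OF assms(2), of q] adaptedD(2)[OF assms(1,3)] assms(4) by auto

text \<open>Since \<open>Y\<close> is killed by every contact form, subtracting a multiple of
  \<open>Y\<close> reduces the inclusion to vectors killed by \<open>dx\<close>, where a contact
  form is just \<open>dz\<close>. Equality follows because the number of independent forms is the
  codimension given by \<open>dim_flag\<close>.\<close>

lemma adaptedI:
  assumes "i \<le> k" "\<And>p. p \<in> W \<Longrightarrow> tindep p (insert CX (zset \<tau> i)) dz"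
    and "\<And>p v \<xi>. p \<in> W \<Longrightarrow> v \<in> F i p \<Longrightarrow> v x = 0 \<Longrightarrow> \<xi> \<in> zset \<tau> i \<Longrightarrow> v (z \<xi>) = 0"
  shows "adapted i"
  unfolding adapted_def
proof (intro ballI conjI assms(2))
  fix p assume p: "p \<in> W"
  have Yp: "Y p \<in> F i p" using sectionsD(2)[OF V_sections[OF Y_sec]] .
  let ?K = "{v \<in> T p. \<forall>\<xi>\<in>zset \<tau> i. contact_form p \<xi> v = 0}"
  show "F i p = ?K"
  proof (rule tangent_subspace_eq)
    show "F i p \<subseteq> ?K"
    proof (intro subsetI CollectI conjI ballI)
      fix v \<xi> assume v: "v \<in> F i p"
      then show "v \<in> T p" using F_tangent by blast
      assume \<xi>: "\<xi> \<in> zset \<tau> i"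
      define t where "t = v x / Y p x"
      define u where "u = v - t *\<^sub>R Y p"
      have u: "u \<in> F i p" unfolding u_def using v Yp F_subspace by (intro subspace_diff subspace_scale)
      have uf: "u f = v f - t * Y p f" for f by (simp add: u_def scaleR_fun_def)
      have "u x = 0" using Yx[OF p] by (simp add: uf t_def)
      then have "u (z \<xi>) = 0" using assms(3)[OF p u _ \<xi>] by simp
      moreover have "Y p (z \<xi>) = z (up \<xi>) p * Y p x"
        using \<xi> zset_subsets(3) by (intro Y_z[OF p]) blast
      ultimately show "contact_form p \<xi> v = 0"
        using Yx[OF p] by (simp add: contact_form_def uf t_def)
    qed
    have "subspace ?K"
      using tlin_contact_form tangent_subspace[of p] unfolding subspace_def tlin_def
      by (auto simp: contact_form_def scaleR_fun_def algebra_simps)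
    then show "subspace ?K" .
    have "dim ?K + card (zset \<tau> i) = DIM('e)"
      by (intro tlin_kernel_dim finite_zset tlin_contact_form indep_contact_form assms(2) p)
    then show "dim ?K \<le> dim (F i p)"
      using dim_flag[OF assms(1), of p] by (simp add: card_zset k_def)
  qed (auto simp: F_subspace)
qed

text \<open>There are no contact forms at level \<open>k\<close>; what remains is
  \<open>dx \<noteq> 0\<close>, which \<open>Y\<close> witnesses. Together with level
  \<open>k - 1\<close> this starts the induction on pairs of levels.\<close>

lemma adapted_top: "adapted k"
proof (rule adaptedI)
  have "zset \<tau> k = {}" by (auto simp: zset_def k_def)
  then show "tindep p (insert CX (zset \<tau> k)) dz" if "p \<in> W" for p
    using Yx[OF that] vector_field_tangent[OF Y_field, of p] by (auto simp: tindep_def)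
  show "v (z \<xi>) = 0" if "\<xi> \<in> zset \<tau> k" for v \<xi>
    using that \<open>zset \<tau> k = {}\<close> by simp
qed simp

lemma adapted_pred_top: "adapted (k - 1)"
proof (rule adaptedI)
  show "v (z \<xi>) = 0" if p: "p \<in> W" and v: "v \<in> F (k - 1) p" "v x = 0" and \<xi>: "\<xi> \<in> zset \<tau> (k - 1)" for p v \<xi>
  proof -
    obtain l where "\<xi> = CZ l k 0" "1 \<le> l" "l \<le> rho \<tau> k"
      
    proof -
      obtain l j s where e: "\<xi> = CZ l j s" "k - 1 < j" "j \<le> k" "1 \<le> l" "l \<le> rho \<tau> j" "s + (k - 1) < j"
        using \<xi> by (auto simp: zset_def k_def)
      then have "j = k" "s = 0" by linarith+
      then show ?thesis using that e by blast
    qed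
    then show ?thesis using top_kill[OF p v] by simp
  qed
qed (use top_indep in auto)

text \<open>A dependence among the new differentials \<open>dz\<^sub>s\<^sub>+\<^sub>1\<close> would give a combination of the contact forms
  \<open>dz\<^sub>s - z\<^sub>s\<^sub>+\<^sub>1 dx\<close> that also vanishes on all brackets, hence on \<open>V\<^sup>(\<^sup>i\<^sup>+\<^sup>1\<^sup>)\<close>, where those forms are independent.\<close>

lemma indep_zset':
  assumes i: "i < k" and Ei: "adapted i" and ES: "adapted (Suc i)" and p: "p \<in> W"
  shows "tindep p (insert CX (zset' \<tau> i)) dz"
  unfolding tindep_def
proof (intro allI impI)
  fix a assume a: "\<forall>v\<in>T p. (\<Sum>\<xi>\<in>insert CX (zset' \<tau> i). a \<xi> * v (z \<xi>)) = 0"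
  let ?D = "zset \<tau> i - zset \<tau> (Suc i)"
  define \<alpha> where "\<alpha> v = (\<Sum>\<xi>\<in>?D. a (up \<xi>) * contact_form p \<xi> v)" for v
  define B where "B v = (\<Sum>\<xi>\<in>?D. a (up \<xi>) * v (z (up \<xi>)))" for v :: "'m tvec"
  \<comment> \<open>On \<open>V^(i)\<close> every \<open>dz\<close> indexed by
    \<open>zset \<tau> i\<close> is a multiple of \<open>dx\<close>, so the assumed relation says
    that the new differentials combine to \<open>B = \<kappa> dx\<close> there. The value of
    \<open>\<alpha>\<close> on a bracket is then antisymmetric in two equal factors and
    vanishes.\<close>
  define \<kappa> where "\<kappa> = - (\<Sum>\<xi>\<in>insert CX (zset \<tau> i). a \<xi> * (if \<xi> = CX then 1 else z (up \<xi>) p))"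
  have tl: "tlin p \<alpha>" unfolding \<alpha>_def by (intro tlin_sum tlin_scale tlin_contact_form)
  have B: "B v = \<kappa> * v x" if v: "v \<in> F i p" for v
  proof -
    have vT: "v \<in> T p" using v F_tangent by blast
    have "v (z \<xi>) = (if \<xi> = CX then 1 else z (up \<xi>) p) * v x" if "\<xi> \<in> insert CX (zset \<tau> i)" for \<xi>
      using that v unfolding adaptedD(2)[OF Ei p] by (auto simp: contact_form_def)
    then have "(\<Sum>\<xi>\<in>insert CX (zset \<tau> i). a \<xi> * v (z \<xi>)) = - \<kappa> * v x"
      unfolding \<kappa>_def minus_minus sum_distrib_right by (intro sum.cong refl) (simp add: mult.assoc)
    then show ?thesis
      using bspec[OF a vT] unfolding sum_zset'_split B_def by linarith
  qed
  have kill: "\<alpha> v = 0" if "v \<in> F (Suc i) p" for v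
  proof -
    have "subspace {v \<in> T p. \<alpha> v = 0}"
      using tl tangent_subspace[of p] subspace_0[OF tangent_subspace[of p]] unfolding subspace_def tlin_def
      by (auto; metis mult_zero_left scaleR_zero_left)
    moreover have "F i p \<union> {lie_bracket A X X' p | X X'. X \<in> sections A (F i) \<and> X' \<in> sections A (F i)} \<subseteq> {v \<in> T p. \<alpha> v = 0}"
    proof
      fix u assume "u \<in> F i p \<union> {lie_bracket A X X' p | X X'. X \<in> sections A (F i) \<and> X' \<in> sections A (F i)}"
      then consider "u \<in> F i p" | X X' where "X \<in> sections A (F i)" "X' \<in> sections A (F i)" "u = lie_bracket A X X' p" by blast
      then show "u \<in> {v \<in> T p. \<alpha> v = 0}"
      proof cases
        case 1
        then show ?thesis using adaptedD(2)[OF Ei p] by (auto simp: \<alpha>_def)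
      next
        case 2
        note XF = sectionsD(1)[OF 2(1)] sectionsD(1)[OF 2(2)]
        have "\<alpha> u = (\<Sum>\<xi>\<in>?D. a (up \<xi>) * (X p (z (up \<xi>)) * X' p x - X' p (z (up \<xi>)) * X p x))"
          unfolding \<alpha>_def 2(3)
          by (intro sum.cong refl arg_cong2[where f = "(*)"] contact_form_lie_bracket[OF XF p] adapted_section[OF Ei 2(1)] adapted_section[OF Ei 2(2)])
             (use zset_subsets(3) in auto)
        also have "\<dots> = B (X p) * X' p x - B (X' p) * X p x"
          unfolding B_def sum_distrib_right sum_subtractf[symmetric] by (intro sum.cong refl) (simp add: algebra_simps)
        also have "\<dots> = 0" using B sectionsD(2)[OF 2(1)] sectionsD(2)[OF 2(2)] by simp
        finally show ?thesis using lie_bracket_tangent[OF XF] by (simp add: 2(3))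
      qed
    qed
    ultimately have "F (Suc i) p \<subseteq> {v \<in> T p. \<alpha> v = 0}"
      unfolding derived_flag_Suc derived_bundle_def by (intro span_minimal)
    with that show ?thesis by blast
  qed
  \<comment> \<open>\<open>\<alpha>\<close> annihilates \<open>V^(i+1)\<close>, so it combines the
    forms of \<open>zset \<tau> (Suc i)\<close>, yet it was built from the forms outside that set.
    This is a relation among the independent forms of level \<open>i\<close>.\<close>
  have "\<exists>b. \<forall>v\<in>T p. \<alpha> v = (\<Sum>\<xi>\<in>zset \<tau> (Suc i). b \<xi> * contact_form p \<xi> v)"
    by (rule tlin_dual[OF finite_zset tlin_contact_form tl]) (rule kill, simp add: adaptedD(2)[OF ES p])
  then obtain b where b: "\<And>v. v \<in> T p \<Longrightarrow> \<alpha> v = (\<Sum>\<xi>\<in>zset \<tau> (Suc i). b \<xi> * contact_form p \<xi> v)"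
    by blast
  define c where "c \<xi> = (if \<xi> \<in> ?D then a (up \<xi>) else - b \<xi>)" for \<xi>
  have "(\<Sum>\<xi>\<in>zset \<tau> i. c \<xi> * contact_form p \<xi> v) = 0" if "v \<in> T p" for v
  proof -
    have "zset \<tau> i = ?D \<union> zset \<tau> (Suc i)" using zset_subsets(4) by blast
    then have "(\<Sum>\<xi>\<in>zset \<tau> i. c \<xi> * contact_form p \<xi> v) = (\<Sum>\<xi>\<in>?D. c \<xi> * contact_form p \<xi> v) + (\<Sum>\<xi>\<in>zset \<tau> (Suc i). c \<xi> * contact_form p \<xi> v)"
      by (metis (no_types, lifting) Diff_disjoint finite_Diff finite_zset inf_commute sum.union_disjoint)
    also have "(\<Sum>\<xi>\<in>?D. c \<xi> * contact_form p \<xi> v) = \<alpha> v" unfolding \<alpha>_def by (rule sum.cong) (auto simp: c_def)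
    also have "(\<Sum>\<xi>\<in>zset \<tau> (Suc i). c \<xi> * contact_form p \<xi> v) = - \<alpha> v"
      unfolding b[OF that] sum_negf[symmetric] by (rule sum.cong) (auto simp: c_def)
    finally show ?thesis by simp
  qed
  from tindepD[OF indep_contact_form[OF adaptedD(1)[OF Ei p]] this]
  have top: "a (up \<xi>) = 0" if "\<xi> \<in> ?D" for \<xi> using that unfolding c_def by (metis DiffD1)
  then have "(\<Sum>\<xi>\<in>insert CX (zset \<tau> i). a \<xi> * v (z \<xi>)) = 0" if "v \<in> T p" for v
    using a that unfolding sum_zset'_split by simp
  from tindepD[OF adaptedD(1)[OF Ei p] this]
  have "a \<xi> = 0" if "\<xi> \<in> insert CX (zset \<tau> i)" for \<xi> using that by blast
  with top show "\<forall>\<xi>\<in>insert CX (zset' \<tau> i). a \<xi> = 0"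
    unfolding zset'_split by auto
qed

end

section \<open>Cauchy bundles\<close>

lemma (in manifold) tindep_reindex:
  assumes "bij_betw e J I" "tindep p I \<alpha>"
  shows "tindep p J (\<lambda>j. \<alpha> (e j))"
  unfolding tindep_def
proof (intro allI impI ballI)
  fix a j assume a: "\<forall>v\<in>T p. (\<Sum>j\<in>J. a j * \<alpha> (e j) v) = 0" and j: "j \<in> J"
  have inv: "inv_into J e (e j) = j" if "j \<in> J" for j
    using assms(1) that by (simp add: bij_betw_def)
  have "(\<Sum>i\<in>I. a (inv_into J e i) * \<alpha> i v) = 0" if "v \<in> T p" for v
  proof -
    have "(\<Sum>i\<in>I. a (inv_into J e i) * \<alpha> i v) = (\<Sum>j\<in>J. a (inv_into J e (e j)) * \<alpha> (e j) v)"
      by (rule sum.reindex_bij_betw[OF assms(1), symmetric])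
    also have "\<dots> = (\<Sum>j\<in>J. a j * \<alpha> (e j) v)" by (rule sum.cong) (simp_all add: inv)
    finally show ?thesis using a that by simp
  qed
  from tindepD[OF assms(2) this, of "e j"] show "a j = 0"
    using assms(1) j by (auto simp: inv bij_betw_def)
qed

lemma (in manifold) coord_vec_gradient:
  assumes "admissible_chart A c" "q \<in> fst c" "smooth_near A q f"
  shows "coord_vec A c q u f = (\<Sum>b\<in>Basis. frechet_derivative (f \<circ> chart_inv c) (at (snd c q)) b *\<^sub>R b) \<bullet> u"
proof -
  have "linear (frechet_derivative (f \<circ> chart_inv c) (at (snd c q)))"
    using smooth_near_derivative[OF assms] has_derivative_linear by blast
  from linear_Basis_expansion[OF this, of u] show ?thesis
    unfolding coord_vec_smooth[OF assms(3)] inner_sum_left inner_scaleR_left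
    by (simp add: inner_commute mult.commute)
qed

text \<open>In a chart the kernel condition is orthogonality to independent gradients, so the
  extension problem is one of projection. The field is then cut off; its closed support inside
  \<open>W\<close> makes it a global field that vanishes near each point outside \<open>W\<close>,
  as needed for sections in the Cauchy bundle.\<close>

lemma (in manifold) smooth_kernel_extension:
  fixes f :: "'i \<Rightarrow> 'm \<Rightarrow> real"
  assumes "open W" "finite I" "\<And>i. i \<in> I \<Longrightarrow> smooth_fun_on A W (f i)"
    and "\<And>q. q \<in> W \<Longrightarrow> tindep q I (\<lambda>i v. v (f i))"
    and "p \<in> W" "v \<in> T p" "\<And>i. i \<in> I \<Longrightarrow> v (f i) = 0"
  shows "\<exists>Z K. vector_field_on A UNIV Z \<and> Z p = v \<and> closed K \<and> K \<subseteq> W \<and> (\<forall>q. q \<notin> K \<longrightarrow> Z q = 0) \<and>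
    (\<forall>q\<in>W. \<forall>i\<in>I. Z q (f i) = 0)"
proof -
  obtain c where c: "c \<in> A" "p \<in> fst c" by (rule atlas_cover)
  note ad = atlas_admissible[OF c(1)] and ch = atlas_chart[OF c(1)]
  define N where "N = fst c \<inter> W"
  have N: "open N" "N \<subseteq> fst c" "N \<subseteq> W" "p \<in> N" "fst c \<inter> N = N"
    using is_chartD(1)[OF ch] assms(1,5) c by (auto simp: N_def)
  define S where "S = snd c ` N"
  have S: "open S" using is_chart_open_image[OF ch N(1)] N(5) by (simp add: S_def)
  obtain e :: "nat \<Rightarrow> 'i" where e: "bij_betw e {..<card I} I"
    using ex_bij_betw_nat_finite[OF assms(2)] by (metis atLeast0LessThan)
  have eI: "e m \<in> I" if "m < card I" for m using e that by (auto simp: bij_betw_def)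
  have eI': "\<exists>m<card I. i = e m" if "i \<in> I" for i using e that by (auto simp: bij_betw_def)
  define w where "w m y = (\<Sum>b\<in>Basis. frechet_derivative (f (e m) \<circ> chart_inv c) (at y) b *\<^sub>R b)" for m y
  have w_smooth: "smooth_on S (w m)" if "m < card I" for m
  proof -
    have "smooth_on (snd c ` (fst c \<inter> W)) (f (e m) \<circ> chart_inv c)"
      using smooth_fun_on_chart[OF assms(3)[OF eI[OF that]] ad] .
    then show ?thesis
      unfolding w_def using S
      by (intro smooth_on_sum smooth_on_scaleR smooth_on_frechet_const smooth_on_const) (auto simp: S_def N_def)
  qed
  have w: "coord_vec A c q u (f (e m)) = w m (snd c q) \<bullet> u" if "q \<in> N" "m < card I" for q m u
    unfolding w_def using that N
    by (intro coord_vec_gradient[OF ad] smooth_nearI[OF assms(3)[OF eI]]) auto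
  obtain v' where v': "v = coord_vec A c p v'" using assms(6) tangent_space_chart[OF ad c(2)] by auto
  \<comment> \<open>The constant field \<open>v'\<close> is the first guess, to be corrected away
    from the base point until it is orthogonal to all gradients.\<close>
  have "\<exists>u. smooth_on S u \<and> u (snd c p) = v' \<and> (\<forall>y\<in>S. \<forall>m<card I. w m y \<bullet> u y = 0) \<and>
           (\<forall>y\<in>S. \<forall>z. z \<bullet> v' = 0 \<longrightarrow> (\<forall>i<card I. z \<bullet> w i y = 0) \<longrightarrow> z \<bullet> u y = 0)"
  proof (rule smooth_extension_orthogonal[OF S w_smooth smooth_on_const])
    show "snd c p \<in> S" using N by (auto simp: S_def)
    show "w m (snd c p) \<bullet> v' = 0" if "m < card I" for m
      using w[OF N(4) that] assms(7)[OF eI[OF that]] v' by simp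
    fix y a assume y: "y \<in> S" and s: "(\<Sum>m<card I. a m *\<^sub>R w m y) = 0"
    obtain q where q: "q \<in> N" "y = snd c q" using y by (auto simp: S_def)
    then have qc: "q \<in> fst c" "q \<in> W" using N by auto
    have "tindep q {..<card I} (\<lambda>m v. v (f (e m)))"
      using tindep_reindex[OF e assms(4)[OF qc(2)]] .
    then have "indep_family {..<card I} (\<lambda>m. w m y)"
      using tindep_representation[OF ad qc(1), of "{..<card I}" "\<lambda>m v. v (f (e m))" "\<lambda>m. w m y"] w[OF q(1)] q(2) by simp
    then show "\<forall>m<card I. a m = 0" using s by (auto simp: indep_family_def)
  qed
  then obtain u where u: "smooth_on S u" "u (snd c p) = v'" "\<And>y m. y \<in> S \<Longrightarrow> m < card I \<Longrightarrow> w m y \<bullet> u y = 0"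
    by blast
  define Z where "Z q = coord_vec A c q (u (snd c q))" for q
  have Z: "vector_field_on A N Z"
    by (rule vector_field_lift[OF ad N(1,2) u(1)[unfolded S_def]]) (simp add: Z_def)
  obtain g N' K where g: "smooth_fun_on A UNIV g" "p \<in> N'" "\<forall>q\<in>N'. g q = 1"
    "closed K" "K \<subseteq> N" "\<forall>q. q \<notin> K \<longrightarrow> g q = 0"
    using manifold_bump[OF N(1,4)] by blast
  define Z' where "Z' q = (if q \<in> N then g q *\<^sub>R Z q else 0)" for q
  have "vector_field_on A UNIV Z'"
    unfolding Z'_def by (rule vector_field_extend[OF Z N(1) g(1,4,5)]) (use g(6) in blast)
  moreover have "Z' p = v" using g N u(2) v' by (simp add: Z'_def Z_def)
  moreover have "Z' q = 0" if "q \<notin> K" for q using g(6) that by (simp add: Z'_def)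
  moreover have "Z' q (f i) = 0" if "q \<in> W" and iI: "i \<in> I" for q i
  proof (cases "q \<in> N")
    case True
    obtain m where m: "m < card I" "i = e m" using eI'[OF iI] by blast
    have "Z q (f i) = w m (snd c q) \<bullet> u (snd c q)" unfolding Z_def m(2) by (rule w[OF True m(1)])
    also have "\<dots> = 0" by (rule u(3)[OF _ m(1)]) (use True in \<open>simp add: S_def\<close>)
    finally show ?thesis using True by (simp add: Z'_def scaleR_fun_def)
  qed (simp add: Z'_def)
  ultimately show ?thesis using g(4,5) N(3)
    by (intro exI[of _ Z'] exI[of _ K]) auto
qed

context prolongation
begin

text \<open>As \<open>[Z, X]\<close> is again a section, the bracket identity makes
  \<open>(dx, dz_{s+1})\<close> on \<open>Z\<close> and on \<open>X\<close> proportional for every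
  section \<open>X\<close>. If \<open>Z x\<close> were nonzero, \<open>dz_{s+1}\<close> would be a
  multiple of \<open>dx\<close> on \<open>V^(i)\<close>, against independence. With
  \<open>Z x = 0\<close>, taking \<open>X = Y\<close> kills the \<open>dz_{s+1}\<close>.\<close>

lemma cauchy_section_kills:
  assumes i: "i < k" and Ei: "adapted i"
    and ind: "tindep p (insert CX (zset' \<tau> i)) dz" and p: "p \<in> W"
    and Z: "Z \<in> sections A (F i)" "\<And>X. X \<in> sections A (F i) \<Longrightarrow> lie_bracket A Z X \<in> sections A (F i)"
    and \<xi>: "\<xi> \<in> insert CX (zset' \<tau> i)"
  shows "Z p (z \<xi>) = 0"
proof -
  have sw: "Z p (z (up \<eta>)) * X p x = X p (z (up \<eta>)) * Z p x" if X: "X \<in> sections A (F i)" and \<eta>: "\<eta> \<in> zset \<tau> i" for X \<eta>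
  proof -
    have "contact_form p \<eta> (lie_bracket A Z X p) = 0" using adapted_section[OF Ei Z(2)[OF X] p \<eta>] .
    moreover have "\<eta> \<in> zall \<tau>" using \<eta> zset_subsets(3) by blast
    ultimately show ?thesis
      using contact_form_lie_bracket[OF sectionsD(1)[OF Z(1)] sectionsD(1)[OF X] p, of \<eta>]
        adapted_section[OF Ei Z(1) _ \<eta>] adapted_section[OF Ei X _ \<eta>] by simp
  qed
  have Zx: "Z p x = 0"
  proof (rule ccontr)
    assume nz: "Z p x \<noteq> 0"
    \<comment> \<open>The last contact form of order \<open>k\<close> at level \<open>i\<close>: its
      successor has \<open>s + i = k\<close> and so leaves \<open>zset \<tau> i\<close>. It exists
      because \<open>rho \<tau> k \<ge> 1\<close> and \<open>i < k\<close>.\<close>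
    define \<eta> where "\<eta> = CZ 1 k (k - Suc i)"
    have \<eta>: "\<eta> \<in> zset \<tau> i" "up \<eta> \<notin> zset \<tau> i"
      using i k_pos by (auto simp: \<eta>_def zset_def k_def)
    define \<kappa> where "\<kappa> = Z p (z (up \<eta>)) / Z p x"
    have "v (z (up \<eta>)) - \<kappa> * v x = 0" if v: "v \<in> F i p" for v
    proof -
      obtain X where X: "X \<in> sections A (F i)" "X p = v" using F_section[OF v] by blast
      show ?thesis using sw[OF X(1) \<eta>(1)] nz by (simp add: X(2) \<kappa>_def field_simps)
    qed
    then have "\<exists>b. \<forall>v\<in>T p. v (z (up \<eta>)) - \<kappa> * v x = (\<Sum>\<xi>\<in>zset \<tau> i. b \<xi> * contact_form p \<xi> v)"
      by (intro tlin_dual finite_zset tlin_contact_form tlin_diff tlin_scale tlin_eval) (simp add: adaptedD(2)[OF Ei p])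
    then obtain b where b: "\<And>v. v \<in> T p \<Longrightarrow> v (z (up \<eta>)) - \<kappa> * v x = (\<Sum>\<xi>\<in>zset \<tau> i. b \<xi> * contact_form p \<xi> v)" by blast
    \<comment> \<open>The coefficients of the relation obtained by moving everything to one side and
      expanding the contact forms; their \<open>dx\<close> parts join \<open>- \<kappa>\<close> at
      \<open>CX\<close>.\<close>
    define a where "a \<xi> = (if \<xi> = up \<eta> then 1 else if \<xi> = CX then (\<Sum>\<xi>\<in>zset \<tau> i. b \<xi> * z (up \<xi>) p) - \<kappa>
       else if \<xi> \<in> zset \<tau> i then - b \<xi> else 0)" for \<xi>
    have upn: "up \<eta> \<noteq> CX" by (simp add: \<eta>_def)
    have "(\<Sum>\<xi>\<in>insert CX (zset' \<tau> i). a \<xi> * v (z \<xi>)) = 0" if v: "v \<in> T p" for v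
    proof -
      have 1: "(\<Sum>\<xi>\<in>zset \<tau> i. a \<xi> * v (z \<xi>)) = - (\<Sum>\<xi>\<in>zset \<tau> i. b \<xi> * v (z \<xi>))"
        unfolding sum_negf[symmetric] using \<eta>(2) by (intro sum.cong) (auto simp: a_def)
      have "(\<Sum>\<zeta>\<in>zset \<tau> i - zset \<tau> (Suc i). a (up \<zeta>) * v (z (up \<zeta>))) =
          (\<Sum>\<zeta>\<in>zset \<tau> i - zset \<tau> (Suc i). if \<zeta> = \<eta> then v (z (up \<eta>)) else 0)"
      proof (rule sum.cong[OF refl])
        fix \<zeta> assume \<zeta>: "\<zeta> \<in> zset \<tau> i - zset \<tau> (Suc i)"
        have "up \<zeta> = up \<eta> \<longleftrightarrow> \<zeta> = \<eta>" using inj_on_up[of "zset \<tau> i"] \<eta>(1) \<zeta> by (auto dest: inj_onD)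
        moreover have "up \<zeta> \<noteq> CX" using \<zeta> by (cases \<zeta>) auto
        ultimately show "a (up \<zeta>) * v (z (up \<zeta>)) = (if \<zeta> = \<eta> then v (z (up \<eta>)) else 0)"
          using up_top_notin[OF \<zeta>] by (simp add: a_def)
      qed
      also have "\<dots> = v (z (up \<eta>))"
        using \<eta> i by (simp add: finite_zset) (auto simp: \<eta>_def zset_def)
      finally have 2: "(\<Sum>\<zeta>\<in>zset \<tau> i - zset \<tau> (Suc i). a (up \<zeta>) * v (z (up \<zeta>))) = v (z (up \<eta>))" .
      have 3: "(\<Sum>\<xi>\<in>zset \<tau> i. b \<xi> * contact_form p \<xi> v) =
          (\<Sum>\<xi>\<in>zset \<tau> i. b \<xi> * v (z \<xi>)) - (\<Sum>\<xi>\<in>zset \<tau> i. b \<xi> * z (up \<xi>) p) * v x"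
        by (simp add: contact_form_def right_diff_distrib sum_subtractf sum_distrib_right mult.assoc)
      have 4: "a CX = (\<Sum>\<xi>\<in>zset \<tau> i. b \<xi> * z (up \<xi>) p) - \<kappa>" using upn by (simp add: a_def)
      show ?thesis
        unfolding sum_zset'_split 2 using 1 3 b[OF v] by (simp add: finite_zset 4 algebra_simps)
    qed
    from tindepD[OF ind this, of "up \<eta>"] show False using up_zset[OF \<eta>(1)] by (simp add: a_def)
  qed
  have up0: "Z p (z (up \<eta>)) = 0" if "\<eta> \<in> zset \<tau> i" for \<eta>
    using sw[OF V_sections[OF Y_sec] that] Zx Yx[OF p] by simp
  consider "\<xi> = CX" | "\<xi> \<in> zset \<tau> i" | \<eta> where "\<eta> \<in> zset \<tau> i" "\<xi> = up \<eta>"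
    using \<xi> zset'_cases by blast
  then show ?thesis
  proof cases
    case 1
    then show ?thesis using Zx by simp
  next
    case 2
    then show ?thesis using adapted_section[OF Ei Z(1) p 2] Zx by (simp add: contact_form_def)
  next
    case 3
    then show ?thesis using up0 by simp
  qed
qed

text \<open>For the inclusion from right to left, \<open>v\<close> is extended to a field
  \<open>Z\<close> killed on \<open>W\<close> by \<open>dx\<close> and all \<open>dz\<close> of
  \<open>zset'\<close>. Both products in the bracket identity then contain a factor coming from
  \<open>Z\<close>, so \<open>[Z, X]\<close> remains in \<open>V^(i)\<close> for every section
  \<open>X\<close>.\<close>

lemma char_flag_eq:
  assumes i: "i < k" and Ei: "adapted i"
    and ind: "\<And>p. p \<in> W \<Longrightarrow> tindep p (insert CX (zset' \<tau> i)) dz" and p: "p \<in> W"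
  shows "char_flag A V i p = {v \<in> T p. \<forall>\<xi>\<in>insert CX (zset' \<tau> i). v (z \<xi>) = 0}"
proof (intro equalityI subsetI)
  fix v assume "v \<in> char_flag A V i p"
  then obtain Z where Z: "Z \<in> sections A (F i)" "\<And>X. X \<in> sections A (F i) \<Longrightarrow> lie_bracket A Z X \<in> sections A (F i)" "v = Z p"
    by (auto simp: char_flag_def cauchy_bundle_def)
  then show "v \<in> {v \<in> T p. \<forall>\<xi>\<in>insert CX (zset' \<tau> i). v (z \<xi>) = 0}"
    using cauchy_section_kills[OF i Ei ind[OF p] p Z(1,2)] sectionsD(2)[OF Z(1), of p] F_tangent by blast
next
  fix v assume "v \<in> {v \<in> T p. \<forall>\<xi>\<in>insert CX (zset' \<tau> i). v (z \<xi>) = 0}"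
  then have v: "v \<in> T p" "\<And>\<xi>. \<xi> \<in> insert CX (zset' \<tau> i) \<Longrightarrow> v (z \<xi>) = 0" by auto
  have sm: "smooth_fun_on A W (z \<xi>)" if "\<xi> \<in> insert CX (zset' \<tau> i)" for \<xi>
    using that zset_subsets(2) by (intro smooth_z) blast
  obtain Z K where Z: "vector_field_on A UNIV Z" "Z p = v" "closed K" "K \<subseteq> W" "\<And>q. q \<notin> K \<Longrightarrow> Z q = 0"
    "\<And>q \<xi>. q \<in> W \<Longrightarrow> \<xi> \<in> insert CX (zset' \<tau> i) \<Longrightarrow> Z q (z \<xi>) = 0"
    using smooth_kernel_extension[OF W_open _ sm ind p v] finite_zset' by (metis (no_types, lifting) finite_insert)
  have Zx: "Z q x = 0" if "q \<in> W" for q using Z(6)[OF that, of CX] by simp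
  have Zth: "contact_form q \<xi> (Z q) = 0" if "q \<in> W" "\<xi> \<in> zset \<tau> i" for q \<xi>
    using Z(6)[OF that(1), of \<xi>] that(2) zset_subsets(1) Zx[OF that(1)] by (auto simp: contact_form_def)
  have "Z q \<in> F i q" for q
  proof (cases "q \<in> W")
    case True
    then show ?thesis using Zth vector_field_tangent[OF Z(1)] by (simp add: adaptedD(2)[OF Ei True])
  next
    case False
    then show ?thesis using Z(4,5) subspace_0[OF F_subspace] by (metis subsetD)
  qed
  then have ZF: "Z \<in> sections A (F i)" using Z(1) by (simp add: sections_def)
  have "lie_bracket A Z X \<in> sections A (F i)" if X: "X \<in> sections A (F i)" for X
    unfolding sections_def
  proof (intro CollectI conjI allI)
    note XF = sectionsD(1)[OF X]
    show "vector_field_on A UNIV (lie_bracket A Z X)" by (rule lie_bracket_vector_field[OF Z(1) XF open_UNIV])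
    fix q
    show "lie_bracket A Z X q \<in> F i q"
    proof (cases "q \<in> W")
      case True
      have "contact_form q \<xi> (lie_bracket A Z X q) = 0" if \<xi>: "\<xi> \<in> zset \<tau> i" for \<xi>
      proof -
        have "\<xi> \<in> zall \<tau>" using \<xi> zset_subsets(3) by blast
        from contact_form_lie_bracket[OF Z(1) XF True this Zth[OF _ \<xi>] adapted_section[OF Ei X _ \<xi>]]
        show ?thesis using Z(6)[OF True, of "up \<xi>"] up_zset[OF \<xi>] Zx[OF True] by simp
      qed
      then show ?thesis
        using lie_bracket_tangent[OF Z(1) XF] by (simp add: adaptedD(2)[OF Ei True])
    next
      case False
      \<comment> \<open>Outside \<open>W\<close> the shape of \<open>V^(i)\<close> is unknown, but
        \<open>Z\<close> vanishes on the open set \<open>- K\<close> around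
        \<open>q\<close>.\<close>
      then have "lie_bracket A Z X q = 0"
        using Z(3,4,5) by (intro lie_bracket_zero_left[OF XF, of "- K"]) auto
      then show ?thesis using subspace_0[OF F_subspace] by simp
    qed
  qed
  with ZF Z(2) show "v \<in> char_flag A V i p"
    unfolding char_flag_def cauchy_bundle_def by blast
qed

text \<open>Extend \<open>v\<close> to a section \<open>X\<close> of \<open>V^(i)\<close>. Then
  \<open>[X, Y]\<close> lies in \<open>V^(i+1)\<close> and is killed by its contact forms; as
  \<open>X x\<close> vanishes at \<open>p\<close> and \<open>Y x\<close> does not, the bracket
  identity leaves \<open>v (z (up \<eta>)) = 0\<close>.\<close>

lemma P_kills_zset':
  assumes i: "Suc i < k" and ES: "adapted (Suc i)" and p: "p \<in> W" and v: "v \<in> F i p" "v x = 0"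
    and \<xi>: "\<xi> \<in> insert CX (zset' \<tau> (Suc i))"
  shows "v (z \<xi>) = 0"
proof -
  obtain X where X: "X \<in> sections A (F i)" "X p = v" using F_section[OF v(1)] by blast
  have XS: "X \<in> sections A (F (Suc i))" by (rule sections_mono[OF _ X(1)]) (simp add: derived_flag_mono)
  have YF: "Y \<in> sections A (F i)" "Y \<in> sections A (F (Suc i))" using V_sections[OF Y_sec] by auto
  have "v (z (up \<eta>)) = 0" if \<eta>: "\<eta> \<in> zset \<tau> (Suc i)" for \<eta>
  proof -
    have "lie_bracket A X Y p \<in> F (Suc i) p"
      unfolding derived_flag_Suc using X(1) YF(1) by (rule lie_bracket_derived)
    then have "contact_form p \<eta> (lie_bracket A X Y p) = 0" using \<eta> by (simp add: adaptedD(2)[OF ES p])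
    moreover have "\<eta> \<in> zall \<tau>" using \<eta> zset_subsets(3) by blast
    ultimately have "X p (z (up \<eta>)) * Y p x = Y p (z (up \<eta>)) * X p x"
      using contact_form_lie_bracket[OF sectionsD(1)[OF XS] Y_field p _ adapted_section[OF ES XS _ \<eta>] adapted_section[OF ES YF(2) _ \<eta>]] by simp
    then show ?thesis using X(2) v(2) Yx[OF p] by simp
  qed
  moreover have "v (z \<eta>) = 0" if "\<eta> \<in> zset \<tau> (Suc i)" for \<eta>
    using adapted_section[OF ES XS p that] X(2) v(2) by (simp add: contact_form_def)
  ultimately show ?thesis using \<xi> zset'_cases[of \<xi> \<tau> "Suc i"] v(2) by auto
qed

end

lemma sum_zset_pred:
  fixes f :: "pp_index \<Rightarrow> 'b::comm_monoid_add"
  assumes "1 \<le> i" "i \<le> length \<tau>"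
  shows "(\<Sum>\<xi>\<in>insert CX (zset \<tau> (i - 1)). f \<xi>) =
    (\<Sum>\<xi>\<in>insert CX (zset' \<tau> i). f \<xi>) + (\<Sum>l=1..rho \<tau> i. f (CZ l i 0))"
proof -
  have "(\<Sum>\<xi>\<in>zset \<tau> (i - 1). f \<xi>) = (\<Sum>\<xi>\<in>zset' \<tau> i. f \<xi>) + (\<Sum>\<xi>\<in>(\<lambda>l. CZ l i 0) ` {1..rho \<tau> i}. f \<xi>)"
    unfolding zset_pred[OF assms] by (intro sum.union_disjoint finite_zset') (auto simp: zset'_def)
  also have "(\<Sum>\<xi>\<in>(\<lambda>l. CZ l i 0) ` {1..rho \<tau> i}. f \<xi>) = (\<Sum>l=1..rho \<tau> i. f (CZ l i 0))"
    by (subst sum.reindex) (auto simp: inj_on_def)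
  finally show ?thesis by (simp add: finite_zset finite_zset' add.assoc)
qed

lemma (in manifold) annihilatorD:
  assumes "\<alpha> \<in> annihilator A V p"
  shows "tlin p \<alpha>" "v \<in> V p \<Longrightarrow> \<alpha> v = 0"
  using assms by (auto simp: annihilator_def tlin_cotangent)

lemma (in manifold) annihilator_zero: "0 \<in> annihilator A V p"
  by (simp add: annihilator_def cotangent_space_def)

text \<open>Truncation off \<open>T p\<close> is the normalisation that
  \<open>cotangent_space\<close> demands; it makes a \<open>tlin\<close> functional comparable with
  annihilators.\<close>

lemma (in manifold) annihilator_restrict:
  assumes "tlin p \<beta>" "V p \<subseteq> T p" "\<And>v. v \<in> V p \<Longrightarrow> \<beta> v = 0"
  shows "(\<lambda>v. if v \<in> T p then \<beta> v else 0) \<in> annihilator A V p"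
  using assms subspace_add[OF tangent_subspace] subspace_scale[OF tangent_subspace]
  by (auto simp: annihilator_def cotangent_space_def tlin_def)

section \<open>One step down the flag by means of the fundamental functions\<close>

context prolongation
begin

lemma char_flag_inter_eq:
  assumes i: "Suc i < k" and ES: "adapted (Suc i)"
    and ind: "\<And>p. p \<in> W \<Longrightarrow> tindep p (insert CX (zset' \<tau> (Suc i))) dz" and p: "p \<in> W"
  shows "char_flag_inter A V (Suc i) p = {v \<in> F i p. v x = 0}"
proof (intro equalityI subsetI)
  fix v assume "v \<in> char_flag_inter A V (Suc i) p"
  then have v: "v \<in> F i p" "v \<in> char_flag A V (Suc i) p" by (auto simp: char_flag_inter_def)
  have "v \<in> {v \<in> T p. \<forall>\<xi>\<in>insert CX (zset' \<tau> (Suc i)). v (z \<xi>) = 0}"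
    using v(2) char_flag_eq[OF i ES ind p] by simp
  then have "v (z CX) = 0" by blast
  with v show "v \<in> {v \<in> F i p. v x = 0}" by simp
next
  fix v assume "v \<in> {v \<in> F i p. v x = 0}"
  then have v: "v \<in> F i p" "v x = 0" by auto
  have vT: "v \<in> T p" using v(1) F_tangent[of i p] by blast
  have "\<forall>\<xi>\<in>insert CX (zset' \<tau> (Suc i)). v (z \<xi>) = 0"
    by (rule ballI) (rule P_kills_zset'[OF i ES p v])
  with vT have "v \<in> char_flag A V (Suc i) p" using char_flag_eq[OF i ES ind p] by simp
  with v show "v \<in> char_flag_inter A V (Suc i) p" by (simp add: char_flag_inter_def)
qed

text \<open>Modulo the annihilator of \<open>Char V^(i+1)\<close>, the differentials of the
  fundamental functions are \<open>M\<close> times the forms \<open>\<omega>\<close>. Both parts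
  annihilate \<open>V^(i) \<inter> ker dx\<close>, which gives the second claim. The first follows
  by transferring independence from the \<open>\<omega>\<close> through the invertible
  matrix.\<close>

lemma lower_step:
  assumes i: "Suc i < k" and ES: "adapted (Suc i)" and pos: "0 < rho \<tau> (Suc i)"
    and ind: "\<And>p. p \<in> W \<Longrightarrow> tindep p (insert CX (zset' \<tau> (Suc i))) dz" and p: "p \<in> W"
  shows "tindep p (insert CX (zset \<tau> i)) dz"
    and "v \<in> F i p \<Longrightarrow> v x = 0 \<Longrightarrow> 1 \<le> l \<Longrightarrow> l \<le> rho \<tau> (Suc i) \<Longrightarrow> v (\<phi> l (Suc i)) = 0"
proof -
  let ?j = "Suc i"
  let ?n = "rho \<tau> ?j"
  let ?I' = "insert CX (zset' \<tau> ?j)"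
  let ?K = "char_flag_inter A V ?j p"
  let ?\<Xi> = "annihilator A (char_flag A V ?j) p"
  have jl: "1 \<le> ?j" "?j \<le> length \<tau>" using i by (auto simp: k_def)
  have "fundamental_lower A V ?j ?n U (\<lambda>l. \<phi> l ?j)" using lower[of ?j] i pos by simp
  then obtain \<omega> M where
    cof: "\<forall>i\<in>{1..?n}. one_form_on A U (\<omega> i)" and
    all: "\<forall>p\<in>U. let \<Xi> = annihilator A (char_flag A V ?j) p; \<Omega> = span ((\<lambda>i. \<omega> i p) ` {1..?n}) in
           annihilator A (char_flag_inter A V ?j) p = {\<xi> + \<eta> | \<xi> \<eta>. \<xi> \<in> \<Xi> \<and> \<eta> \<in> \<Omega>} \<and>
           \<Xi> \<inter> \<Omega> = {0} \<and> ndet ?n (M p) \<noteq> 0 \<and>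
           (\<forall>l\<in>{1..?n}. differential A (\<phi> l ?j) p - (\<Sum>i=1..?n. M p l i *\<^sub>R \<omega> i p) \<in> \<Xi>)"
    unfolding fundamental_lower_def by (elim conjE exE) (erule (1) that)
  have pU: "p \<in> U" using p W_sub by blast
  have sumK: "annihilator A (char_flag_inter A V ?j) p = {\<xi> + \<eta> | \<xi> \<eta>. \<xi> \<in> ?\<Xi> \<and> \<eta> \<in> span ((\<lambda>i. \<omega> i p) ` {1..?n})}"
    and det: "ndet ?n (M p) \<noteq> 0"
    and dif: "\<And>l. l \<in> {1..?n} \<Longrightarrow> differential A (\<phi> l ?j) p - (\<Sum>i=1..?n. M p l i *\<^sub>R \<omega> i p) \<in> ?\<Xi>"
    using bspec[OF all pU] by (auto simp: Let_def)
  have \<omega>_lin: "tlin p (\<omega> m p)" if "m \<in> {1..?n}" for m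
    using cof pU that by (auto simp: one_form_on_def intro: tlin_cotangent)
  have K: "?K = {v \<in> F i p. v x = 0}" by (rule char_flag_inter_eq[OF i ES ind p])
  have \<omega>K: "\<omega> m p v = 0" if "m \<in> {1..?n}" "v \<in> ?K" for m v
  proof -
    have "\<omega> m p \<in> span ((\<lambda>i. \<omega> i p) ` {1..?n})" using that by (intro span_base) auto
    then have "0 + \<omega> m p \<in> annihilator A (char_flag_inter A V ?j) p"
      unfolding sumK using annihilator_zero by blast
    then show ?thesis using annihilatorD(2) that(2) by simp
  qed
  define \<theta> where "\<theta> l v = (differential A (\<phi> l ?j) p - (\<Sum>i=1..?n. M p l i *\<^sub>R \<omega> i p)) v" for l v
  have \<theta>: "v (\<phi> l ?j) = \<theta> l v + (\<Sum>m=1..?n. M p l m * \<omega> m p v)" if "v \<in> T p" for l v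
    using that by (simp add: \<theta>_def differential_def sum_fun_apply scaleR_fun_def)
  have \<theta>\<Xi>: "\<theta> l \<in> ?\<Xi>" if "l \<in> {1..?n}" for l
    using dif[OF that] unfolding \<theta>_def by simp
  show "v (\<phi> l ?j) = 0" if v: "v \<in> F i p" "v x = 0" and l: "1 \<le> l" "l \<le> ?n" for v l
  proof -
    have vK: "v \<in> ?K" using v K by blast
    then have "v \<in> char_flag A V ?j p" by (simp add: char_flag_inter_def)
    then have "\<theta> l v = 0" using annihilatorD(2)[OF \<theta>\<Xi>] l by simp
    moreover have "(\<Sum>m=1..?n. M p l m * \<omega> m p v) = 0" using \<omega>K vK by simp
    moreover have "v \<in> T p" using v(1) F_tangent by blast
    ultimately show ?thesis using \<theta>[of v l] by simp
  qed
  have \<Xi>_span: "\<exists>a. \<forall>v\<in>T p. \<xi> v = (\<Sum>\<zeta>\<in>?I'. a \<zeta> * v (z \<zeta>))" if "\<xi> \<in> ?\<Xi>" for \<xi>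
  proof (rule tlin_dual[OF _ tlin_eval annihilatorD(1)[OF that]])
    show "finite ?I'" by (simp add: finite_zset')
    fix v assume "v \<in> T p" "\<And>\<zeta>. \<zeta> \<in> ?I' \<Longrightarrow> v (z \<zeta>) = 0"
    then have "v \<in> {v \<in> T p. \<forall>\<xi>\<in>?I'. v (z \<xi>) = 0}" by blast
    then have "v \<in> char_flag A V ?j p" using char_flag_eq[OF i ES ind p] by simp
    then show "\<xi> v = 0" by (rule annihilatorD(2)[OF that])
  qed
  \<comment> \<open>\<open>\<alpha>\<close> consists of the known differentials and the \<open>\<omega>\<close>; it spans the annihilator of \<open>?K\<close> and has
    as many members as the dimension of that space, so it is independent.\<close>
  define sel :: "(pp_index \<Rightarrow> real) \<Rightarrow> (nat \<Rightarrow> real) \<Rightarrow> pp_index \<Rightarrow> real"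
    where "sel a c \<zeta> = (case \<zeta> of CX \<Rightarrow> a CX | CZ l j' s \<Rightarrow> if j' = ?j then c l else a \<zeta>)" for a c \<zeta>
  have sel1: "sel a c \<zeta> = a \<zeta>" if "\<zeta> \<in> ?I'" for a c \<zeta>
    using that by (auto simp: sel_def zset'_def split: pp_index.split)
  have sel2: "sel a c (CZ l ?j 0) = c l" for a c l by (simp add: sel_def)
  define \<alpha> where "\<alpha> \<zeta> v = sel (\<lambda>\<zeta>. v (z \<zeta>)) (\<lambda>l. \<omega> l p v) \<zeta>" for \<zeta> v
  have split: "(\<Sum>\<zeta>\<in>insert CX (zset \<tau> i). sel a c \<zeta> * \<alpha> \<zeta> v) =
      (\<Sum>\<zeta>\<in>?I'. a \<zeta> * v (z \<zeta>)) + (\<Sum>l=1..?n. c l * \<omega> l p v)" for a c v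
  proof -
    have "(\<Sum>\<zeta>\<in>?I'. sel a c \<zeta> * \<alpha> \<zeta> v) = (\<Sum>\<zeta>\<in>?I'. a \<zeta> * v (z \<zeta>))"
      by (rule sum.cong) (simp_all add: \<alpha>_def sel1 del: insert_iff)
    moreover have "(\<Sum>l=1..?n. sel a c (CZ l ?j 0) * \<alpha> (CZ l ?j 0) v) = (\<Sum>l=1..?n. c l * \<omega> l p v)"
      by (simp add: \<alpha>_def sel2)
    ultimately show ?thesis using sum_zset_pred[OF jl, of "\<lambda>\<zeta>. sel a c \<zeta> * \<alpha> \<zeta> v"] by simp
  qed
  have \<alpha>_indep: "tindep p (insert CX (zset \<tau> i)) \<alpha>"
  proof (rule tindep_if_spanning)
    show "finite (insert CX (zset \<tau> i))" by (simp add: finite_zset)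
    show "tlin p (\<alpha> \<zeta>)" if "\<zeta> \<in> insert CX (zset \<tau> i)" for \<zeta>
    proof -
      have "\<zeta> \<in> ?I' \<or> (\<exists>l\<in>{1..?n}. \<zeta> = CZ l ?j 0)" using that zset_pred[OF jl] by auto
      then show ?thesis
      proof
        assume "\<zeta> \<in> ?I'"
        then have "\<alpha> \<zeta> = (\<lambda>v. v (z \<zeta>))" unfolding \<alpha>_def using sel1 by blast
        then show ?thesis using tlin_eval by simp
      next
        assume "\<exists>l\<in>{1..?n}. \<zeta> = CZ l ?j 0"
        then obtain l where l: "l \<in> {1..?n}" "\<zeta> = CZ l ?j 0" by blast
        then have "\<alpha> \<zeta> = \<omega> l p" by (simp add: \<alpha>_def sel2 fun_eq_iff)
        then show ?thesis using \<omega>_lin[OF l(1)] by simp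
      qed
    qed
    show KT: "?K \<subseteq> T p" unfolding K using F_tangent by blast
    show "subspace ?K"
      unfolding K using F_subspace[of i p] by (auto simp: subspace_def scaleR_fun_def)
    have "Y p \<in> F i p" using sectionsD(2)[OF V_sections[OF Y_sec]] .
    from tangent_hyperplane_dim[OF F_tangent F_subspace this Yx[OF p]]
    have "dim ?K + 1 = dim (F i p)" by (simp add: K)
    then show "dim ?K + card (insert CX (zset \<tau> i)) = DIM('e)"
      using dim_flag[of i p] i by (simp add: finite_zset card_zset k_def)
    fix \<beta> assume \<beta>: "tlin p \<beta>" "\<And>v. v \<in> ?K \<Longrightarrow> \<beta> v = 0"
    have "(\<lambda>v. if v \<in> T p then \<beta> v else 0) \<in> annihilator A (char_flag_inter A V ?j) p"
      using \<beta> KT by (intro annihilator_restrict) auto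
    then obtain \<xi> \<eta> where \<xi>: "\<xi> \<in> ?\<Xi>" and \<eta>: "\<eta> \<in> span ((\<lambda>i. \<omega> i p) ` {1..?n})"
      and eq: "(\<lambda>v. if v \<in> T p then \<beta> v else 0) = \<xi> + \<eta>" unfolding sumK by blast
    obtain a where a: "\<forall>v\<in>T p. \<xi> v = (\<Sum>\<zeta>\<in>?I'. a \<zeta> * v (z \<zeta>))" using \<Xi>_span[OF \<xi>] by blast
    obtain c where c: "\<eta> = (\<Sum>l=1..?n. c l *\<^sub>R \<omega> l p)"
      using span_image_obtain_coeffs[OF _ \<eta>] by auto
    have "\<beta> v = (\<Sum>\<zeta>\<in>insert CX (zset \<tau> i). sel a c \<zeta> * \<alpha> \<zeta> v)" if "v \<in> T p" for v
    proof -
      have "\<beta> v = \<xi> v + \<eta> v" using fun_cong[OF eq, of v] that by simp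
      also have "\<eta> v = (\<Sum>l=1..?n. c l * \<omega> l p v)" by (simp add: c sum_fun_apply scaleR_fun_def)
      finally show ?thesis unfolding split using a that by simp
    qed
    then show "\<exists>a. \<forall>v\<in>T p. \<beta> v = (\<Sum>\<zeta>\<in>insert CX (zset \<tau> i). a \<zeta> * \<alpha> \<zeta> v)" by blast
  qed
  show "tindep p (insert CX (zset \<tau> i)) dz"
    unfolding tindep_def
  proof (intro allI impI)
    fix a assume a: "\<forall>v\<in>T p. (\<Sum>\<zeta>\<in>insert CX (zset \<tau> i). a \<zeta> * v (z \<zeta>)) = 0"
    have "\<forall>l\<in>{1..?n}. \<exists>d. \<forall>v\<in>T p. \<theta> l v = (\<Sum>\<zeta>\<in>?I'. d \<zeta> * v (z \<zeta>))"
      using \<Xi>_span \<theta>\<Xi> by blast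
    then obtain d where d: "\<And>l v. l \<in> {1..?n} \<Longrightarrow> v \<in> T p \<Longrightarrow> \<theta> l v = (\<Sum>\<zeta>\<in>?I'. d l \<zeta> * v (z \<zeta>))"
      by metis
    \<comment> \<open>Substituting \<open>d\<phi> = \<theta> + M \<omega>\<close>, with
      \<open>\<theta>\<close> expanded by \<open>d\<close> in the known differentials, turns a
      relation among the \<open>dz\<close> into one among the independent \<open>\<alpha>\<close>:
      the known coefficients become \<open>a'\<close>, and those of \<open>\<omega>\<close> become
      the row vector \<open>c = b M\<close>.\<close>
    define b where "b l = a (CZ l ?j 0)" for l
    define a' where "a' \<zeta> = a \<zeta> + (\<Sum>l=1..?n. b l * d l \<zeta>)" for \<zeta>
    define c where "c m = (\<Sum>l=1..?n. b l * M p l m)" for m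
    have "(\<Sum>\<zeta>\<in>insert CX (zset \<tau> i). sel a' c \<zeta> * \<alpha> \<zeta> v) = 0" if v: "v \<in> T p" for v
    proof -
      have "(\<Sum>l=1..?n. b l * v (\<phi> l ?j)) =
          (\<Sum>l=1..?n. (\<Sum>\<zeta>\<in>?I'. b l * d l \<zeta> * v (z \<zeta>)) + (\<Sum>m=1..?n. b l * M p l m * \<omega> m p v))"
      proof (rule sum.cong[OF refl])
        fix l assume l: "l \<in> {1..?n}"
        show "b l * v (\<phi> l ?j) = (\<Sum>\<zeta>\<in>?I'. b l * d l \<zeta> * v (z \<zeta>)) + (\<Sum>m=1..?n. b l * M p l m * \<omega> m p v)"
          unfolding \<theta>[OF v] d[OF l v] by (simp only: distrib_left sum_distrib_left mult.assoc)
      qed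
      also have "\<dots> = (\<Sum>\<zeta>\<in>?I'. (\<Sum>l=1..?n. b l * d l \<zeta>) * v (z \<zeta>)) + (\<Sum>m=1..?n. c m * \<omega> m p v)"
        unfolding sum.distrib c_def sum_distrib_right
        by (intro arg_cong2[where f = "(+)"] sum.swap)
      finally have "(\<Sum>l=1..?n. b l * v (\<phi> l ?j)) =
        (\<Sum>\<zeta>\<in>?I'. (\<Sum>l=1..?n. b l * d l \<zeta>) * v (z \<zeta>)) + (\<Sum>m=1..?n. c m * \<omega> m p v)" .
      moreover have "(\<Sum>\<zeta>\<in>?I'. a \<zeta> * v (z \<zeta>)) + (\<Sum>l=1..?n. b l * v (\<phi> l ?j)) = 0"
        using bspec[OF a v] sum_zset_pred[OF jl, of "\<lambda>\<zeta>. a \<zeta> * v (z \<zeta>)"] by (simp add: b_def)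
      ultimately show ?thesis
        unfolding split a'_def by (simp only: distrib_right sum.distrib)
    qed
    note zero = tindepD[OF \<alpha>_indep this]
    have inI: "CZ m ?j 0 \<in> insert CX (zset \<tau> i)" if "m \<in> {1..?n}" for m
      using that zset_pred[OF jl] by auto
    have c0: "c m = 0" if "m \<in> {1..?n}" for m
      using zero[OF _ inI[OF that]] by (simp add: sel2)
    \<comment> \<open>\<open>b M = 0\<close> with \<open>M\<close> invertible; from here only the
      already independent differentials are left in the relation.\<close>
    have b0: "b l = 0" if "l \<in> {1..?n}" for l
      by (rule ndet_nonzero_rows_indep[OF det _ that]) (use c0 in \<open>simp add: c_def\<close>)
    have "(\<Sum>\<zeta>\<in>?I'. a \<zeta> * v (z \<zeta>)) = 0" if "v \<in> T p" for v
    proof -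
      have "(\<Sum>l=1..?n. a (CZ l ?j 0) * v (z (CZ l ?j 0))) = 0"
        using b0 by (intro sum.neutral) (auto simp: b_def)
      then show ?thesis using bspec[OF a that] sum_zset_pred[OF jl, of "\<lambda>\<zeta>. a \<zeta> * v (z \<zeta>)"] by simp
    qed
    from tindepD[OF ind[OF p] this] have a0: "a \<zeta> = 0" if "\<zeta> \<in> ?I'" for \<zeta> using that by blast
    show "\<forall>\<zeta>\<in>insert CX (zset \<tau> i). a \<zeta> = 0"
      using a0 b0 zset_pred[OF jl] by (auto simp: b_def)
  qed
qed

text \<open>Level \<open>i + 2\<close> serves to make the differentials of
  \<open>zset' \<tau> (Suc i)\<close> independent. These determine the Cauchy bundle at level
  \<open>i + 1\<close>, and with the fundamental functions of order \<open>i + 1\<close> they make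
  up level \<open>i\<close>.\<close>

lemma adapted_step:
  assumes i: "Suc i < k" and ES: "adapted (Suc i)" and ESS: "adapted (Suc (Suc i))"
  shows "adapted i"
proof -
  have ind: "tindep p (insert CX (zset' \<tau> (Suc i))) dz" if "p \<in> W" for p
    using indep_zset'[OF i ES ESS that] .
  have jl: "1 \<le> Suc i" "Suc i \<le> length \<tau>" using i by (auto simp: k_def)
  note zp = zset_pred[OF jl, simplified]
  show ?thesis
  proof (rule adaptedI)
    show "i \<le> k" using i by simp
    fix p assume p: "p \<in> W"
    show "tindep p (insert CX (zset \<tau> i)) dz"
    proof (cases "rho \<tau> (Suc i) = 0")
      case True
      \<comment> \<open>With no fundamental functions of this order there is nothing to
        adjoin.\<close>
      then have "zset \<tau> i = zset' \<tau> (Suc i)" using zp by simp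
      then show ?thesis using ind[OF p] by simp
    next
      case False
      then show ?thesis using lower_step(1)[OF i ES _ ind p] by simp
    qed
    fix v \<xi> assume v: "v \<in> F i p" "v x = 0" and \<xi>: "\<xi> \<in> zset \<tau> i"
    then consider "\<xi> \<in> zset' \<tau> (Suc i)" | l where "1 \<le> l" "l \<le> rho \<tau> (Suc i)" "\<xi> = CZ l (Suc i) 0"
      using zp by auto
    then show "v (z \<xi>) = 0"
    proof cases
      case 1
      then show ?thesis using P_kills_zset'[OF i ES p v] by blast
    next
      case 2
      then have "0 < rho \<tau> (Suc i)" by linarith
      from lower_step(2)[OF i ES this ind p v 2(1,2)] show ?thesis by (simp add: 2(3))
    qed
  qed
qed

text \<open>The induction runs on pairs of neighbouring levels. The last pair \<open>0, 1\<close>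
  gives the shape of \<open>V\<close> and, through \<open>indep_zset'\<close>, the independence of
  the full coordinate system, including the top \<open>dz_j\<close>, which lie in
  \<open>zset' \<tau> 0\<close> but not in \<open>zset \<tau> 0\<close>.\<close>

lemma adapted_zero: "adapted 0" "p \<in> W \<Longrightarrow> tindep p (pp_indices \<tau>) dz"
proof -
  have "adapted i \<and> adapted (Suc i)" if "i \<le> k - 1" for i
    using that
  proof (induction rule: inc_induct)
    case base
    then show ?case using adapted_pred_top adapted_top k_pos by simp
  next
    case (step n)
    then show ?case using adapted_step[of n] by simp
  qed
  then have 01: "adapted 0" "adapted (Suc 0)" by auto
  then show "adapted 0" by simp
  show "tindep p (pp_indices \<tau>) dz" if "p \<in> W"
    unfolding pp_indices_zset' using k_pos by (intro indep_zset' 01 that) auto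
qed

lemma V_eq: "p \<in> W \<Longrightarrow> V p = {v \<in> T p. \<forall>\<xi>\<in>zset \<tau> 0. contact_form p \<xi> v = 0}"
  using adaptedD(2)[OF adapted_zero(1)] by (simp add: derived_flag_0)

end

section \<open>Contact coordinates\<close>

context manifold
begin

text \<open>The functions, labelled by the basis through \<open>\<beta>\<close>, form a map
  \<open>\<Phi>\<close> from a chart into \<open>'e\<close>; their independence makes its derivative
  injective. The local inverse supplies the new chart, whose compatibility with every atlas chart
  comes from smoothness of \<open>g\<close> and of the functions themselves.\<close>

lemma independent_functions_chart:
  fixes f :: "'i \<Rightarrow> 'm \<Rightarrow> real" and \<beta> :: "'i \<Rightarrow> 'e"
  assumes W: "open W" "p \<in> W" and \<beta>: "bij_betw \<beta> I Basis"
    and sm: "\<And>i. i \<in> I \<Longrightarrow> smooth_fun_on A W (f i)"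
    and ind: "tindep p I (\<lambda>i v. v (f i))"
  obtains c where "admissible_chart A c" "p \<in> fst c" "fst c \<subseteq> W"
    "\<And>q i. q \<in> fst c \<Longrightarrow> i \<in> I \<Longrightarrow> snd c q \<bullet> \<beta> i = f i q"
proof -
  have fin: "finite I" using bij_betw_finite[OF \<beta>] by simp
  have cardI: "card I = DIM('e)" using bij_betw_same_card[OF \<beta>] by simp
  have \<beta>B: "\<beta> i \<in> Basis" if "i \<in> I" for i using \<beta> that by (auto simp: bij_betw_def)
  have \<beta>inner: "(\<Sum>i\<in>I. g i *\<^sub>R \<beta> i) \<bullet> \<beta> j = g j" if "j \<in> I" for g j
  proof -
    have "(\<Sum>i\<in>I. g i *\<^sub>R \<beta> i) \<bullet> \<beta> j = (\<Sum>i\<in>I. if i = j then g j else 0)"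
      unfolding inner_sum_left
    proof (rule sum.cong[OF refl])
      fix i assume "i \<in> I"
      moreover have "\<beta> i = \<beta> j \<longleftrightarrow> i = j" using \<beta> that \<open>i \<in> I\<close> by (auto simp: bij_betw_def inj_on_def)
      ultimately show "(g i *\<^sub>R \<beta> i) \<bullet> \<beta> j = (if i = j then g j else 0)"
        using \<beta>B that by (simp add: inner_Basis)
    qed
    then show ?thesis using that fin by simp
  qed
  obtain c where c: "c \<in> A" "p \<in> fst c" by (rule atlas_cover)
  note ad = atlas_admissible[OF c(1)] and ch = atlas_chart[OF c(1)]
  define S where "S = snd c ` (fst c \<inter> W)"
  have S: "open S" using is_chart_open_image[OF ch W(1)] by (simp add: S_def)
  define \<Phi> where "\<Phi> y = (\<Sum>i\<in>I. f i (chart_inv c y) *\<^sub>R \<beta> i)" for y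
  have fs: "smooth_on S (\<lambda>y. f i (chart_inv c y))" if "i \<in> I" for i
    using smooth_fun_onD[OF sm[OF that] c(1)] by (simp add: S_def)
  have \<Phi>: "smooth_on S \<Phi>"
    unfolding \<Phi>_def by (intro smooth_on_sum smooth_on_scaleR smooth_on_const fs S)
  have y0: "snd c p \<in> S" using c W by (simp add: S_def)
  define w where "w i = (\<Sum>b\<in>Basis. frechet_derivative (f i \<circ> chart_inv c) (at (snd c p)) b *\<^sub>R b)" for i
  have w: "coord_vec A c p u (f i) = w i \<bullet> u" if "i \<in> I" for i u
    unfolding w_def using that W by (intro coord_vec_gradient[OF ad c(2)] smooth_nearI[OF sm]) auto
  have "indep_family I w"
    using ind tindep_representation[OF ad c(2), of I "\<lambda>i v. v (f i)" w] w by simp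
  \<comment> \<open>There are \<open>DIM('e)\<close> independent gradients, so only the zero vector
    is orthogonal to all of them.\<close>
  then have "dim {v. \<forall>i\<in>I. w i \<bullet> v = 0} = 0"
    using dim_orthogonal_family[where I = I and w = w] indep_family_dim[OF fin, of w] cardI by simp
  then have w0: "u = 0" if "\<And>i. i \<in> I \<Longrightarrow> w i \<bullet> u = 0" for u
    using that by (auto simp: dim_eq_0)
  have lin: "linear (frechet_derivative \<Phi> (at (snd c p)))"
    by (rule smooth_on_frechet_linear[OF S \<Phi> y0])
  have "inj (frechet_derivative \<Phi> (at (snd c p)))"
  proof (subst linear_injective_0[OF lin], intro allI impI)
    fix u assume u: "frechet_derivative \<Phi> (at (snd c p)) u = 0"
    have "w i \<bullet> u = 0" if i: "i \<in> I" for i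
    proof -
      have "((\<lambda>y. \<Phi> y \<bullet> \<beta> i) has_derivative (\<lambda>v. frechet_derivative \<Phi> (at (snd c p)) v \<bullet> \<beta> i)) (at (snd c p))"
        by (intro has_derivative_inner_left smooth_on_has_derivative[OF S \<Phi> y0])
      then have "((f i \<circ> chart_inv c) has_derivative (\<lambda>v. frechet_derivative \<Phi> (at (snd c p)) v \<bullet> \<beta> i)) (at (snd c p))"
        unfolding \<Phi>_def \<beta>inner[OF i] comp_def .
      from frechet_derivative_at[OF this]
      have "frechet_derivative (f i \<circ> chart_inv c) (at (snd c p)) u = 0" using u by (metis inner_zero_left)
      then have "coord_vec A c p u (f i) = 0" using smooth_nearI[OF sm[OF i] W(2)] by (simp add: coord_vec_smooth)
      then show ?thesis using w[OF i] by simp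
    qed
    then show "u = 0" by (rule w0)
  qed
  from smooth_local_diffeomorphism[OF S \<Phi> y0 this]
  obtain U T' g where U: "open U" "U \<subseteq> S" "snd c p \<in> U" "open T'" "homeomorphism U T' \<Phi> g" "smooth_on T' g"
    by metis
  define N where "N = fst c \<inter> snd c -` U"
  define h where "h q = (\<Sum>i\<in>I. f i q *\<^sub>R \<beta> i)" for q
  define d where "d = (N, h)"
  have NW: "N \<subseteq> W"
  proof
    fix q assume q: "q \<in> N"
    then obtain q' where q': "q' \<in> fst c" "q' \<in> W" "snd c q = snd c q'" using U(2) by (auto simp: N_def S_def)
    then have "q = q'" using is_chartD(5)[OF ch] q by (metis IntD1 N_def)
    then show "q \<in> W" using q' by simp
  qed
  have Nop: "open N" unfolding N_def by (rule is_chart_open_preimage[OF ch U(1)])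
  have cN: "snd c ` N = U"
    using U(2) by (auto simp: N_def S_def)
  have h\<Phi>: "h q = \<Phi> (snd c q)" if "q \<in> fst c" for q
    using is_chartD(5)[OF ch that] by (simp add: h_def \<Phi>_def)
  have "homeomorphism (fst c) (snd c ` fst c) (snd c) (chart_inv c)" using ch by (simp add: is_chart_def)
  then have "homeomorphism N U (snd c) (chart_inv c)"
    by (rule homeomorphism_of_subsets) (use cN in \<open>auto simp: N_def\<close>)
  from homeomorphism_compose[OF this U(5)]
  have hom0: "homeomorphism N T' (\<Phi> \<circ> snd c) (chart_inv c \<circ> g)" .
  have hN: "h ` N = T'"
    using hom0 h\<Phi> by (force simp: homeomorphism_def N_def)
  \<comment> \<open>\<open>chart_inv d\<close> is a chosen inverse of \<open>h\<close> on
    \<open>N\<close>; injectivity identifies it with the explicit smooth one.\<close>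
  have ginv: "(chart_inv c \<circ> g) y = chart_inv d y" if y: "y \<in> T'" for y
  proof -
    have q: "(chart_inv c \<circ> g) y \<in> N" using hom0 y by (auto simp: homeomorphism_def)
    have "h ((chart_inv c \<circ> g) y) = y"
      using hom0 y h\<Phi> q by (auto simp: homeomorphism_def N_def)
    moreover have "inj_on h N"
      using hom0 h\<Phi> by (intro inj_on_inverseI[of _ "chart_inv c \<circ> g"]) (auto simp: homeomorphism_def N_def)
    ultimately show ?thesis using q by (metis chart_inv_def d_def fst_conv snd_conv inv_into_f_f)
  qed
  have hom: "homeomorphism N T' h (chart_inv d)"
  proof (rule homeomorphism_cong[OF hom0])
    show "h q = (\<Phi> \<circ> snd c) q" if "q \<in> N" for q using that h\<Phi> by (simp add: N_def)
    show "chart_inv d y = (chart_inv c \<circ> g) y" if "y \<in> T'" for y using ginv[OF that] by simp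
  qed auto
  have dch: "is_chart d"
    unfolding is_chart_def d_def using Nop U(4) hN hom by (simp add: d_def)
  have dadm: "admissible_chart A d"
    unfolding admissible_chart_def
  proof (intro conjI ballI dch)
    fix e assume e: "e \<in> A"
    note ech = atlas_chart[OF e]
    show "compatible d e"
      unfolding compatible_def
    proof
      have o: "open (snd d ` (fst d \<inter> fst e))" using is_chart_open_image[OF dch is_chartD(1)[OF ech]] .
      have img: "y \<in> T'" "chart_inv c (g y) \<in> fst e" "g y \<in> U" if y: "y \<in> snd d ` (fst d \<inter> fst e)" for y
      proof -
        show yT: "y \<in> T'" using y hN by (auto simp: d_def)
        show "chart_inv c (g y) \<in> fst e"
          using is_chart_image_inv(2)[OF dch y] ginv[OF yT] by simp
        show "g y \<in> U" using yT U(5) by (auto simp: homeomorphism_def)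
      qed
      show "smooth_on (snd d ` (fst d \<inter> fst e)) (snd e \<circ> chart_inv d)"
      proof (rule smooth_on_cong[OF o])
        show "smooth_on (snd d ` (fst d \<inter> fst e)) (\<lambda>y. (snd e \<circ> chart_inv c) (g y))"
        proof (rule smooth_on_compose[OF o is_chart_open_image[OF ch is_chartD(1)[OF ech]] _ _ transition_smooth(1)[OF ad e]])
          show "g ` (snd d ` (fst d \<inter> fst e)) \<subseteq> snd c ` (fst c \<inter> fst e)"
          proof
            fix t assume "t \<in> g ` (snd d ` (fst d \<inter> fst e))"
            then obtain y where y: "y \<in> snd d ` (fst d \<inter> fst e)" "t = g y" by blast
            have gU: "g y \<in> snd c ` fst c" using img(3)[OF y(1)] U(2) by (auto simp: S_def)
            have "chart_inv c (g y) \<in> fst c \<inter> fst e" "snd c (chart_inv c (g y)) = g y"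
              using is_chartD(6,7)[OF ch gU] img(2)[OF y(1)] by auto
            then show "t \<in> snd c ` (fst c \<inter> fst e)" using y(2) by (metis imageI)
          qed
          show "smooth_on (snd d ` (fst d \<inter> fst e)) g"
            by (rule smooth_on_subset[OF U(6)]) (use img in blast)
        qed
        show "(snd e \<circ> chart_inv c) (g y) = (snd e \<circ> chart_inv d) y" if "y \<in> snd d ` (fst d \<inter> fst e)" for y
          using ginv[OF img(1)[OF that]] by simp
      qed
      have o': "open (snd e ` (fst d \<inter> fst e))"
        using is_chart_open_image[OF ech is_chartD(1)[OF dch]] by (simp add: Int_commute)
      have "smooth_on (snd e ` (fst d \<inter> fst e)) (\<lambda>y. f i (chart_inv e y))" if "i \<in> I" for i
        by (rule smooth_on_subset[OF smooth_fun_onD[OF sm[OF that] e]]) (use NW in \<open>auto simp: d_def\<close>)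
      then have "smooth_on (snd e ` (fst d \<inter> fst e)) (\<lambda>y. \<Sum>i\<in>I. f i (chart_inv e y) *\<^sub>R \<beta> i)"
        by (intro smooth_on_sum smooth_on_scaleR smooth_on_const o')
      then show "smooth_on (snd e ` (fst d \<inter> fst e)) (snd d \<circ> chart_inv e)"
        by (simp add: d_def h_def comp_def)
    qed
  qed
  have "p \<in> fst d" using c U(3) by (simp add: d_def N_def)
  moreover have "fst d \<subseteq> W" using NW by (simp add: d_def)
  moreover have "snd d q \<bullet> \<beta> i = f i q" if "i \<in> I" for q i
    using \<beta>inner[OF that] by (simp add: d_def h_def)
  ultimately show ?thesis using that[OF dadm] by blast
qed

lemma chart_coordinate_basis:
  assumes "admissible_chart A c" "q \<in> fst c" "bij_betw \<beta> I Basis"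
    and "\<And>q' i. q' \<in> fst c \<Longrightarrow> i \<in> I \<Longrightarrow> snd c q' \<bullet> \<beta> i = f i q'"
  shows "i \<in> I \<Longrightarrow> j \<in> I \<Longrightarrow> coord_vec A c q (\<beta> i) (f j) = (if i = j then 1 else 0)"
    and "v \<in> T q \<Longrightarrow> v = (\<Sum>i\<in>I. v (f i) *\<^sub>R coord_vec A c q (\<beta> i))"
proof -
  have co: "coord_vec A c q u (f i) = u \<bullet> \<beta> i" if "i \<in> I" for u i
  proof -
    have "coord_vec A c q u (f i) = coord_vec A c q u (\<lambda>q'. snd c q' \<bullet> \<beta> i)"
      by (rule tangent_cong[OF coord_vec_in_tangent[OF assms(1,2)] is_chartD(1)[OF admissible_is_chart[OF assms(1)]] assms(2)])
         (simp add: assms(4) that)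
    then show ?thesis by (simp add: coord_vec_coordinate[OF assms(1,2)])
  qed
  show "coord_vec A c q (\<beta> i) (f j) = (if i = j then 1 else 0)" if "i \<in> I" "j \<in> I" for i j
  proof -
    have "\<beta> i = \<beta> j \<longleftrightarrow> i = j" "\<beta> i \<in> Basis" "\<beta> j \<in> Basis"
      using assms(3) that by (auto simp: bij_betw_def inj_on_def)
    then show ?thesis using co[OF that(2)] by (simp add: inner_Basis)
  qed
  show "v = (\<Sum>i\<in>I. v (f i) *\<^sub>R coord_vec A c q (\<beta> i))" if vT: "v \<in> T q" for v
  proof -
    note lin = coord_vec_linear[OF assms(1,2)]
    obtain u where u: "v = coord_vec A c q u" using vT tangent_space_chart[OF assms(1,2)] by auto
    have "u = (\<Sum>b\<in>Basis. (u \<bullet> b) *\<^sub>R b)" by (simp add: euclidean_representation)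
    also have "\<dots> = (\<Sum>i\<in>I. (u \<bullet> \<beta> i) *\<^sub>R \<beta> i)"
      by (rule sum.reindex_bij_betw[OF assms(3), symmetric])
    finally have "v = coord_vec A c q (\<Sum>i\<in>I. (u \<bullet> \<beta> i) *\<^sub>R \<beta> i)" using u by simp
    also have "\<dots> = (\<Sum>i\<in>I. (u \<bullet> \<beta> i) *\<^sub>R coord_vec A c q (\<beta> i))"
      by (simp add: linear_sum[OF lin] linear_scale[OF lin])
    also have "\<dots> = (\<Sum>i\<in>I. v (f i) *\<^sub>R coord_vec A c q (\<beta> i))"
      by (rule sum.cong) (simp_all add: u co)
    finally show ?thesis .
  qed
qed

end

lemma sum_zset_0:
  "(\<Sum>j=1..length \<tau>. \<Sum>l=1..rho \<tau> j. \<Sum>h<j. f (CZ l j h)) = (\<Sum>\<xi>\<in>zset \<tau> 0. f \<xi>)"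
  for f :: "pp_index \<Rightarrow> 'b::comm_monoid_add"
proof -
  let ?S = "SIGMA j:{Suc 0..length \<tau>}. {1..rho \<tau> j} \<times> {..<j - 0}"
  have "(\<Sum>\<xi>\<in>zset \<tau> 0. f \<xi>) = (\<Sum>(j, l, s)\<in>?S. f (CZ l j s))"
    unfolding zset_image by (subst sum.reindex) (auto simp: inj_on_def case_prod_unfold comp_def intro!: sum.cong)
  also have "\<dots> = (\<Sum>j=1..length \<tau>. \<Sum>(l, s)\<in>{1..rho \<tau> j} \<times> {..<j}. f (CZ l j s))"
    by (subst sum.Sigma[symmetric]) (auto simp: case_prod_unfold)
  also have "\<dots> = (\<Sum>j=1..length \<tau>. \<Sum>l=1..rho \<tau> j. \<Sum>h<j. f (CZ l j h))"
    by (simp add: sum.cartesian_product)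
  finally show ?thesis ..
qed

text \<open>In coordinates dual to the \<open>z\<close>, the total derivative \<open>X\<close> and
  the top coordinate fields are killed by all contact forms. Conversely those equations fix all
  lower components of \<open>v\<close> as multiples of \<open>v x\<close>, so \<open>v\<close> is
  \<open>v x\<close> times \<open>X\<close> plus a combination of top fields.\<close>

lemma (in prolongation) V_contact:
  assumes c: "admissible_chart A c" "fst c \<subseteq> W" and q: "q \<in> fst c"
    and \<beta>: "bij_betw \<beta> (pp_indices \<tau>) Basis"
    and co: "\<And>q i. q \<in> fst c \<Longrightarrow> i \<in> pp_indices \<tau> \<Longrightarrow> snd c q \<bullet> \<beta> i = z i q"
  shows "V q = contact_distribution A c \<tau> \<beta> q"
proof -
  let ?e = "\<lambda>i. coord_vec A c q (\<beta> i)"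
  have qW: "q \<in> W" using c q by blast
  have e: "?e i (z j) = (if i = j then 1 else 0)" if "i \<in> pp_indices \<tau>" "j \<in> pp_indices \<tau>" for i j
    by (rule chart_coordinate_basis(1)[OF c(1) q \<beta> co that])
  have eT: "?e i \<in> T q" for i by (rule coord_vec_in_tangent[OF c(1) q])
  have sub: "zset \<tau> 0 \<subseteq> pp_indices \<tau>" "CX \<in> pp_indices \<tau>" unfolding pp_indices_zset' using zset_subsets(1) by auto
  have subup: "up \<xi> \<in> pp_indices \<tau>" if "\<xi> \<in> zset \<tau> 0" for \<xi> unfolding pp_indices_zset' using up_zset[OF that] by simp
  define X where "X = ?e CX + (\<Sum>\<xi>\<in>zset \<tau> 0. z (up \<xi>) q *\<^sub>R ?e \<xi>)"
  let ?G = "{?e (CZ l j j) | l j. 1 \<le> j \<and> j \<le> length \<tau> \<and> 1 \<le> l \<and> l \<le> rho \<tau> j}"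
  have "(\<Sum>j=1..length \<tau>. \<Sum>l=1..rho \<tau> j. \<Sum>h<j. (snd c q \<bullet> \<beta> (CZ l j (Suc h))) *\<^sub>R ?e (CZ l j h)) =
    (\<Sum>\<xi>\<in>zset \<tau> 0. (snd c q \<bullet> \<beta> (up \<xi>)) *\<^sub>R ?e \<xi>)"
    using sum_zset_0[of "\<lambda>\<xi>. (snd c q \<bullet> \<beta> (up \<xi>)) *\<^sub>R ?e \<xi>" \<tau>] by simp
  also have "\<dots> = (\<Sum>\<xi>\<in>zset \<tau> 0. z (up \<xi>) q *\<^sub>R ?e \<xi>)"
    by (rule sum.cong) (simp_all add: co[OF q] subup)
  finally have cd: "contact_distribution A c \<tau> \<beta> q = span (insert X ?G)"
    by (simp add: contact_distribution_def X_def)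
  have Xe: "X (z i) = (if i = CX then 1 else if i \<in> zset \<tau> 0 then z (up i) q else 0)" if i: "i \<in> pp_indices \<tau>" for i
  proof -
    have "X (z i) = ?e CX (z i) + (\<Sum>\<xi>\<in>zset \<tau> 0. z (up \<xi>) q * ?e \<xi> (z i))"
      by (simp add: X_def sum_fun_apply scaleR_fun_def)
    also have "(\<Sum>\<xi>\<in>zset \<tau> 0. z (up \<xi>) q * ?e \<xi> (z i)) = (\<Sum>\<xi>\<in>zset \<tau> 0. if \<xi> = i then z (up i) q else 0)"
      by (rule sum.cong) (use e i sub in auto)
    finally show ?thesis using e[OF sub(2) i] by (auto simp: finite_zset)
  qed
  have Veq: "V q = {v \<in> T q. \<forall>\<xi>\<in>zset \<tau> 0. contact_form q \<xi> v = 0}" by (rule V_eq[OF qW])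
  have Vsub: "subspace (V q)" using F_subspace[of 0 q] by (simp add: derived_flag_0)
  have z_CX: "z CX = x" by simp
  show ?thesis
  proof
    show "contact_distribution A c \<tau> \<beta> q \<subseteq> V q"
      unfolding cd
    proof (rule span_minimal[OF _ Vsub], rule insert_subsetI)
      have "X \<in> T q" unfolding X_def by (intro subspace_add[OF tangent_subspace] subspace_sum[OF tangent_subspace] subspace_scale[OF tangent_subspace] eT)
      moreover have "contact_form q \<xi> X = 0" if "\<xi> \<in> zset \<tau> 0" for \<xi>
      proof -
        have "\<xi> \<in> pp_indices \<tau>" "\<xi> \<noteq> CX" using that sub(1) by auto
        then show ?thesis using Xe[of \<xi>] Xe[OF sub(2)] that by (simp add: contact_form_def)
      qed
      ultimately show "X \<in> V q" unfolding Veq by blast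
      show "?G \<subseteq> V q"
      proof
        fix v assume "v \<in> ?G"
        then obtain l j where lj: "v = ?e (CZ l j j)" "1 \<le> j" "j \<le> length \<tau>" "1 \<le> l" "l \<le> rho \<tau> j" by blast
        have I: "CZ l j j \<in> pp_indices \<tau>" using lj by (simp add: pp_indices_def)
        have n: "CZ l j j \<notin> zset \<tau> 0" by (simp add: zset_def)
        have "contact_form q \<xi> v = 0" if "\<xi> \<in> zset \<tau> 0" for \<xi>
          using e[OF I, of \<xi>] e[OF I, of CX] that sub n by (auto simp: contact_form_def lj(1))
        then show "v \<in> V q" unfolding Veq using eT lj(1) by blast
      qed
    qed
    show "V q \<subseteq> contact_distribution A c \<tau> \<beta> q"
    proof
      fix v assume v: "v \<in> V q"
      then have vT: "v \<in> T q" and vth: "\<And>\<xi>. \<xi> \<in> zset \<tau> 0 \<Longrightarrow> v (z \<xi>) = z (up \<xi>) q * v x"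
        unfolding Veq by (auto simp: contact_form_def)
      have "v = (\<Sum>i\<in>insert CX (zset' \<tau> 0). v (z i) *\<^sub>R ?e i)"
        using chart_coordinate_basis(2)[OF c(1) q \<beta> co vT] by (simp add: pp_indices_zset'[symmetric])
      \<comment> \<open>The indices in \<open>zset \<tau> 0 - zset \<tau> (Suc 0)\<close> have
        \<open>s + 1 = j\<close>, so their successors are the top coordinates.\<close>
      also have "\<dots> = (v x *\<^sub>R ?e CX + (\<Sum>\<xi>\<in>zset \<tau> 0. v (z \<xi>) *\<^sub>R ?e \<xi>)) +
          (\<Sum>\<xi>\<in>zset \<tau> 0 - zset \<tau> (Suc 0). v (z (up \<xi>)) *\<^sub>R ?e (up \<xi>))"
        unfolding sum_zset'_split by (simp add: finite_zset)
      also have "v x *\<^sub>R ?e CX + (\<Sum>\<xi>\<in>zset \<tau> 0. v (z \<xi>) *\<^sub>R ?e \<xi>) = v x *\<^sub>R X"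
        by (simp add: X_def scaleR_add_right scaleR_sum_right vth mult.commute)
      finally have eq: "v = v x *\<^sub>R X + (\<Sum>\<xi>\<in>zset \<tau> 0 - zset \<tau> (Suc 0). v (z (up \<xi>)) *\<^sub>R ?e (up \<xi>))" .
      have "?e (up \<xi>) \<in> ?G" if \<xi>: "\<xi> \<in> zset \<tau> 0 - zset \<tau> (Suc 0)" for \<xi>
      proof -
        \<comment> \<open>Failing to lie in \<open>zset \<tau> (Suc 0)\<close> has two causes; for
          \<open>j \<le> 1\<close> the bounds force \<open>j = 1\<close> and \<open>s = 0\<close>,
          so \<open>Suc s = j\<close> in either case.\<close>
        obtain l j s where x: "\<xi> = CZ l j s" "0 < j" "j \<le> length \<tau>" "1 \<le> l" "l \<le> rho \<tau> j" "s < j" "Suc s = j \<or> j \<le> 1"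
          using \<xi> by (force simp: zset_def)
        then have "up \<xi> = CZ l j j" by auto
        with x show ?thesis by auto
      qed
      then have "v x *\<^sub>R X + (\<Sum>\<xi>\<in>zset \<tau> 0 - zset \<tau> (Suc 0). v (z (up \<xi>)) *\<^sub>R ?e (up \<xi>)) \<in> span (insert X ?G)"
        by (intro span_add span_sum span_scale span_base) auto
      then show "v \<in> contact_distribution A c \<tau> \<beta> q" unfolding cd using eq by metis
    qed
  qed
qed

lemma (in prolongation) contact_coordinates:
  assumes "bij_betw \<beta> (pp_indices \<tau>) (Basis :: 'e set)"
  shows "contact_coordinates_on A V \<tau> W z"
  unfolding contact_coordinates_on_def
proof (intro ballI)
  fix p assume p: "p \<in> W"
  have sm: "smooth_fun_on A W (z i)" if "i \<in> pp_indices \<tau>" for i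
    using that zset_subsets(2) unfolding pp_indices_zset' by (intro smooth_z) blast
  obtain c where c: "admissible_chart A c" "p \<in> fst c" "fst c \<subseteq> W"
    "\<And>q i. q \<in> fst c \<Longrightarrow> i \<in> pp_indices \<tau> \<Longrightarrow> snd c q \<bullet> \<beta> i = z i q"
    using independent_functions_chart[OF W_open p assms sm adapted_zero(2)[OF p]] by metis
  then show "\<exists>c \<beta>. admissible_chart A c \<and> p \<in> fst c \<and> fst c \<subseteq> W \<and> bij_betw \<beta> (pp_indices \<tau>) Basis \<and>
     (\<forall>q\<in>fst c. \<forall>i\<in>pp_indices \<tau>. snd c q \<bullet> \<beta> i = z i q) \<and>
     (\<forall>q\<in>fst c. V q = contact_distribution A c \<tau> \<beta> q)"
    using V_contact[OF c(1,3) _ assms c(4)] assms by (intro exI[of _ c] exI[of _ \<beta>]) auto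
qed

section \<open>A generic section\<close>

context manifold
begin

text \<open>If all sections kill \<open>f\<close> throughout an open set, the functions being
  differentiated in a commutator vanish there, so brackets kill \<open>f\<close> too. An open set is
  essential: vanishing at one point says nothing about brackets.\<close>

lemma flag_kills_on_open:
  assumes "filled V" "open N" "\<And>p v. p \<in> N \<Longrightarrow> v \<in> V p \<Longrightarrow> v f = 0"
    and "smooth_fun_on A N f" "p \<in> N" "v \<in> derived_flag A i V p"
  shows "v f = 0"
  using assms(5,6)
proof (induction i arbitrary: p v)
  case 0
  then show ?case using assms(3) by (simp add: derived_flag_0)
next
  case (Suc i)
  let ?F = "derived_flag A i V"
  have br: "lie_bracket A X X' p f = 0" if X: "X \<in> sections A ?F" and X': "X' \<in> sections A ?F" for X X'
  proof -
    have zero: "Z p (\<lambda>q. Z' q f) = 0" if "Z \<in> sections A ?F" "Z' \<in> sections A ?F" for Z Z'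
    proof -
      have Zp: "Z p \<in> T p" using vector_field_tangent[OF sectionsD(1)[OF that(1)]] by simp
      have "Z p (\<lambda>q. Z' q f) = Z p (\<lambda>q. 0)"
        by (rule tangent_cong[OF Zp assms(2) Suc.prems(1)]) (rule Suc.IH[OF _ sectionsD(2)[OF that(2)]])
      then show ?thesis using tangent_const[OF Zp] by simp
    qed
    show ?thesis using zero[OF X X'] zero[OF X' X] by (simp add: lie_bracket_def)
  qed
  have "subspace {v :: 'm tvec. v f = 0}" by (simp add: subspace_def scaleR_fun_def)
  moreover have "?F p \<union> {lie_bracket A X X' p | X X'. X \<in> sections A ?F \<and> X' \<in> sections A ?F} \<subseteq> {v. v f = 0}"
    using Suc.IH[OF Suc.prems(1)] br by auto
  ultimately have "derived_flag A (Suc i) V p \<subseteq> {v. v f = 0}"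
    unfolding derived_flag_Suc derived_bundle_def by (intro span_minimal)
  then show ?case using Suc.prems(2) by blast
qed

text \<open>A countable generating family in which only finitely many members are nonzero near a
  given point, so that sums with arbitrary constant coefficients define global sections.
  Countability comes from the Lindelof property.\<close>

lemma subbundle_locally_finite_generators:
  assumes "subbundle A r V" "0 < r"
  shows "\<exists>(H :: nat \<Rightarrow> 'm vfield) \<nu>. (\<forall>k. H k \<in> sections A V) \<and>
    (\<forall>p. \<exists>N. open N \<and> p \<in> N \<and> (\<forall>q\<in>N. \<forall>k\<ge>\<nu> p. H k q = 0)) \<and>
    (\<forall>p f. \<forall>v\<in>V p. v f \<noteq> 0 \<longrightarrow> (\<exists>k. H k p f \<noteq> 0))"
proof -
  define P where "P N G g \<longleftrightarrow> open N \<and> smooth_fun_on A UNIV g \<and> (\<forall>q\<in>N. g q = 1) \<and>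
    (\<forall>a<r. G a \<in> sections A V) \<and> (\<forall>q. g q \<noteq> 0 \<longrightarrow> V q = span ((\<lambda>a. G a q) ` {..<r}))"
    for N and G :: "nat \<Rightarrow> 'm vfield" and g
  define \<F> where "\<F> = {N. \<exists>G g. P N G g}"
  have op: "open N" if "N \<in> \<F>" for N using that by (auto simp: \<F>_def P_def)
  obtain \<F>' where F': "\<F>' \<subseteq> \<F>" "countable \<F>'" "\<Union>\<F>' = \<Union>\<F>" using Lindelof[of \<F>] op by metis
  have "p \<in> \<Union>\<F>" for p
  proof -
    obtain N G g where "p \<in> N" "P N G g" using subbundle_global_frame[OF assms(1), of p] unfolding P_def by blast
    then show ?thesis unfolding \<F>_def by blast
  qed
  then have cov: "\<Union>\<F>' = UNIV" using F'(3) by blast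
  then have ne: "\<F>' \<noteq> {}" by auto
  define N where "N n = from_nat_into \<F>' n" for n
  have ranN: "range N = \<F>'" unfolding N_def using range_from_nat_into[OF ne F'(2)] .
  have "\<forall>n. \<exists>G g. P (N n) G g"
  proof
    fix n
    have "N n \<in> \<F>" using F'(1) ranN rangeI[of N n] by blast
    then show "\<exists>G g. P (N n) G g" by (simp add: \<F>_def)
  qed
  then obtain G g where PG: "\<And>n. P (N n) (G n) (g n)" by metis
  have Nop: "open (N n)" and gs: "smooth_fun_on A UNIV (g n)" and g1: "\<And>q. q \<in> N n \<Longrightarrow> g n q = 1"
    and Gs: "\<And>a. a < r \<Longrightarrow> G n a \<in> sections A V"
    and Gspan: "\<And>q. g n q \<noteq> 0 \<Longrightarrow> V q = span ((\<lambda>a. G n a q) ` {..<r})" for n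
    using PG[of n] by (auto simp: P_def)
  have inN: "\<exists>n. p \<in> N n" for p using cov ranN by blast
  \<comment> \<open>Since \<open>g m = 1\<close> on \<open>N m\<close>, the factors \<open>1 - g m\<close> make the family locally finite; the first \<open>n\<close> with
    \<open>g n q \<noteq> 0\<close> gives \<open>\<psi> n q = 1\<close>, so the family still spans.\<close>
  define \<psi> where "\<psi> n q = (\<Prod>m<n. 1 - g m q)" for n q
  have \<psi>0: "\<psi> n q = 0" if "q \<in> N m" "m < n" for n q m
    unfolding \<psi>_def using that g1[OF that(1)] by (intro prod_zero) auto
  have \<psi>s: "smooth_fun_on A UNIV (\<psi> n)" for n
    unfolding \<psi>_def by (intro smooth_fun_on_prod smooth_fun_on_diff smooth_fun_on_const gs open_UNIV)
  \<comment> \<open>The pair of cover index \<open>n\<close> and frame index \<open>a < r\<close> is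
    encoded as \<open>n * r + a\<close>.\<close>
  define H where "H k q = \<psi> (k div r) q *\<^sub>R G (k div r) (k mod r) q" for k q
  \<comment> \<open>If \<open>p\<close> lies in the chosen \<open>N m\<close>, then from
    \<open>(m + 1) * r\<close> on the cover index exceeds \<open>m\<close>, so the factor
    \<open>1 - g m\<close> makes \<open>H\<close> vanish on all of \<open>N m\<close>.\<close>
  define \<nu> where "\<nu> p = Suc (SOME n. p \<in> N n) * r" for p
  have V: "\<And>p. subspace (V p)" using assms by (auto simp: subbundle_def)
  have "H k \<in> sections A V" for k
  proof -
    have "G (k div r) (k mod r) \<in> sections A V" using assms(2) by (intro Gs) simp
    then show ?thesis
      unfolding H_def sections_def using vector_field_scale[OF \<psi>s] V by (simp add: subspace_scale)
  qed
  moreover have "\<exists>M. open M \<and> p \<in> M \<and> (\<forall>q\<in>M. \<forall>k\<ge>\<nu> p. H k q = 0)" for p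
  proof -
    define m where "m = (SOME n. p \<in> N n)"
    have pm: "p \<in> N m" unfolding m_def using inN by (rule someI_ex)
    have "H k q = 0" if "q \<in> N m" "k \<ge> \<nu> p" for q k
    proof -
      have "Suc m \<le> k div r" using that(2) assms(2) unfolding \<nu>_def m_def[symmetric]
        by (metis div_le_mono div_mult_self_is_m)
      then show ?thesis using \<psi>0[OF that(1), of "k div r"] by (simp add: H_def)
    qed
    with pm Nop show ?thesis by blast
  qed
  moreover have "\<exists>k. H k p f \<noteq> 0" if v: "v \<in> V p" "v f \<noteq> 0" for p f v
  proof -
    define n where "n = (LEAST n. g n p \<noteq> 0)"
    have "\<exists>n. g n p \<noteq> 0" using inN[of p] g1 by (metis one_neq_zero)
    then have n: "g n p \<noteq> 0" unfolding n_def by (rule LeastI_ex)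
    have "g m p = 0" if "m < n" for m using not_less_Least[of m "\<lambda>n. g n p \<noteq> 0"] that by (auto simp: n_def)
    then have \<psi>1: "\<psi> n p = 1" by (simp add: \<psi>_def)
    have "\<exists>a<r. G n a p f \<noteq> 0"
    proof (rule ccontr)
      assume "\<not> ?thesis"
      then have "(\<lambda>a. G n a p) ` {..<r} \<subseteq> {v. v f = 0}" by auto
      moreover have "subspace {v :: 'm tvec. v f = 0}" by (simp add: subspace_def scaleR_fun_def)
      ultimately have "V p \<subseteq> {v. v f = 0}" unfolding Gspan[OF n] by (rule span_minimal)
      then show False using v by blast
    qed
    then obtain a where a: "a < r" "G n a p f \<noteq> 0" by blast
    have "H (n * r + a) p f \<noteq> 0" using a \<psi>1 by (simp add: H_def scaleR_fun_def)
    then show ?thesis by blast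
  qed
  ultimately show ?thesis
    by (intro exI[of _ H] exI[of _ \<nu>]) simp
qed

lemma generic_section:
  assumes "subbundle A r V" "open U" "smooth_fun_on A U f"
    and "\<And>N. open N \<Longrightarrow> N \<noteq> {} \<Longrightarrow> N \<subseteq> U \<Longrightarrow> \<exists>p\<in>N. \<exists>v\<in>V p. v f \<noteq> 0"
  shows "\<exists>Y\<in>sections A V. \<forall>N. open N \<longrightarrow> N \<noteq> {} \<longrightarrow> N \<subseteq> U \<longrightarrow> (\<exists>p\<in>N. Y p f \<noteq> 0)"
proof (cases "r = 0")
  case True
  \<comment> \<open>The encoding by \<open>div r\<close> and \<open>mod r\<close> requires
    \<open>r > 0\<close>. In rank 0 the hypothesis leaves no nonempty open subset of
    \<open>U\<close>, and the zero section will do.\<close>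
  have V0: "V p = {0}" for p
  proof -
    obtain N X where "p \<in> N" "\<forall>q\<in>N. V q = span ((\<lambda>i. X i q) ` {..<r})"
    proof -
      have "\<exists>N X. open N \<and> p \<in> N \<and> (\<forall>i<r. vector_field_on A N (X i)) \<and>
          (\<forall>q\<in>N. V q = span ((\<lambda>i. X i q) ` {..<r}))"
        using assms(1) by (simp add: subbundle_def)
      then show ?thesis using that by blast
    qed
    then show ?thesis using True by simp
  qed
  have "N = {}" if "open N" "N \<subseteq> U" for N
    using assms(4)[OF that(1) _ that(2)] by (auto simp: V0)
  moreover have "(\<lambda>p. 0) \<in> sections A V" by (simp add: sections_def vector_field_zero V0)
  ultimately show ?thesis by blast
next
  case False
  have V: "\<And>p. subspace (V p)" using assms(1) by (auto simp: subbundle_def)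
  have "\<exists>(H :: nat \<Rightarrow> 'm vfield) \<nu>. (\<forall>k. H k \<in> sections A V) \<and>
    (\<forall>p. \<exists>N. open N \<and> p \<in> N \<and> (\<forall>q\<in>N. \<forall>k\<ge>\<nu> p. H k q = 0)) \<and>
    (\<forall>p f. \<forall>v\<in>V p. v f \<noteq> 0 \<longrightarrow> (\<exists>k. H k p f \<noteq> 0))"
    using subbundle_locally_finite_generators[OF assms(1)] False by simp
  then obtain H :: "nat \<Rightarrow> 'm vfield" and \<nu> where H0: "\<forall>k. H k \<in> sections A V"
    and lf0: "\<forall>p. \<exists>N. open N \<and> p \<in> N \<and> (\<forall>q\<in>N. \<forall>k\<ge>\<nu> p. H k q = 0)"
    and nz0: "\<forall>p f. \<forall>v\<in>V p. v f \<noteq> 0 \<longrightarrow> (\<exists>k. H k p f \<noteq> 0)"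
    by (elim exE conjE)
  note H = spec[OF H0] and lf = spec[OF lf0]
  have nz: "\<exists>k. H k p f \<noteq> 0" if "v \<in> V p" "v f \<noteq> 0" for p f v
    by (rule mp[OF bspec[OF spec[OF spec[OF nz0]] that(1)] that(2)])
  \<comment> \<open>At each of countably many test points \<open>Ys s _ f\<close> is a nonzero polynomial in \<open>s\<close>, so all but countably
    many \<open>s\<close> will do.\<close>
  define Ys where "Ys s q = (\<Sum>k<\<nu> q. s ^ k *\<^sub>R H k q)" for s :: real and q
  \<comment> \<open>The bound \<open>\<nu> q\<close> jumps with \<open>q\<close>. Any larger bound
    gives the same sum, so near \<open>p\<close> the fixed bound \<open>\<nu> p\<close> can be used
    and smoothness is visible.\<close>
  have Ys_eq: "Ys s q = (\<Sum>k<n. s ^ k *\<^sub>R H k q)" if "\<And>k. k \<ge> n \<Longrightarrow> H k q = 0" for s q n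
  proof -
    have nu: "H k q = 0" if "k \<ge> \<nu> q" for k using lf[of q] that by blast
    have "Ys s q = (\<Sum>k<max n (\<nu> q). s ^ k *\<^sub>R H k q)"
      unfolding Ys_def by (rule sum.mono_neutral_left) (use nu in auto)
    also have "\<dots> = (\<Sum>k<n. s ^ k *\<^sub>R H k q)"
      by (rule sum.mono_neutral_right) (use that in auto)
    finally show ?thesis .
  qed
  have Ys: "Ys s \<in> sections A V" for s
    unfolding sections_def
  proof (intro CollectI conjI allI)
    show "Ys s q \<in> V q" for q
      unfolding Ys_def using sectionsD(2)[OF H] V by (intro subspace_sum subspace_scale) auto
    show "vector_field_on A UNIV (Ys s)"
    proof (rule vector_field_local)
      fix p
      obtain N where N: "open N" "p \<in> N" "\<forall>q\<in>N. \<forall>k\<ge>\<nu> p. H k q = 0" using lf by blast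
      have "vector_field_on A N (\<lambda>q. \<Sum>k<\<nu> p. s ^ k *\<^sub>R H k q)"
        using vector_field_subset[OF sectionsD(1)[OF H]] N(1)
        by (intro vector_field_sum vector_field_scale smooth_fun_on_const) auto
      moreover have "\<forall>q\<in>N. Ys s q = (\<Sum>k<\<nu> p. s ^ k *\<^sub>R H k q)" using N(3) by (intro ballI Ys_eq) auto
      ultimately show "\<exists>N Z. open N \<and> p \<in> N \<and> vector_field_on A N Z \<and> (\<forall>q\<in>N. Ys s q = Z q)"
        using N(1,2) by blast
    qed
  qed
  obtain \<B> :: "'m set set" where B: "countable \<B>" "topological_basis \<B>"
    using ex_countable_basis by blast
  define \<B>' where "\<B>' = {N \<in> \<B>. N \<noteq> {} \<and> N \<subseteq> U}"
  have "\<forall>N\<in>\<B>'. \<exists>p\<in>N. \<exists>v\<in>V p. v f \<noteq> 0"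
    using assms(4) topological_basis_open[OF B(2)] by (auto simp: \<B>'_def)
  then obtain pt where pt: "\<And>N. N \<in> \<B>' \<Longrightarrow> pt N \<in> N \<and> (\<exists>v\<in>V (pt N). v f \<noteq> 0)" by metis
  have fin: "finite {s. Ys s (pt N) f = 0}" if NB: "N \<in> \<B>'" for N
  proof -
    let ?p = "pt N"
    obtain k where k: "H k ?p f \<noteq> 0" using pt[OF NB] nz by blast
    \<comment> \<open>Large enough to contain all nonzero terms at the test point and also the index
      \<open>k\<close> of a nonzero coefficient, so the polynomial in \<open>s\<close> is not the
      zero polynomial.\<close>
    define n where "n = max (\<nu> ?p) k"
    have "Ys s ?p f = (\<Sum>i\<le>n. H i ?p f * s ^ i)" for s
    proof -
      have "Ys s ?p = (\<Sum>k<Suc n. s ^ k *\<^sub>R H k ?p)"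
        using lf[of ?p] by (intro Ys_eq) (auto simp: n_def)
      then show ?thesis by (simp only: sum_fun_apply scaleR_fun_def lessThan_Suc_atMost) (simp add: mult.commute)
    qed
    moreover have "finite {s. (\<Sum>i\<le>n. H i ?p f * s ^ i) = 0}"
      using polyfun_finite_roots[of "\<lambda>i. H i ?p f" n] k by (auto simp: n_def)
    ultimately show ?thesis by simp
  qed
  have "countable (\<Union>N\<in>\<B>'. {s. Ys s (pt N) f = 0})"
    using B(1) fin by (intro countable_UN) (auto simp: \<B>'_def intro: countable_finite)
  then obtain s where s: "s \<notin> (\<Union>N\<in>\<B>'. {s. Ys s (pt N) f = 0})"
    using uncountable_UNIV_real by (metis UNIV_eq_I)
  show ?thesis
  proof (intro bexI[OF _ Ys] allI impI)
    fix N :: "'m set" assume N: "open N" "N \<noteq> {}" "N \<subseteq> U"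
    then obtain p where "p \<in> N" by blast
    with N(1) B(2) obtain N' where N': "N' \<in> \<B>" "p \<in> N'" "N' \<subseteq> N" by (meson topological_basisE)
    then have "N' \<in> \<B>'" using N(3) by (auto simp: \<B>'_def)
    then have "pt N' \<in> N" "Ys s (pt N') f \<noteq> 0" using pt N'(3) s by auto
    then show "\<exists>p\<in>N. Ys s p f \<noteq> 0" by blast
  qed
qed

end

section \<open>Ranks, resolvent bundle and assembly for a Goursat bundle\<close>

section \<open>Goursat bundles\<close>

context manifold
begin

lemma smooth_fun_on_continuous:
  assumes "smooth_fun_on A U f"
  shows "continuous_on U f"
proof -
  have U: "open U" by (rule smooth_fun_on_open[OF assms])
  have "isCont f p" if p: "p \<in> U" for p
  proof -
    obtain c where c: "c \<in> A" "p \<in> fst c" by (rule atlas_cover)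
    note ch = atlas_chart[OF c(1)]
    let ?N = "fst c \<inter> U"
    have N: "open ?N" using is_chartD(1)[OF ch] U by blast
    have "continuous_on (snd c ` ?N) (\<lambda>y. f (chart_inv c y))"
      using smooth_on_continuous[OF smooth_fun_onD[OF assms c(1)]] .
    moreover have "continuous_on ?N (snd c)" using is_chartD(3)[OF ch] by (rule continuous_on_subset) simp
    ultimately have "continuous_on ?N (\<lambda>q. f (chart_inv c (snd c q)))"
      by (rule continuous_on_compose2) simp
    then have "continuous_on ?N f"
      by (rule continuous_on_eq) (simp add: is_chartD(5)[OF ch])
    then show ?thesis using N c p by (simp add: continuous_on_eq_continuous_at)
  qed
  then show ?thesis using U by (simp add: continuous_on_eq_continuous_at)
qed

lemma tindep_differentials:
  assumes "finite I" "inj_on (\<lambda>l. differential A (f l) p) I" "independent ((\<lambda>l. differential A (f l) p) ` I)"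
  shows "tindep p I (\<lambda>l v. v (f l))"
  unfolding tindep_def
proof (intro allI impI)
  fix a assume a: "\<forall>v\<in>T p. (\<Sum>l\<in>I. a l * v (f l)) = 0"
  have "indep_family I (\<lambda>l. differential A (f l) p)"
    using assms by (simp add: indep_family_iff)
  moreover have "(\<Sum>l\<in>I. a l *\<^sub>R differential A (f l) p) = 0"
  proof (rule ext)
    fix v
    show "(\<Sum>l\<in>I. a l *\<^sub>R differential A (f l) p) v = 0 v"
      using a by (cases "v \<in> T p") (simp_all add: sum_fun_apply scaleR_fun_def differential_def)
  qed
  ultimately show "\<forall>l\<in>I. a l = 0" unfolding indep_family_def by blast
qed

lemma tindep_cong:
  assumes "tindep p I \<alpha>" "\<And>i. i \<in> I \<Longrightarrow> \<alpha> i = \<alpha>' i"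
  shows "tindep p I \<alpha>'"
proof -
  have "(\<Sum>i\<in>I. a i * \<alpha>' i v) = (\<Sum>i\<in>I. a i * \<alpha> i v)" for a v
    by (rule sum.cong) (simp_all add: assms(2))
  then show ?thesis using assms(1) by (simp add: tindep_def)
qed

text \<open>Solving the definition of the decceleration vector for the ranks:
  \<open>\<Delta>_k = rho_k\<close> and \<open>\<Delta>_j = rho_j + \<Delta>_{j+1}\<close>, so
  \<open>\<Delta>_j\<close> is a tail sum of \<open>\<tau>\<close>. Summing these jumps from the top
  level downwards gives the codimension of each bundle.\<close>

lemma deccel_dims:
  assumes k: "k = length \<tau>" "1 \<le> k" and dec: "map int \<tau> = deccel A V k"
    and top: "flag_rank A V k = n" and i: "i \<le> k"
  shows "flag_rank A V i + (\<Sum>j=Suc i..k. rho \<tau> j * (j - i)) = n"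
proof -
  let ?\<Delta> = "flag_diff A V"
  have last: "int (rho \<tau> k) = ?\<Delta> k"
  proof -
    have "int (rho \<tau> k) = map int \<tau> ! (k - 1)" using k by (simp add: rho_def)
    also have "\<dots> = ?\<Delta> k" unfolding dec deccel_def using k by (simp add: nth_append del: upt_Suc)
    finally show ?thesis .
  qed
  \<comment> \<open>The list of second differences starts with index 2, so its entry at position
    \<open>j - 1\<close> belongs to \<open>j + 1\<close>.\<close>
  have mid: "int (rho \<tau> j) = ?\<Delta> j - ?\<Delta> (Suc j)" if "1 \<le> j" "j < k" for j
  proof -
    have "int (rho \<tau> j) = map int \<tau> ! (j - 1)" using k that by (simp add: rho_def)
    also have "\<dots> = ?\<Delta> j - ?\<Delta> (Suc j)"
    proof -
      have "j - 1 < k - 1" using that by linarith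
      then show ?thesis unfolding dec deccel_def using that by (simp add: nth_append del: upt_Suc)
    qed
    finally show ?thesis .
  qed
  have \<Delta>: "?\<Delta> j = int (\<Sum>l=j..k. rho \<tau> l)" if "1 \<le> j" "j \<le> k" for j
    using that(2,1)
  proof (induction rule: inc_induct)
    case base
    then show ?case by (simp add: last)
  next
    case (step m)
    then show ?case using mid[of m] by (simp add: sum.atLeast_Suc_atMost[of m k])
  qed
  show ?thesis
    using i
  proof (induction rule: inc_induct)
    case base
    then show ?case by (simp add: top)
  next
    case (step m)
    have "(\<Sum>j=Suc m..k. rho \<tau> j * (j - m)) = (\<Sum>j=Suc m..k. rho \<tau> j * (j - Suc m) + rho \<tau> j)"
    proof (rule sum.cong[OF refl])
      fix j assume "j \<in> {Suc m..k}"
      then have "j - m = Suc (j - Suc m)" by (simp add: Suc_diff_Suc Suc_le_eq)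
      then show "rho \<tau> j * (j - m) = rho \<tau> j * (j - Suc m) + rho \<tau> j" by simp
    qed
    also have "\<dots> = (\<Sum>j=Suc m..k. rho \<tau> j * (j - Suc m)) + (\<Sum>j=Suc m..k. rho \<tau> j)"
      by (rule sum.distrib)
    also have "(\<Sum>j=Suc m..k. rho \<tau> j * (j - Suc m)) = (\<Sum>j=Suc (Suc m)..k. rho \<tau> j * (j - Suc m))"
      using step.hyps by (simp add: sum.atLeast_Suc_atMost[of "Suc m" k])
    finally have "(\<Sum>j=Suc m..k. rho \<tau> j * (j - m)) =
        (\<Sum>j=Suc (Suc m)..k. rho \<tau> j * (j - Suc m)) + (\<Sum>j=Suc m..k. rho \<tau> j)" .
    moreover have "int (flag_rank A V (Suc m)) - int (flag_rank A V m) = int (\<Sum>j=Suc m..k. rho \<tau> j)"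
      using \<Delta>[of "Suc m"] step.hyps by (simp add: flag_diff_def)
    ultimately show ?case using step.IH by linarith
  qed
qed

text \<open>The rank \<open>c + q\<close> bundle \<open>B\<close> behind the singular sub-bundle
  lies in the resolvent, so \<open>dx\<close> and \<open>df\<close> kill it. Since \<open>y\<close>
  is transversal to \<open>ker dx\<close>, the kernel of \<open>dx\<close> in \<open>W p\<close> has
  dimension \<open>c + q\<close> as well and equals \<open>B p\<close>.\<close>

lemma weber_kernel:
  assumes weber: "weber_structure A c q W Bh" and p: "y \<in> W p" "y x \<noteq> 0"
    and ann: "\<And>f. f \<in> S \<Longrightarrow> differential A f p \<in> annihilator A (resolvent_bundle A W Bh) p"
    and S: "x \<in> S" "f \<in> S" and v: "v \<in> W p" "v x = 0"
  shows "v f = 0"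
proof -
  have W: "subbundle A (c + q + 1) W" and Bh: "quot_subbundle A c q W Bh"
    using weber by (auto simp: weber_structure_def)
  have WT: "W p \<subseteq> T p" "subspace (W p)" "dim (W p) = c + q + 1" using W by (auto simp: subbundle_def)
  obtain B where "subbundle A (c + q) B"
    and B: "\<forall>p. cauchy_bundle A W p \<subseteq> B p \<and> B p \<subseteq> W p \<and> Bh p = quot (cauchy_bundle A W p) ` B p"
    using Bh unfolding quot_subbundle_def by blast
  then have Bp: "subspace (B p)" "dim (B p) = c + q" by (auto simp: subbundle_def)
  have BR: "B p \<subseteq> resolvent_bundle A W Bh p" using B by (auto simp: resolvent_bundle_def)
  have kill: "u f = 0" if "u \<in> B p" "f \<in> S" for u f
  proof -
    have "differential A f p u = 0" using ann[OF that(2)] BR that(1) by (auto simp: annihilator_def)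
    moreover have "u \<in> T p" using that(1) B WT by blast
    ultimately show ?thesis by (simp add: differential_def)
  qed
  have "B p = {v \<in> W p. v x = 0}"
  proof (rule tangent_subspace_eq)
    show "B p \<subseteq> {v \<in> W p. v x = 0}" using kill S(1) B by blast
    show "subspace {v \<in> W p. v x = 0}" using WT(2) by (auto simp: subspace_def scaleR_fun_def)
    show "dim {v \<in> W p. v x = 0} \<le> dim (B p)"
      using tangent_hyperplane_dim[OF WT(1,2) p] WT(3) Bp(2) by simp
  qed (use WT Bp in auto)
  then show ?thesis using kill[OF _ S(2)] v by blast
qed

end

lemma zset_top: "k = length \<tau> \<Longrightarrow> 1 \<le> k \<Longrightarrow> zset \<tau> (k - 1) = (\<lambda>l. CZ l k 0) ` {1..rho \<tau> k}"
  using zset_pred[of k \<tau>] by (auto simp: zset'_def)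

theorem theorem4p2:
  fixes A :: "('m::{t2_space,second_countable_topology}, 'e::euclidean_space) chart set"
    and V :: "'m tbundle"
    and \<tau> :: "nat list" and k :: nat
    and U :: "'m set"
    and x :: "'m \<Rightarrow> real" and \<phi> :: "nat \<Rightarrow> nat \<Rightarrow> 'm \<Rightarrow> real"
  assumes "smooth_atlas A"
    and "k = length \<tau>"
    and "goursat_bundle A V \<tau>"
    and "rho \<tau> k \<ge> 2"
    and "open U"
    and "fundamental_top A V k (rho \<tau> k) U ((\<lambda>l. \<phi> l k)(0 := x))"
    and "\<And>j. 1 \<le> j \<Longrightarrow> j \<le> k - 1 \<Longrightarrow> rho \<tau> j > 0 \<Longrightarrow>
           fundamental_lower A V j (rho \<tau> j) U (\<lambda>l. \<phi> l j)"
  shows "\<exists>Uh Y. open Uh \<and> Uh \<subseteq> U \<and> U \<subseteq> closure Uh \<and> Y \<in> sections A V \<and>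
           (\<forall>p\<in>Uh. Y p x \<noteq> 0) \<and>
           contact_coordinates_on A V \<tau> Uh (prolonged_coords Y x \<phi>)"
proof -
  interpret manifold A by standard (fact assms(1))
  let ?f = "(\<lambda>l. \<phi> l k)(0 := x)"
  let ?n = "rho \<tau> k"
  have k: "1 \<le> k" "1 \<le> ?n" and reg: "regular_bundle A V" and top: "derived_flag A k V = tangent_space A"
    and dec: "map int \<tau> = deccel A V k"
    using assms(3) unfolding goursat_bundle_def Let_def totally_regular_def assms(2)[symmetric] by auto
  obtain \<beta> :: "pp_index \<Rightarrow> 'e" where \<beta>: "bij_betw \<beta> (pp_indices \<tau>) Basis"
    using assms(3) unfolding goursat_bundle_def Let_def by blast
  obtain r where r: "subbundle A r V" using reg by (auto simp: regular_bundle_def)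
  have filled: "filled V" by (rule subbundle_filled[OF r])
  note dimF = derived_flag_dim[OF reg filled]
  have "flag_rank A V k = DIM('e)"
    using dimF[of k] tangent_dim_total top by metis
  note dims = deccel_dims[OF assms(2) k(1) dec this]
  obtain c q Bh where weber: "weber_structure A c q (derived_flag A (k - 1) V) Bh"
    and fU: "\<forall>p\<in>U. inj_on (\<lambda>l. differential A (?f l) p) {..?n} \<and>
       independent ((\<lambda>l. differential A (?f l) p) ` {..?n}) \<and>
       span ((\<lambda>l. differential A (?f l) p) ` {..?n}) =
         annihilator A (resolvent_bundle A (derived_flag A (k - 1) V) Bh) p"
    using assms(6) unfolding fundamental_top_def by blast
  have fs: "smooth_fun_on A U (?f l)" if "l \<le> ?n" for l
    using assms(6) that unfolding fundamental_top_def by blast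
  have xs: "smooth_fun_on A U x" using fs[of 0] by simp
  have \<phi>s: "smooth_fun_on A U (\<phi> l j)" if "1 \<le> j" "j \<le> k" "1 \<le> l" "l \<le> rho \<tau> j" for l j
  proof (cases "j = k")
    case True
    then show ?thesis using fs[of l] that by (auto split: if_splits)
  next
    case False
    then show ?thesis using assms(7)[of j] that by (auto simp: fundamental_lower_def)
  qed
  have find: "tindep p {..?n} (\<lambda>l v. v (?f l))" if "p \<in> U" for p
    using fU that by (intro tindep_differentials) auto
  have dx: "\<exists>v\<in>T p. v x \<noteq> 0" if "p \<in> U" for p
  proof (rule ccontr)
    assume "\<not> ?thesis"
    then have "(\<Sum>l\<le>?n. (if l = 0 then 1 else 0) * v (?f l)) = 0" if "v \<in> T p" for v
      using that by (intro sum.neutral) auto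
    from tindepD[OF find[OF that] this, of 0] show False by simp
  qed
  \<comment> \<open>Were \<open>dx\<close> to annihilate \<open>V\<close> on an open set, it would
    annihilate the whole flag there, hence the tangent space, although it is a member of an
    independent family.\<close>
  have dense: "\<exists>p\<in>N. \<exists>v\<in>V p. v x \<noteq> 0" if N: "open N" "N \<noteq> {}" "N \<subseteq> U" for N
  proof (rule ccontr)
    assume no: "\<not> ?thesis"
    obtain p where p: "p \<in> N" using N by blast
    obtain v where v: "v \<in> T p" "v x \<noteq> 0" using dx p N by blast
    have "v x = 0"
      by (rule flag_kills_on_open[OF filled N(1) _ smooth_fun_on_subset[OF xs N(1,3)] p, of v k])
         (use no v(1) top in auto)
    with v show False by simp
  qed
  obtain Y where Y: "Y \<in> sections A V"
    and Yd: "\<forall>N. open N \<longrightarrow> N \<noteq> {} \<longrightarrow> N \<subseteq> U \<longrightarrow> (\<exists>p\<in>N. Y p x \<noteq> 0)"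
    using generic_section[OF r assms(5) xs dense] by blast
  define W where "W = U \<inter> (\<lambda>p. Y p x) -` (- {0})"
  have W: "open W"
    unfolding W_def
    by (rule continuous_open_preimage[OF smooth_fun_on_continuous[OF vector_field_smooth[OF sectionsD(1)[OF Y] xs]] assms(5)]) auto
  have WU: "W \<subseteq> U" by (auto simp: W_def)
  \<comment> \<open>A missed point would lie in the nonempty open set \<open>U - closure W\<close>,
    where the genericity of \<open>Y\<close> provides a point of \<open>W\<close>.\<close>
  have cl: "U \<subseteq> closure W"
  proof
    fix p assume p: "p \<in> U"
    show "p \<in> closure W"
    proof (rule ccontr)
      assume "p \<notin> closure W"
      then have "U - closure W \<noteq> {}" "open (U - closure W)" using p assms(5) by auto
      then obtain q where "q \<in> U - closure W" "Y q x \<noteq> 0" using Yd by blast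
      then show False using closure_subset[of W] by (auto simp: W_def)
    qed
  qed
  interpret prolongation A V \<tau> k U W x \<phi> Y
  proof
    show "dim (derived_flag A i V p) + (\<Sum>j=Suc i..k. rho \<tau> j * (j - i)) = DIM('e)" if "i \<le> k" for i p
      using dims[OF that] dimF by simp
    show "Y p x \<noteq> 0" if "p \<in> W" for p using that by (simp add: W_def)
    show "smooth_fun_on A W x" by (rule smooth_fun_on_subset[OF xs W WU])
    show "smooth_fun_on A W (\<phi> l j)" if "1 \<le> j" "j \<le> k" "1 \<le> l" "l \<le> rho \<tau> j" for j l
      by (rule smooth_fun_on_subset[OF \<phi>s[OF that] W WU])
    show "tindep p (insert CX (zset \<tau> (k - 1))) (\<lambda>\<xi> v. v (prolonged_coords Y x \<phi> \<xi>))" if "p \<in> W" for p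
    proof (rule tindep_cong)
      \<comment> \<open>Matches the two numberings of the functions of order \<open>k\<close>: label
        0 for \<open>x\<close>, label \<open>l\<close> for \<open>\<phi> l k\<close>.\<close>
      define e where "e \<xi> = (case \<xi> of CX \<Rightarrow> 0 | CZ l j s \<Rightarrow> l)" for \<xi>
      have "bij_betw e (insert CX (zset \<tau> (k - 1))) {..?n}"
        unfolding zset_top[OF assms(2) k(1)]
        by (rule bij_betw_byWitness[where f' = "\<lambda>l. if l = 0 then CX else CZ l k 0"]) (auto simp: e_def)
      from tindep_reindex[OF this find] that WU
      show "tindep p (insert CX (zset \<tau> (k - 1))) (\<lambda>\<xi> v. v (?f (e \<xi>)))" by blast
      show "(\<lambda>v. v (?f (e \<xi>))) = (\<lambda>v. v (prolonged_coords Y x \<phi> \<xi>))" if "\<xi> \<in> insert CX (zset \<tau> (k - 1))" for \<xi>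
        using that unfolding zset_top[OF assms(2) k(1)] by (auto simp: e_def)
    qed
    show "v (\<phi> l k) = 0"
      if p: "p \<in> W" and v: "v \<in> derived_flag A (k - 1) V p" "v x = 0" and l: "1 \<le> l" "l \<le> ?n" for p v l
    proof (rule weber_kernel[OF weber, where S = "?f ` {..?n}" and v = v and f = "\<phi> l k" and x = x and y = "Y p"])
      \<comment> \<open>\<open>Y p\<close> serves as the transversal vector: it lies in
        \<open>V p\<close>, hence in every later bundle of the flag.\<close>
      show "Y p \<in> derived_flag A (k - 1) V p"
        using sectionsD(2)[OF Y, of p] derived_flag_mono[of 0 "k - 1" V p] by (auto simp: derived_flag_0)
      show "Y p x \<noteq> 0" using p by (simp add: W_def)
      show "differential A g p \<in> annihilator A (resolvent_bundle A (derived_flag A (k - 1) V) Bh) p"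
        if g: "g \<in> ?f ` {..?n}" for g
      proof -
        obtain l where l: "l \<in> {..?n}" "g = ?f l" using g by blast
        have "span ((\<lambda>l. differential A (?f l) p) ` {..?n}) =
            annihilator A (resolvent_bundle A (derived_flag A (k - 1) V) Bh) p"
          using bspec[OF fU subsetD[OF WU p]] by (elim conjE)
        moreover have "differential A (?f l) p \<in> span ((\<lambda>l. differential A (?f l) p) ` {..?n})"
          using l(1) by (intro span_base imageI)
        ultimately show ?thesis unfolding l(2) by (rule subst)
      qed
      show "x \<in> ?f ` {..?n}" by (rule image_eqI[of _ _ 0]) auto
      show "\<phi> l k \<in> ?f ` {..?n}" using l by (intro image_eqI[of _ _ l]) auto
    qed (fact v)+
  qed (use filled assms(2,7) k W WU Y in auto)
  have "contact_coordinates_on A V \<tau> W (prolonged_coords Y x \<phi>)"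
    by (rule contact_coordinates[OF \<beta>])
  then show ?thesis
    using W WU cl Y by (intro exI[of _ W] exI[of _ Y]) (auto simp: W_def)
qed


end
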